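(* Let $0<\alpha<1$, $n-1<d<n$, $1\le p<\infty$. (i) If $p<\frac{n\alpha}{d}$, $U\subset\mathbb{R}^n$ is open and bounded with $\dim_{\mathrm{box}}\partial U=d$, and $u_k\in C^{0,\alpha}(U;\mathbb{R}^n)$ ($k\in\mathbb{N}$) with $u_k\to u$ in $C^{0,\alpha}(U;\mathbb{R}^n)$, then $\deg(u_k,U,\cdot)\to\deg(u,U,\cdot)$ in $L^p(\mathbb{R}^n)$. (ii) If $p>\frac{n\alpha}{d}$, there exist an open bounded set $U\subset\mathbb{R}^n$ with $\dim_{\mathrm{box}}\partial U=d$ and a sequence $u_k\in C^{0,\alpha}(U;\mathbb{R}^n)$ with $\deg(u_k,U,\cdot)\in L^p(\mathbb{R}^n)$, $u_k\to0$ in $C^{0,\alpha}(U;\mathbb{R}^n)$ and $\|\deg(u_k,U,\cdot)\|_{L^p(\mathbb{R}^n)}\to\infty$.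
   Context: For $A\subset\mathbb{R}^n$, $[f]_{C^{0,\alpha}(A)}=\sup_{x,y\in A,\,x\ne y}\frac{|f(x)-f(y)|}{|x-y|^\alpha}$ and $\|f\|_{C^{0,\alpha}(A)}=\sup_{A}|f|+[f]_{C^{0,\alpha}(A)}$; $C^{0,\alpha}(A)$ is the space of functions for which this norm is finite. A function $u\in C^{0,\alpha}(U;\mathbb{R}^n)$ is identified with its unique continuous extension to $\overline U$. Box dimension: for a bounded set $E\subset\mathbb{R}^n$, let $N_r(E)$ be the number of $n$-dimensional boxes (cubes) of side length $r$ required to cover $E$; then $\dim_{\mathrm{box}}E=\lim_{r\to0}\frac{\log N_r(E)}{-\log r}$, if this limit exists. The statement $\dim_{\mathrm{box}}\partial U=d$ means the limit exists and equals $d$. Brouwer degree: for $U\subset\mathbb{R}^n$ bounded and open and $u\in C^\infty(\overline U;\mathbb{R}^n)$, $y\in\mathbb{R}^n\setminus u(\partial U)$, $\deg(u,U,y)=\int_U u^*(\mu)$, where $\mu$ is any smooth $n$-form with support in the connected component of $\mathbb{R}^n\setminus u(\partial U)$ containing $y$ and $\int_{\mathbb{R}^n}\mu=1$; for $u\in C^0(\overline U;\mathbb{R}^n)$ it is defined by approximation. The function $\deg(u,U,\cdot)$ is defined on $\mathbb{R}^n\setminus u(\partial U)$; the assertion that it lies in $L^p(\mathbb{R}^n)$ includes that it is defined almost everywhere. *)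

theory Defs
  imports "HOL-Analysis.Analysis"
begin

section \<open>Hoelder spaces\<close>

definition holder_seminorm ::
    "real \<Rightarrow> 'a::real_normed_vector set \<Rightarrow> ('a \<Rightarrow> 'b::real_normed_vector) \<Rightarrow> ennreal" where
  "holder_seminorm \<alpha> A f =
     (SUP (x, y) \<in> {(x, y). x \<in> A \<and> y \<in> A \<and> x \<noteq> y}.
        ennreal (norm (f x - f y) / norm (x - y) powr \<alpha>))"

definition holder_norm ::
    "real \<Rightarrow> 'a::real_normed_vector set \<Rightarrow> ('a \<Rightarrow> 'b::real_normed_vector) \<Rightarrow> ennreal" where
  "holder_norm \<alpha> A f = (SUP x\<in>A. ennreal (norm (f x))) + holder_seminorm \<alpha> A f"

definition holder_space ::
    "real \<Rightarrow> 'a::real_normed_vector set \<Rightarrow> ('a \<Rightarrow> 'b::real_normed_vector) set" where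
  "holder_space \<alpha> A = {f. holder_norm \<alpha> A f < \<infinity>}"

definition tendsto_holder ::
    "real \<Rightarrow> 'a::real_normed_vector set \<Rightarrow> (nat \<Rightarrow> 'a \<Rightarrow> 'b::real_normed_vector) \<Rightarrow> ('a \<Rightarrow> 'b) \<Rightarrow> bool"
  where
  "tendsto_holder \<alpha> A u v \<longleftrightarrow>
     (\<forall>k. u k \<in> holder_space \<alpha> A) \<and> v \<in> holder_space \<alpha> A \<and>
     (\<lambda>k. holder_norm \<alpha> A (\<lambda>x. u k x - v x)) \<longlonglongrightarrow> 0"

text \<open>
  The extension is unique on the closure of \<open>U\<close>; its values elsewhere are arbitrary,
  and nothing below depends on them.
\<close>

definition cont_ext ::
    "'a::topological_space set \<Rightarrow> ('a \<Rightarrow> 'b::topological_space) \<Rightarrow> 'a \<Rightarrow> 'b" where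
  "cont_ext U u = (SOME v. continuous_on (closure U) v \<and> (\<forall>x\<in>U. v x = u x))"


section \<open>Box dimension\<close>

definition box_number :: "real \<Rightarrow> 'a::euclidean_space set \<Rightarrow> nat" where
  "box_number r E =
     (LEAST m. \<exists>A. finite A \<and> card A = m \<and> E \<subseteq> (\<Union>a\<in>A. cbox a (a + r *\<^sub>R One)))"

text \<open>
  Meant for bounded \<open>E\<close>. Since \<open>ln 0 = 0\<close>, the empty set gets dimension \<open>0\<close>.
\<close>

definition has_box_dim :: "'a::euclidean_space set \<Rightarrow> real \<Rightarrow> bool" where
  "has_box_dim E d \<longleftrightarrow>
     ((\<lambda>r. ln (real (box_number r E)) / (- ln r)) \<longlongrightarrow> d) (at_right 0)"


section \<open>Smooth maps\<close>

text \<open>\<open>Ck_on k f S\<close> is meant for open \<open>S\<close>.\<close>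

fun Ck_on ::
    "nat \<Rightarrow> ('a::real_normed_vector \<Rightarrow> 'b::real_normed_vector) \<Rightarrow> 'a set \<Rightarrow> bool" where
  "Ck_on 0 f S \<longleftrightarrow> continuous_on S f"
| "Ck_on (Suc k) f S \<longleftrightarrow>
     (\<forall>x\<in>S. f differentiable (at x)) \<and>
     (\<forall>h. Ck_on k (\<lambda>x. frechet_derivative f (at x) h) S)"

definition smooth_on ::
    "('a::real_normed_vector \<Rightarrow> 'b::real_normed_vector) \<Rightarrow> 'a set \<Rightarrow> bool" where
  "smooth_on f S \<longleftrightarrow> (\<forall>k. Ck_on k f S)"

text \<open>The space of smooth maps on the closure of \<open>U\<close>: smooth in some open neighbourhood of it.\<close>

definition smooth_closure ::
    "'a::real_normed_vector set \<Rightarrow> ('a \<Rightarrow> 'b::real_normed_vector) set" where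
  "smooth_closure U = {u. \<exists>W. open W \<and> closure U \<subseteq> W \<and> smooth_on u W}"


section \<open>Brouwer degree\<close>

text \<open>
  The \<open>n\<close>-form \<open>\<mu> = \<phi> dy\<^sub>1 \<and> \<dots> \<and> dy\<^sub>n\<close> is represented by its density \<open>\<phi>\<close>, so that
  the pullback \<open>u\<^sup>*(\<mu>)\<close> has density \<open>\<phi> (u x) * det (Du x)\<close>.
\<close>

definition degree_test_form ::
    "(real^'n \<Rightarrow> real^'n) \<Rightarrow> (real^'n) set \<Rightarrow> real^'n \<Rightarrow> (real^'n \<Rightarrow> real) set" where
  "degree_test_form u U y =
     {\<phi>. smooth_on \<phi> UNIV \<and>
         closure {z. \<phi> z \<noteq> 0} \<subseteq> connected_component_set (- u ` frontier U) y \<and>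
         has_bochner_integral lborel \<phi> 1}"

definition smooth_degree ::
    "(real^'n \<Rightarrow> real^'n) \<Rightarrow> (real^'n) set \<Rightarrow> real^'n \<Rightarrow> real" where
  "smooth_degree u U y =
     (THE c. \<forall>\<phi> \<in> degree_test_form u U y.
        (LINT x:U|lborel. \<phi> (u x) * det (matrix (frechet_derivative u (at x)))) = c)"

text \<open>
  Continuous maps on the closure of \<open>U\<close> are treated by uniform approximation with smooth maps.
  The degree is undefined on \<open>u ` frontier U\<close>; the value \<open>0\<close> there only makes the function
  total, and \<open>degree_in_Lp\<close> requires that set to be null.
\<close>

definition brouwer_degree ::
    "(real^'n \<Rightarrow> real^'n) \<Rightarrow> (real^'n) set \<Rightarrow> real^'n \<Rightarrow> real" where
  "brouwer_degree u U y =
     (if y \<in> u ` frontier U then 0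
      else THE c. \<forall>v. (\<forall>k. v k \<in> smooth_closure U) \<and> uniform_limit (closure U) v u sequentially
             \<longrightarrow> (\<lambda>k. smooth_degree (v k) U y) \<longlonglongrightarrow> c)"


section \<open>Lebesgue spaces\<close>

definition Lp_space :: "real \<Rightarrow> ('a::euclidean_space \<Rightarrow> real) set" where
  "Lp_space p = {f. f \<in> borel_measurable lborel \<and> integrable lborel (\<lambda>x. \<bar>f x\<bar> powr p)}"

definition Lp_norm :: "real \<Rightarrow> ('a::euclidean_space \<Rightarrow> real) \<Rightarrow> real" where
  "Lp_norm p f = (LINT x|lborel. \<bar>f x\<bar> powr p) powr (1 / p)"

definition degree_in_Lp ::
    "real \<Rightarrow> (real^'n) set \<Rightarrow> (real^'n \<Rightarrow> real^'n) \<Rightarrow> bool" where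
  "degree_in_Lp p U u \<longleftrightarrow>
     u ` frontier U \<in> null_sets lborel \<and> brouwer_degree u U \<in> Lp_space p"

end

theory Submission
  imports Defs
begin

text \<open>
  Part (i). At the dyadic scale \<open>h\<close> let \<open>u_h\<close> be a grid interpolation of \<open>u\<close>, so that
  \<open>u_h - u\<close> is of order \<open>\<epsilon> = E h\<^sup>\<alpha>\<close>, and let \<open>d_h(y)\<close> be the integral of the Jacobian
  determinant of \<open>x \<mapsto> \<sigma>((u_h(x) - y)/\<epsilon>)\<close>, with \<open>\<sigma>\<close> a sigmoid in each coordinate, over the
  part of \<open>U\<close> at distance at least about \<open>h\<close> from the frontier. For \<open>y\<close> off \<open>u(\<partial>U)\<close> and small
  \<open>h\<close> this is the degree. Adding a compactly supported map to \<open>f\<close> does not change the integral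
  of \<open>det Df\<close>, so \<open>d_{h/2} - d_h\<close> is an integral over a strip of width of order \<open>h\<close> along
  \<open>\<partial>U\<close>; it is at most a constant times the number of those boxes, in a cover of \<open>\<partial>U\<close> by
  \<open>N_h\<close> boxes of side \<open>h\<close>, whose image comes within a multiple of \<open>\<epsilon>\<close> of \<open>y\<close>. Its \<open>L\<^sup>q\<close> norm to
  the power \<open>q\<close> is thus at most of order \<open>N_h\<^sup>q \<epsilon>\<^sup>n\<close>, about \<open>h\<close> to the power \<open>n\<alpha> - qd\<close>, and
  summing over the dyadic scales bounds the degree in \<open>L\<^sup>q\<close> for every \<open>q < n\<alpha>/d\<close>, uniformly
  on bounded sets of Hoelder functions. As \<open>deg(u_k,U,y)\<close> is eventually \<open>deg(u,U,y)\<close> for \<open>y\<close>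
  off the null set \<open>u(\<partial>U)\<close>, the bound for some \<open>q > p\<close> gives convergence in \<open>L\<^sup>p\<close>.

  Part (ii). The domain is a disjoint union of cubes of side \<open>2\<^sup>-\<^sup>k/2\<close>, about \<open>2\<^sup>k\<^sup>d\<close> of them
  for each \<open>k\<close>, with box dimension \<open>d\<close> of the frontier. The map \<open>v_k\<close> is zero except on the
  cubes of level \<open>k\<close>, each of which it maps affinely onto the same cube of side \<open>2\<^sup>-\<^sup>k\<^sup>\<beta>/2\<close>.
  Its degree is the number of these cubes on that image, so the \<open>L\<^sup>p\<close> norm tends to infinity
  if \<open>n\<beta> < pd\<close>, while \<open>v_k\<close> tends to zero in the Hoelder space if \<open>\<alpha> < \<beta>\<close>.
\<close>

section \<open>Determinants of compactly supported gradients\<close>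

text \<open>The degree of a continuous map is defined through limits of smooth maps and through test
  forms confined to one component of a complement. Both are removed by one formula: the degree is
  the integral of a Jacobian determinant, and comparing two such integrals comes down to the fact
  that the Jacobian determinant of a compactly supported map has integral 0. The sigmoid decouples
  the estimate from the size of \<epsilon>: the interpolation has gradient of order \<epsilon>/h,
  the sigmoid contributes 1/\<epsilon>, so the determinant is of order h^(-n) and each box of side h
  contributes a bounded amount. The strict inequality p < n\<alpha>/d leaves room for q, for box
  counts that only obey h^(-d') with d' > d, and for the weights spread over the scales; with p
  \<ge> 1 it gives d < n\<alpha>, which makes the image of the frontier a null set. In part (ii) the
  number of cubes is governed by \<gamma> = d - (n - 1): \<gamma> > 0 lets the finest cubes dominate
  the box count, \<gamma> < 1 keeps the total height of the layers finite, and p > n\<alpha>/d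
  leaves a \<beta> between \<alpha> and pd/n.\<close>

text \<open>
  The change of variables theorem in HOL-Analysis is restricted to wellordered index types;
  \<open>'a wo\<close> is a wellordered copy of a finite type.
\<close>

typedef 'a wo = "UNIV :: 'a set" by simp

instantiation wo :: (finite) "{finite, wellorder}"
begin

definition wo_rank :: "'a wo \<Rightarrow> nat" where
  "wo_rank = (SOME f. inj f)"

definition less_eq_wo :: "'a wo \<Rightarrow> 'a wo \<Rightarrow> bool" where
  "less_eq_wo x y \<longleftrightarrow> wo_rank x \<le> wo_rank y"

definition less_wo :: "'a wo \<Rightarrow> 'a wo \<Rightarrow> bool" where
  "less_wo x y \<longleftrightarrow> wo_rank x < wo_rank y"

instance
proof
  have fin: "finite (UNIV :: 'a wo set)"
    using type_definition.univ[OF type_definition_wo] by (metis finite finite_imageI)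
  show "finite (UNIV :: 'a wo set)" by (fact fin)
  have "\<exists>f::'a wo \<Rightarrow> nat. inj f"
    using finite_imp_inj_to_nat_seg[OF fin] by auto
  then have inj: "inj (wo_rank :: 'a wo \<Rightarrow> nat)"
    unfolding wo_rank_def by (rule someI_ex)
  fix x y z :: "'a wo" and P
  show "(x < y) = (x \<le> y \<and> \<not> y \<le> x)" by (auto simp: less_eq_wo_def less_wo_def)
  show "x \<le> x" by (simp add: less_eq_wo_def)
  show "x \<le> y \<Longrightarrow> y \<le> z \<Longrightarrow> x \<le> z" by (simp add: less_eq_wo_def)
  show "x \<le> y \<Longrightarrow> y \<le> x \<Longrightarrow> x = y" using inj by (simp add: less_eq_wo_def inj_eq)
  show "x \<le> y \<or> y \<le> x" by (auto simp: less_eq_wo_def)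
  assume "\<And>x::'a wo. (\<And>y. y < x \<Longrightarrow> P y) \<Longrightarrow> P x"
  then show "P z"
    by (rule measure_induct_rule[of wo_rank P z]) (auto simp: less_wo_def)
qed

end

section \<open>Determinants near the identity matrix\<close>

lemma det_pos_near_mat_1:
  "\<exists>d>0. \<forall>M::real^'n^'n. norm (M - mat 1) < d \<longrightarrow> det M > 0"
proof -
  have "continuous_on UNIV (det :: real^'n^'n \<Rightarrow> real)"
    unfolding det_def by (intro continuous_intros)
  then have "open (det -` {0<..} :: (real^'n^'n) set)"
    by (rule open_vimage[rotated]) auto
  moreover have "mat 1 \<in> (det -` {0<..} :: (real^'n^'n) set)" by (simp add: det_I)
  ultimately obtain e where "e > 0" "ball (mat 1) e \<subseteq> (det -` {0<..} :: (real^'n^'n) set)"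
    using open_contains_ball by blast
  then show ?thesis
    by (intro exI[of _ e]) (auto simp: dist_norm norm_minus_commute subset_iff)
qed

text \<open>The sum of the principal minors of size \<open>k\<close>: \<open>X\<close> is the set of
  rows taken from \<open>A\<close>, and a term survives only if \<open>p\<close> fixes every row
  outside \<open>X\<close>.\<close>

definition det_coeff :: "nat \<Rightarrow> real^'n^'n \<Rightarrow> real" where
  "det_coeff k A = (\<Sum>p | p permutes UNIV. \<Sum>X | card X = k.
     of_int (sign p) * (\<Prod>i\<in>X. A $ i $ p i) * (\<Prod>i\<in>UNIV - X. mat 1 $ i $ p i))"

lemma det_mat1_plus:
  fixes A :: "real^'n^'n"
  shows "det (mat 1 + s *\<^sub>R A) = (\<Sum>k\<le>CARD('n). det_coeff k A * s ^ k)"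
proof -
  have part: "(\<Sum>X\<in>UNIV. g X) = (\<Sum>k\<le>CARD('n). \<Sum>X | card X = k. g X)" for g :: "'n set \<Rightarrow> real"
    by (subst sum.group[symmetric, where T="{..CARD('n)}" and g=card])
       (auto simp: card_mono)
  have "det (mat 1 + s *\<^sub>R A) = (\<Sum>p | p permutes UNIV. of_int (sign p) *
          (\<Prod>i\<in>UNIV. s * A $ i $ p i + mat 1 $ i $ p i))"
    by (simp add: det_def add.commute)
  also have "\<dots> = (\<Sum>p | p permutes UNIV. of_int (sign p) *
          (\<Sum>X\<in>UNIV. (\<Prod>i\<in>X. s * A $ i $ p i) * (\<Prod>i\<in>UNIV - X. mat 1 $ i $ p i)))"
    by (subst prod_add) auto
  also have "\<dots> = (\<Sum>p | p permutes UNIV. \<Sum>k\<le>CARD('n). \<Sum>X | card X = k.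
      of_int (sign p) * (\<Prod>i\<in>X. A $ i $ p i) * (\<Prod>i\<in>UNIV - X. mat 1 $ i $ p i) * s ^ k)"
    unfolding part
    by (simp add: sum_distrib_left prod.distrib mult_ac)
  also have "\<dots> = (\<Sum>k\<le>CARD('n). det_coeff k A * s ^ k)"
    unfolding det_coeff_def by (subst sum.swap) (simp add: sum_distrib_right)
  finally show ?thesis .
qed

lemma det_coeff_top: "det_coeff CARD('n) (A::real^'n^'n) = det A"
proof -
  have "{X::'n set. card X = CARD('n)} = {UNIV}"
    using card_subset_eq[OF finite[of "UNIV::'n set"]] by auto
  then show ?thesis by (simp add: det_coeff_def det_def)
qed

lemma continuous_on_det_coeff:
  assumes "continuous_on S A"
  shows "continuous_on S (\<lambda>x. det_coeff k (A x :: real^'n^'n))"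
  unfolding det_coeff_def by (intro continuous_intros assms)

lemma top_coeff_zero_if_locally_constant:
  fixes c :: "nat \<Rightarrow> real"
  assumes "0 < e" "\<And>s. 0 < s \<Longrightarrow> s < e \<Longrightarrow> (\<Sum>k\<le>n. c k * s ^ k) = b" and "0 < n"
  shows "c n = 0"
proof -
  \<comment> \<open>Moving \<open>b\<close> into the constant term makes the polynomial vanish on an
    interval; \<open>0 < n\<close> keeps the top coefficient unchanged.\<close>
  define c' where "c' k = (if k = 0 then c 0 - b else c k)" for k
  have eq: "(\<Sum>k\<le>n. c' k * s ^ k) = (\<Sum>k\<le>n. c k * s ^ k) - b" for s
    by (simp add: c'_def sum.atMost_shift)
  have "\<not> finite {s. (\<Sum>k\<le>n. c' k * s ^ k) = 0}"
  proof
    assume fin: "finite {s. (\<Sum>k\<le>n. c' k * s ^ k) = 0}"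
    have "{0<..<e} \<subseteq> {s. (\<Sum>k\<le>n. c' k * s ^ k) = 0}"
      using assms(2) by (auto simp: eq)
    with fin have "finite {0<..<e}" by (rule finite_subset[rotated])
    with assms(1) show False by (simp add: infinite_Ioo)
  qed
  then have "\<forall>k\<le>n. c' k = 0"
    by (metis polyfun_rootbound_finite)
  with assms(3) show ?thesis by (auto simp: c'_def)
qed

lemma norm_matrix_vector_le:
  fixes A :: "real^'n^'m"
  shows "norm (A *v h) \<le> real CARD('m) * norm A * norm h"
proof -
  have "norm (A *v h) \<le> (\<Sum>i\<in>UNIV. \<bar>(A *v h) $ i\<bar>)" by (rule norm_le_l1_cart)
  also have "\<dots> \<le> (\<Sum>i\<in>(UNIV::'m set). norm A * norm h)"
  proof (rule sum_mono)
    fix i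
    have "\<bar>(A *v h) $ i\<bar> = \<bar>A $ i \<bullet> h\<bar>" by (simp add: matrix_vector_mul_component)
    also have "\<dots> \<le> norm (A $ i) * norm h" by (rule Cauchy_Schwarz_ineq2)
    also have "\<dots> \<le> norm A * norm h" by (intro mult_right_mono) (auto intro: Finite_Cartesian_Product.norm_nth_le)
    finally show "\<bar>(A *v h) $ i\<bar> \<le> norm A * norm h" .
  qed
  finally show ?thesis by simp
qed

text \<open>
  For small \<open>s > 0\<close>, \<open>x \<mapsto> x + s f(x)\<close> is a bijection of the box with positive Jacobian
  determinant, so the integral of \<open>det (1 + s A)\<close> is the volume of the box. Being a polynomial
  in \<open>s\<close>, it has vanishing top coefficient, which is the integral of \<open>det A\<close>.
\<close>

lemma integral_det_compact_support_wo:
  fixes f :: "real^'n::{finite,wellorder} \<Rightarrow> real^'n::_"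
  assumes der: "\<And>x. (f has_derivative (*v) (A x)) (at x)"
    and cont: "continuous_on UNIV A"
    and f0: "\<And>x. x \<notin> cbox a b \<Longrightarrow> f x = 0"
  shows "integral (cbox a b) (\<lambda>x. det (A x)) = 0"
proof -
  let ?B = "cbox a b"
  have A0: "A x = 0" if "x \<notin> ?B" for x
  proof -
    have "(f has_derivative (\<lambda>h. 0)) (at x)"
    proof (rule has_derivative_transform_within_open[where f="\<lambda>_. 0" and s="- ?B"])
      show "open (- ?B)" by (rule open_Compl[OF closed_cbox])
    qed (use that f0 in auto)
    with der have "(*v) (A x) = (\<lambda>h. 0)" by (rule has_derivative_unique)
    then show ?thesis by (metis matrix_eq matrix_vector_mult_0)
  qed
  have "compact (A ` ?B)"
    by (intro compact_continuous_image continuous_on_subset[OF cont]) auto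
  then obtain L0 where L0: "\<And>x. x \<in> ?B \<Longrightarrow> norm (A x) \<le> L0"
    by (meson bounded_iff compact_imp_bounded imageI)
  define L where "L = max L0 1"
  have L: "norm (A x) \<le> L" for x
    using L0[of x] A0[of x] by (cases "x \<in> ?B") (auto simp: L_def)
  have L1: "L \<ge> 1" by (simp add: L_def)
  define M where "M = real CARD('n) * L"
  have M: "M > 0" using L1 by (simp add: M_def)
  have onorm: "onorm ((*v) (A x)) \<le> M" for x
  proof (rule onorm_le)
    fix h
    have "norm (A x *v h) \<le> real CARD('n) * norm (A x) * norm h" by (rule norm_matrix_vector_le)
    also have "\<dots> \<le> M * norm h" unfolding M_def using L[of x] by (intro mult_right_mono) auto
    finally show "norm (A x *v h) \<le> M * norm h" .
  qed
  have lip: "norm (f x - f y) \<le> M * norm (x - y)" for x y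
    by (rule differentiable_bound[where S=UNIV and f'="\<lambda>x. (*v) (A x)"]) (use der onorm in auto)
  obtain d where d: "d > 0" "\<forall>N::real^'n::_^'n::_. norm (N - mat 1) < d \<longrightarrow> det N > 0"
    using det_pos_near_mat_1[where 'n='n] by (elim exE conjE)
  \<comment> \<open>\<open>s < 1 / M\<close> makes \<open>s f\<close> a contraction, so that
    \<open>x + s f(x)\<close> is a bijection; \<open>s < d / L\<close> keeps \<open>1 + s A\<close>
    in the ball around the identity where the determinant is positive.\<close>
  define e where "e = min (1 / M) (d / L)"
  have e: "e > 0" using M d L1 by (simp add: e_def)
  have vol: "(\<Sum>k\<le>CARD('n). integral ?B (\<lambda>x. det_coeff k (A x)) * s ^ k) = measure lebesgue ?B"
    if s: "0 < s" "s < e" for s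
  proof -
    define g where "g x = x + s *\<^sub>R f x" for x
    have sM: "s * M < 1" using s M by (simp add: e_def pos_less_divide_eq)
    have lips: "norm (s *\<^sub>R f x - s *\<^sub>R f y) \<le> s * M * norm (x - y)" for x y
      using mult_left_mono[OF lip[of x y], of s] s
      by (simp flip: scaleR_right_diff_distrib add: mult.assoc)
    have inj: "inj g"
    proof (rule injI)
      fix x y assume "g x = g y"
      moreover have "x - y = (g x - g y) + (s *\<^sub>R f y - s *\<^sub>R f x)" by (simp add: g_def)
      ultimately have "norm (x - y) = norm (s *\<^sub>R f x - s *\<^sub>R f y)"
        by (simp add: norm_minus_commute)
      with lips[of x y] have "(1 - s * M) * norm (x - y) \<le> 0" by (simp add: algebra_simps)
      with sM show "x = y" by (simp add: mult_le_0_iff)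
    qed
    have surj: "\<exists>x. g x = z" for z
    proof -
      have "\<exists>!x. z - s *\<^sub>R f x = x"
      proof (rule banach_fix_type[where c="s * M"])
        show "0 \<le> s * M" "s * M < 1" using s M sM by auto
        show "\<forall>x y. dist (z - s *\<^sub>R f x) (z - s *\<^sub>R f y) \<le> s * M * dist x y"
          using lips by (simp add: dist_norm norm_minus_commute)
      qed
      then obtain x where "z - s *\<^sub>R f x = x" by blast
      then show ?thesis by (intro exI[of _ x]) (simp add: g_def algebra_simps)
    qed
    have out: "g x = x" if "x \<notin> ?B" for x using f0[OF that] by (simp add: g_def)
    \<comment> \<open>\<open>g\<close> fixes every point outside the box, so injectivity keeps
      points of the box from leaving it.\<close>
    have img: "g ` ?B = ?B"
    proof (intro equalityI subsetI)
      fix y assume "y \<in> g ` ?B"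
      then obtain x where x: "x \<in> ?B" "y = g x" by blast
      show "y \<in> ?B"
      proof (rule ccontr)
        assume y: "y \<notin> ?B"
        then have "g y = g x" using out x by simp
        then have "y = x" using inj by (simp add: inj_eq)
        with x y show False by simp
      qed
    next
      fix z assume z: "z \<in> ?B"
      obtain x where x: "g x = z" using surj by blast
      with z out show "z \<in> g ` ?B" by (cases "x \<in> ?B") auto
    qed
    have derg: "(g has_derivative (*v) (mat 1 + s *\<^sub>R A x)) (at x within ?B)" for x
    proof -
      have "(g has_derivative (\<lambda>h. h + s *\<^sub>R (A x *v h))) (at x)"
        unfolding g_def by (intro derivative_intros der)
      moreover have "(\<lambda>h. h + s *\<^sub>R (A x *v h)) = (*v) (mat 1 + s *\<^sub>R A x)"
        by (rule ext) (simp add: matrix_vector_mult_add_rdistrib scaleR_matrix_vector_assoc)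
      ultimately show ?thesis by (simp add: has_derivative_at_withinI)
    qed
    have pos: "det (mat 1 + s *\<^sub>R A x) > 0" for x
    proof (rule d(2)[rule_format])
      have "norm (mat 1 + s *\<^sub>R A x - mat 1) = s * norm (A x)" using s by simp
      also have "\<dots> \<le> s * L" using L[of x] s by simp
      also have "\<dots> < d" using s L1 by (simp add: e_def pos_less_divide_eq)
      finally show "norm (mat 1 + s *\<^sub>R A x - mat 1) < d" .
    qed
    have "((\<lambda>x. \<bar>det (matrix ((*v) (mat 1 + s *\<^sub>R A x)))\<bar>) has_integral measure lebesgue ?B) ?B"
      using has_measure_differentiable_image[of ?B g "\<lambda>x. (*v) (mat 1 + s *\<^sub>R A x)" "measure lebesgue ?B"]
        derg inj img by (auto intro: inj_on_subset)
    then have 1: "((\<lambda>x. det (mat 1 + s *\<^sub>R A x)) has_integral measure lebesgue ?B) ?B"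
      using pos by (simp add: abs_of_pos)
    have "((\<lambda>x. \<Sum>k\<le>CARD('n). det_coeff k (A x) * s ^ k) has_integral
        (\<Sum>k\<le>CARD('n). integral ?B (\<lambda>x. det_coeff k (A x)) * s ^ k)) ?B"
      by (intro has_integral_sum has_integral_mult_left integrable_integral integrable_continuous
          continuous_on_det_coeff continuous_on_subset[OF cont]) auto
    with 1 show ?thesis unfolding det_mat1_plus by (rule has_integral_unique[rotated])
  qed
  have "integral ?B (\<lambda>x. det_coeff CARD('n) (A x)) = 0"
    by (rule top_coeff_zero_if_locally_constant[OF e vol]) auto
  then show ?thesis by (simp add: det_coeff_top)
qed

section \<open>Transfer from wellordered to arbitrary finite index types\<close>

text \<open>Conjugation by \<open>b\<close> carries the permutations of one index type to those of
  the other and preserves the sign.\<close>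

lemma det_reindex:
  fixes A :: "real^'n^'n" and b :: "'m::finite \<Rightarrow> 'n"
  assumes b: "bij b"
  shows "det (\<chi> i j. A $ b i $ b j) = det A"
proof -
  have inj: "inj b" "surj b" using b by (auto simp: bij_def)
  have mp: "map_permutation UNIV b p = b \<circ> p \<circ> inv b" for p
    using inj by (auto simp: map_permutation_def restrict_id_def fun_eq_iff)
  have sg: "sign (b \<circ> p \<circ> inv b) = sign p" if "p permutes UNIV" for p
    using sign_map_permutation[OF _ that finite, of b] inj by (simp add: mp)
  have "det (\<chi> i j. A $ b i $ b j) = (\<Sum>p | p permutes UNIV. of_int (sign p) * (\<Prod>i\<in>UNIV. A $ b i $ b (p i)))"
    by (simp add: det_def)
  also have "\<dots> = (\<Sum>p | p permutes UNIV. of_int (sign p) * (\<Prod>i\<in>UNIV. A $ i $ p i))"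
  proof (rule sum.reindex_bij_witness[where i="\<lambda>p. inv b \<circ> p \<circ> b" and j="\<lambda>p. b \<circ> p \<circ> inv b"])
    fix p :: "'m \<Rightarrow> 'm" assume "p \<in> {p. p permutes UNIV}"
    then have p: "p permutes UNIV" by simp
    show "inv b \<circ> (b \<circ> p \<circ> inv b) \<circ> b = p" using inj by (auto simp: fun_eq_iff)
    have "bij (b \<circ> p \<circ> inv b)" using b p by (intro bij_comp bij_imp_bij_inv permutes_bij)
    then show "b \<circ> p \<circ> inv b \<in> {p. p permutes UNIV}" by (auto intro: bij_imp_permutes)
    have "(\<Prod>i\<in>UNIV. A $ i $ (b \<circ> p \<circ> inv b) i) = (\<Prod>i\<in>UNIV. A $ b i $ (b \<circ> p \<circ> inv b) (b i))"
      using prod.reindex_bij_betw[OF b[folded bij_betw_def], of "\<lambda>i. A $ i $ (b \<circ> p \<circ> inv b) i"] by simp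
    then show "of_int (sign (b \<circ> p \<circ> inv b)) * (\<Prod>i\<in>UNIV. A $ i $ (b \<circ> p \<circ> inv b) i)
        = of_int (sign p) * (\<Prod>i\<in>UNIV. A $ b i $ b (p i))"
      using inj by (simp add: sg[OF p])
  next
    fix p :: "'n \<Rightarrow> 'n" assume "p \<in> {p. p permutes UNIV}"
    then have p: "p permutes UNIV" by simp
    show "b \<circ> (inv b \<circ> p \<circ> b) \<circ> inv b = p" using inj by (auto simp: fun_eq_iff surj_f_inv_f)
    have "bij (inv b \<circ> p \<circ> b)" using b p by (intro bij_comp bij_imp_bij_inv permutes_bij)
    then show "inv b \<circ> p \<circ> b \<in> {p. p permutes UNIV}" by (auto intro: bij_imp_permutes)
  qed
  finally show ?thesis by (simp add: det_def)
qed

lemma prod_Basis_cart: "(\<Prod>b\<in>Basis. f b) = (\<Prod>i\<in>UNIV. f (axis i 1 :: real^'n))"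
proof -
  have "bij_betw (\<lambda>i. axis i 1 :: real^'n) UNIV Basis"
    by (auto simp: bij_betw_def inj_on_def axis_eq_axis Basis_vec_def)
  then show ?thesis by (metis prod.reindex_bij_betw)
qed

lemma emeasure_lborel_box_cart:
  fixes l u :: "real^'n"
  assumes "\<And>i. l $ i \<le> u $ i"
  shows "emeasure lborel (box l u) = (\<Prod>i\<in>UNIV. ennreal (u $ i - l $ i))"
proof -
  have "emeasure lborel (box l u) = ennreal (\<Prod>b\<in>Basis. (u - l) \<bullet> b)"
    by (rule emeasure_lborel_box) (use assms in \<open>auto simp: Basis_vec_def inner_axis\<close>)
  also have "\<dots> = ennreal (\<Prod>i\<in>UNIV. u $ i - l $ i)"
    by (simp add: prod_Basis_cart inner_axis)
  finally show ?thesis using assms by (simp add: prod_ennreal)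
qed

text \<open>Lebesgue measure is determined by its values on boxes, and the preimage of a box is the
  box with its sides permuted.\<close>

lemma lborel_distr_reindex:
  fixes b :: "'n::finite \<Rightarrow> 'm::finite"
  assumes b: "bij b"
  shows "distr lborel borel (\<lambda>x::real^'m. \<chi> i. x $ b i) = lborel" (is "distr _ _ ?T = _")
proof (rule lborel_eqI[symmetric])
  have T: "?T \<in> borel_measurable borel"
    by (intro borel_measurable_continuous_onI continuous_intros)
  fix l u :: "real^'n" assume le: "\<And>b. b \<in> Basis \<Longrightarrow> l \<bullet> b \<le> u \<bullet> b"
  have le': "l $ i \<le> u $ i" for i
    using le[of "axis i 1"] by (simp add: inner_axis)
  have surj: "b (inv b i) = i" "inv b (b j) = j" for i j
    using b by (simp_all add: bij_def surj_f_inv_f)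
  have "(\<chi> i. x $ b i) \<in> box l u \<longleftrightarrow> x \<in> box (\<chi> i. l $ inv b i) (\<chi> i. u $ inv b i)" for x
  proof
    assume a: "(\<chi> i. x $ b i) \<in> box l u"
    have "l $ inv b j < x $ b (inv b j) \<and> x $ b (inv b j) < u $ inv b j" for j
      using a by (simp add: mem_box_cart)
    then show "x \<in> box (\<chi> i. l $ inv b i) (\<chi> i. u $ inv b i)" by (simp add: mem_box_cart surj)
  next
    assume a: "x \<in> box (\<chi> i. l $ inv b i) (\<chi> i. u $ inv b i)"
    have "l $ inv b (b i) < x $ b i \<and> x $ b i < u $ inv b (b i)" for i
      using a by (simp add: mem_box_cart)
    then show "(\<chi> i. x $ b i) \<in> box l u" by (simp add: mem_box_cart surj)
  qed
  then have "?T -` box l u = box (\<chi> i. l $ inv b i) (\<chi> i. u $ inv b i)" by blast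
  then have "emeasure (distr lborel borel ?T) (box l u) = (\<Prod>i\<in>UNIV. ennreal (u $ inv b i - l $ inv b i))"
    using T by (simp add: emeasure_distr emeasure_lborel_box_cart le')
  also have "\<dots> = (\<Prod>i\<in>UNIV. ennreal (u $ i - l $ i))"
    using prod.reindex_bij_betw[OF bij_imp_bij_inv[OF b], of "\<lambda>i. ennreal (u $ i - l $ i)"] by simp
  also have "\<dots> = ennreal (\<Prod>b\<in>Basis. (u - l) \<bullet> b)"
    using le' by (simp add: prod_Basis_cart inner_axis prod_ennreal)
  finally show "emeasure (distr lborel borel ?T) (box l u) = ennreal (\<Prod>b\<in>Basis. (u - l) \<bullet> b)" .
qed simp

lemma derivative_outside_support:
  fixes f :: "real^'n \<Rightarrow> real^'m"
  assumes der: "(f has_derivative (*v) A) (at x)" and "closed K" "x \<notin> K"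
    and f0: "\<And>x. x \<notin> K \<Longrightarrow> f x = 0"
  shows "A = 0"
proof -
  have "(f has_derivative (\<lambda>h. 0)) (at x)"
    by (rule has_derivative_transform_within_open[where f="\<lambda>_. 0" and s="- K"])
       (use assms in \<open>auto intro: open_Compl\<close>)
  with der have "(*v) A = (\<lambda>h. 0)" by (rule has_derivative_unique)
  then show ?thesis by (metis matrix_eq matrix_vector_mult_0)
qed

lemma det_0_cart [simp]: "det (0 :: real^'n^'n) = 0"
  by (rule det_zero_row(1)[of undefined]) (simp add: row_def vec_eq_iff)

text \<open>The coordinate maps \<open>T\<close> and \<open>T'\<close> carry \<open>f\<close> to a
  map over the wellordered index type. Its Jacobian matrix is a relabelling of \<open>A\<close>, and
  \<open>T\<close> preserves Lebesgue measure, so the two integrals agree.\<close>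

theorem integral_det_compact_support:
  fixes f :: "real^'n \<Rightarrow> real^'n"
  assumes der: "\<And>x. (f has_derivative (*v) (A x)) (at x)"
    and cont: "continuous_on UNIV A"
    and "compact K" and f0: "\<And>x. x \<notin> K \<Longrightarrow> f x = 0"
  shows "(LINT x|lborel. det (A x)) = 0"
proof -
  define b where "b = (Rep_wo :: 'n wo \<Rightarrow> 'n)"
  have b: "bij b" unfolding b_def
    using type_definition.Rep_inject[OF type_definition_wo] type_definition.Rep_range[OF type_definition_wo]
    by (auto simp: bij_def inj_def)
  have ib: "bij (inv b)" by (rule bij_imp_bij_inv[OF b])
  have surj: "b (inv b i) = i" "inv b (b j) = j" for i j
    using b by (simp_all add: bij_def surj_f_inv_f)
  define T :: "real^'n wo \<Rightarrow> real^'n" where "T x = (\<chi> i. x $ inv b i)" for x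
  define T' :: "real^'n \<Rightarrow> real^'n wo" where "T' x = (\<chi> i. x $ b i)" for x
  have linT: "bounded_linear T" "bounded_linear T'"
    unfolding linear_conv_bounded_linear[symmetric] T_def T'_def
    by (auto intro!: linearI simp: vec_eq_iff)
  define B where "B x = (\<chi> i j. A (T x) $ b i $ b j)" for x
  have contT: "continuous_on UNIV T"
    using linT(1) by (simp add: linear_continuous_on)
  have contAT: "continuous_on UNIV (\<lambda>x. A (T x))"
    by (rule continuous_on_compose2[OF cont contT]) auto
  have contB: "continuous_on UNIV B"
    unfolding B_def by (intro continuous_intros contAT)
  have derB: "((\<lambda>x. T' (f (T x))) has_derivative (*v) (B x)) (at x)" for x
  proof -
    have "((\<lambda>x. T' (f (T x))) has_derivative (\<lambda>h. T' (A (T x) *v T h))) (at x)"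
      by (rule bounded_linear.has_derivative[OF linT(2)])
         (rule has_derivative_compose[OF bounded_linear_imp_has_derivative[OF linT(1)] der])
    moreover have "(\<lambda>h. T' (A (T x) *v T h)) = (*v) (B x)"
    proof
      fix h
      have "(\<Sum>j\<in>UNIV. A (T x) $ b i $ j * h $ inv b j) = (\<Sum>j\<in>UNIV. A (T x) $ b i $ b j * h $ j)" for i
        using sum.reindex_bij_betw[OF b, of "\<lambda>j. A (T x) $ b i $ j * h $ inv b j"] by (simp add: surj)
      then show "T' (A (T x) *v T h) = B x *v h"
        by (simp add: vec_eq_iff T'_def T_def B_def matrix_vector_mult_def)
    qed
    ultimately show ?thesis by simp
  qed
  obtain c where c: "K \<subseteq> cbox (- c) c"
    using bounded_subset_cbox_symmetric[OF compact_imp_bounded[OF \<open>compact K\<close>]] by blast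
  let ?B = "cbox (T' (- c)) (T' c)"
  have out: "T x \<notin> K" if "x \<notin> ?B" for x
  proof
    assume "T x \<in> K"
    with c have "T x \<in> cbox (- c) c" by blast
    then have "(- c) $ b i \<le> T x $ b i \<and> T x $ b i \<le> c $ b i" for i by (simp add: mem_box_cart)
    then have "x \<in> ?B" by (simp add: mem_box_cart T_def T'_def surj)
    with that show False by simp
  qed
  have "T' 0 = 0" by (simp add: T'_def vec_eq_iff)
  then have 0: "integral ?B (\<lambda>x. det (B x)) = 0"
    using out f0 by (intro integral_det_compact_support_wo[OF derB contB]) simp
  have detB: "det (B x) = det (A (T x))" for x
    unfolding B_def by (rule det_reindex[OF b])
  have A0: "A y = 0" if "y \<notin> K" for y
    using derivative_outside_support[OF der _ that f0] \<open>compact K\<close> compact_imp_closed by blast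
  have contdet: "continuous_on S (\<lambda>x. det (A (T x)))" for S
    unfolding det_def by (intro continuous_intros continuous_on_subset[OF contAT]) auto
  have "set_integrable lborel ?B (\<lambda>x. det (A (T x)))"
    unfolding set_integrable_def by (intro borel_integrable_compact contdet) auto
  then have "(LINT x:?B|lborel. det (A (T x))) = 0"
    using 0 by (simp add: set_borel_integral_eq_integral detB)
  moreover have "(LINT x:?B|lborel. det (A (T x))) = (LINT x|lborel. det (A (T x)))"
    unfolding set_lebesgue_integral_def using out A0
    by (intro Bochner_Integration.integral_cong) (auto simp: indicator_def)
  moreover have "(LINT x|lborel. det (A (T x))) = (LINT x|distr lborel borel T. det (A x))"
    unfolding det_def
    by (rule integral_distr[symmetric])
       (auto intro!: borel_measurable_continuous_onI continuous_intros contT cont)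
  moreover have "distr lborel borel T = lborel"
    unfolding T_def by (rule lborel_distr_reindex[OF ib])
  ultimately show ?thesis by simp
qed

section \<open>Grid cutoff functions\<close>

text \<open>A closed ball of the maximum norm, which suits cutoffs that are products over the
  coordinates and the boxes in the definition of the box dimension.\<close>

definition cub :: "real^'n \<Rightarrow> real \<Rightarrow> (real^'n) set" where
  "cub x r = {z. \<forall>i. \<bar>z $ i - x $ i\<bar> \<le> r}"

lemma cub_eq_cbox: "cub x r = cbox (\<chi> i. x $ i - r) (\<chi> i. x $ i + r)"
  by (auto simp: set_eq_iff cub_def mem_box_cart abs_diff_le_iff)

lemma compact_cub: "compact (cub x r)"
  by (simp add: cub_eq_cbox)

lemma cub_self: "0 \<le> r \<Longrightarrow> x \<in> cub x r"
  by (simp add: cub_def)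

lemma cub_trans:
  assumes "y \<in> cub x r"
  shows "cub y s \<subseteq> cub x (r + s)"
proof
  fix z assume z: "z \<in> cub y s"
  have "\<bar>z $ i - x $ i\<bar> \<le> r + s" for i
  proof -
    have "\<bar>z $ i - y $ i\<bar> \<le> s" "\<bar>y $ i - x $ i\<bar> \<le> r" using z assms by (simp_all add: cub_def)
    then show ?thesis by linarith
  qed
  then show "z \<in> cub x (r + s)" by (simp add: cub_def)
qed

lemma cub_sym: "y \<in> cub x r \<longleftrightarrow> x \<in> cub y r"
  by (simp add: cub_def abs_minus_commute)

lemma cub_mono: "r \<le> s \<Longrightarrow> cub x r \<subseteq> cub x s"
  by (auto simp: cub_def intro: order_trans)

lemma cball_subset_cub: "cball x r \<subseteq> cub x r"
proof
  fix z assume "z \<in> cball x r"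
  then have "norm (z - x) \<le> r" by (simp add: dist_norm norm_minus_commute)
  then have "\<bar>z $ i - x $ i\<bar> \<le> r" for i
    using component_le_norm_cart[of "z - x" i] by simp
  then show "z \<in> cub x r" by (simp add: cub_def)
qed

lemma norm_le_cub: "z \<in> cub x r \<Longrightarrow> norm (z - x) \<le> real CARD('n) * r"
  for z x :: "real^'n"
proof -
  assume z: "z \<in> cub x r"
  have "norm (z - x) \<le> (\<Sum>i\<in>UNIV. \<bar>(z - x) $ i\<bar>)" by (rule norm_le_l1_cart)
  also have "\<dots> \<le> (\<Sum>i\<in>(UNIV::'n set). r)"
    using z by (intro sum_mono) (simp add: cub_def)
  finally show ?thesis by simp
qed

lemma bounded_cub: "bounded (cub x r)"
  by (simp add: compact_imp_bounded compact_cub)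

lemma cub_in_open:
  fixes K :: "(real^'n) set"
  assumes "open U" "compact K" "K \<subseteq> U"
  shows "\<exists>h>0. \<forall>x\<in>K. cub x h \<subseteq> U"
proof -
  obtain e where e: "e > 0" "\<And>x. x \<in> K \<Longrightarrow> ball x e \<subseteq> U"
    using assms by (metis compact_subset_open_imp_ball_epsilon_subset UN_subset_iff)
  define h where "h = e / (2 * real CARD('n))"
  have h: "h > 0" using e by (simp add: h_def)
  have "cub x h \<subseteq> U" if "x \<in> K" for x
  proof
    fix z assume "z \<in> cub x h"
    then have "norm (z - x) \<le> e / 2" using norm_le_cub[of z x h] by (simp add: h_def)
    then have "z \<in> ball x e" using e by (simp add: dist_norm norm_minus_commute)
    then show "z \<in> U" using e that by blast
  qed
  with h show ?thesis by blast
qed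

text \<open>
  Once differentiable cutoffs suffice, since only first derivatives enter the determinants.
  \<open>sig\<close> rises from 0 to 1 on \<open>{0..1}\<close>, and the integer translates of \<open>rho\<close> form a
  partition of unity. Primed functions are derivatives.
\<close>

definition pos_sq :: "real \<Rightarrow> real" where "pos_sq t = (max 0 t)\<^sup>2"

lemma pos_sq_deriv: "(pos_sq has_real_derivative 2 * max 0 t) (at t)"
proof -
  consider "t > 0" | "t < 0" | "t = 0" by linarith
  then show ?thesis
  proof cases
    case 1
    have "((\<lambda>t. t\<^sup>2) has_real_derivative 2 * max 0 t) (at t)"
      using 1 by (auto intro!: derivative_eq_intros)
    then show ?thesis
      by (rule has_field_derivative_transform_within_open[where S="{0<..}"]) (use 1 in \<open>auto simp: pos_sq_def\<close>)
  next
    case 2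
    have "((\<lambda>t. 0) has_real_derivative 2 * max 0 t) (at t)"
      using 2 by (auto intro!: derivative_eq_intros)
    then show ?thesis
      by (rule has_field_derivative_transform_within_open[where S="{..<0}"]) (use 2 in \<open>auto simp: pos_sq_def\<close>)
  next
    case 3
    have "((\<lambda>h. (pos_sq (0 + h) - pos_sq 0) / h) \<longlongrightarrow> 0) (at 0)"
    proof (rule Lim_null_comparison)
      show "eventually (\<lambda>h. norm ((pos_sq (0 + h) - pos_sq 0) / h) \<le> \<bar>h\<bar>) (at 0)"
        by (rule always_eventually) (auto simp: pos_sq_def max_def power2_eq_square)
      show "((\<lambda>h. \<bar>h\<bar>) \<longlongrightarrow> (0::real)) (at 0)" by (rule tendsto_eq_intros | simp)+
    qed
    then show ?thesis using 3 by (simp add: DERIV_def)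
  qed
qed

definition sig :: "real \<Rightarrow> real" where
  "sig t = 2 * (pos_sq t - 2 * pos_sq (t - 1/2) + pos_sq (t - 1))"

text \<open>The hat function over the unit interval with peak 2 at 1/2: its integral is 1, and the
  peak is the source of the factors 2 in the derivative bounds.\<close>

definition sig' :: "real \<Rightarrow> real" where
  "sig' t = 4 * (max 0 t - 2 * max 0 (t - 1/2) + max 0 (t - 1))"

lemma sig_deriv: "(sig has_real_derivative sig' t) (at t)"
proof -
  have 1: "((\<lambda>t. pos_sq (t - a)) has_real_derivative 2 * max 0 (t - a)) (at t)" for a
  proof -
    have d: "((\<lambda>t. t - a) has_real_derivative 1) (at t)" by (auto intro!: derivative_eq_intros)
    show ?thesis using DERIV_chain2[OF pos_sq_deriv d] by simp
  qed
  show ?thesis unfolding sig_def[abs_def]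
    by (rule derivative_eq_intros 1 pos_sq_deriv | simp add: sig'_def)+
qed

lemma sig_derivative [derivative_intros]:
  assumes "(g has_derivative g') (at x within S)"
  shows "((\<lambda>x. sig (g x)) has_derivative (\<lambda>h. sig' (g x) * g' h)) (at x within S)"
  using has_derivative_compose[OF assms sig_deriv[THEN has_field_derivative_imp_has_derivative]]
  by (simp add: mult.commute)

lemma sig_cont [continuous_intros]: "continuous_on S g \<Longrightarrow> continuous_on S (\<lambda>x. sig (g x))"
  unfolding sig_def pos_sq_def by (intro continuous_intros)

lemma sig'_cont [continuous_intros]: "continuous_on S g \<Longrightarrow> continuous_on S (\<lambda>x. sig' (g x))"
  unfolding sig'_def by (intro continuous_intros)

lemma sig_le0: "t \<le> 0 \<Longrightarrow> sig t = 0"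
  by (simp add: sig_def pos_sq_def)

lemma sig_ge1: "t \<ge> 1 \<Longrightarrow> sig t = 1"
  by (simp add: sig_def pos_sq_def power2_eq_square algebra_simps)

lemma sig'_out: "t \<le> 0 \<or> 1 \<le> t \<Longrightarrow> sig' t = 0"
  by (auto simp: sig'_def)

lemma sig'_bounds: "0 \<le> sig' t" "sig' t \<le> 2"
  by (auto simp: sig'_def max_def)

lemma sig_mono: "s \<le> t \<Longrightarrow> sig s \<le> sig t"
  by (rule DERIV_nonneg_imp_nondecreasing) (use sig_deriv sig'_bounds in blast)+

lemma sig_bounds: "0 \<le> sig t" "sig t \<le> 1"
proof -
  show "0 \<le> sig t" using sig_mono[of "min t 0" t] sig_le0[of "min t 0"] by simp
  show "sig t \<le> 1" using sig_mono[of t "max t 1"] sig_ge1[of "max t 1"] by simp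
qed

definition rho :: "real \<Rightarrow> real" where "rho t = sig (t + 1) - sig t"
definition rho' :: "real \<Rightarrow> real" where "rho' t = sig' (t + 1) - sig' t"

lemma rho_derivative [derivative_intros]:
  assumes "(g has_derivative g') (at x within S)"
  shows "((\<lambda>x. rho (g x)) has_derivative (\<lambda>h. rho' (g x) * g' h)) (at x within S)"
  unfolding rho_def rho'_def by (rule derivative_eq_intros assms | simp add: algebra_simps)+

lemma rho_cont [continuous_intros]: "continuous_on S g \<Longrightarrow> continuous_on S (\<lambda>x. rho (g x))"
  unfolding rho_def by (intro continuous_intros)

lemma rho'_cont [continuous_intros]: "continuous_on S g \<Longrightarrow> continuous_on S (\<lambda>x. rho' (g x))"
  unfolding rho'_def by (intro continuous_intros)

lemma rho_bounds: "0 \<le> rho t" "rho t \<le> 1"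
  using sig_mono[of t "t + 1"] sig_bounds[of t] sig_bounds[of "t + 1"] by (auto simp: rho_def)

lemma rho'_bound: "\<bar>rho' t\<bar> \<le> 2"
  using sig'_bounds[of t] sig'_bounds[of "t + 1"] by (auto simp: rho'_def)

lemma rho_out: "1 \<le> \<bar>t\<bar> \<Longrightarrow> rho t = 0" "1 \<le> \<bar>t\<bar> \<Longrightarrow> rho' t = 0"
  by (auto simp: rho_def rho'_def sig_le0 sig_ge1 sig'_out abs_if split: if_splits)

text \<open>With \<open>s\<close> the fractional part of \<open>t\<close> the sum telescopes to
  \<open>sig (s + 1) - sig (s - 1)\<close>, which is 1 - 0. The derivatives telescope to 0 in the
  same way.\<close>

lemma rho_partition:
  fixes t :: real
  shows "rho (t - \<lfloor>t\<rfloor>) + rho (t - (\<lfloor>t\<rfloor> + 1)) = 1"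
    and rho'_partition: "rho' (t - \<lfloor>t\<rfloor>) + rho' (t - (\<lfloor>t\<rfloor> + 1)) = 0"
proof -
  have "t - \<lfloor>t\<rfloor> \<ge> 0" "t - \<lfloor>t\<rfloor> < 1" by linarith+
  then show "rho (t - \<lfloor>t\<rfloor>) + rho (t - (\<lfloor>t\<rfloor> + 1)) = 1" "rho' (t - \<lfloor>t\<rfloor>) + rho' (t - (\<lfloor>t\<rfloor> + 1)) = 0"
    by (simp_all add: rho_def rho'_def sig_le0 sig_ge1 sig'_out algebra_simps)
qed

section \<open>Bump functions on a cubic grid\<close>

definition grid_pt :: "real \<Rightarrow> ('n \<Rightarrow> int) \<Rightarrow> real^'n" where
  "grid_pt h a = (\<chi> i. h * of_int (a i))"

definition grid_bump :: "real \<Rightarrow> ('n \<Rightarrow> int) \<Rightarrow> real^'n \<Rightarrow> real" where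
  "grid_bump h a x = (\<Prod>i\<in>UNIV. rho (x $ i / h - of_int (a i)))"

text \<open>The gradient, with every component written as a single product over the coordinates, so
  that sums over corners factor as they do for \<open>grid_bump\<close>.\<close>

definition grid_bump' :: "real \<Rightarrow> ('n \<Rightarrow> int) \<Rightarrow> real^'n \<Rightarrow> real^'n" where
  "grid_bump' h a x = (\<chi> j. \<Prod>i\<in>UNIV. (if i = j then rho' (x $ i / h - of_int (a i)) / h
                                     else rho (x $ i / h - of_int (a i))))"

lemma has_derivative_grid_bump:
  "(grid_bump h a has_derivative (\<lambda>v. grid_bump' h a x \<bullet> v)) (at x)"
proof -
  have eq: "(\<Sum>i\<in>UNIV. (rho' (x $ i / h - of_int (a i)) * (v $ i / h)) *
         (\<Prod>j\<in>UNIV - {i}. rho (x $ j / h - of_int (a j)))) = grid_bump' h a x \<bullet> v" for v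
  proof -
    have "grid_bump' h a x $ i = rho' (x $ i / h - of_int (a i)) / h * (\<Prod>j\<in>UNIV - {i}. rho (x $ j / h - of_int (a j)))" for i
      unfolding grid_bump'_def by (subst prod.remove[of _ i]) (auto intro!: prod.cong)
    then show ?thesis by (simp add: inner_vec_def mult_ac)
  qed
  have nth: "((\<lambda>x. x $ i / h - of_int (a i)) has_derivative (\<lambda>v. v $ i / h)) (at x)" for i
    by (rule has_derivative_eq_rhs[OF has_derivative_diff[OF bounded_linear.has_derivative[OF bounded_linear_divide
      bounded_linear.has_derivative[OF bounded_linear_vec_nth has_derivative_ident]] has_derivative_const]]) simp
  have "(grid_bump h a has_derivative (\<lambda>v. \<Sum>i\<in>UNIV. (rho' (x $ i / h - of_int (a i)) * (v $ i / h)) *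
         (\<Prod>j\<in>UNIV - {i}. rho (x $ j / h - of_int (a j))))) (at x)"
    unfolding grid_bump_def[abs_def] by (intro has_derivative_prod rho_derivative nth)
  then show ?thesis by (simp only: eq)
qed

lemma grid_bump'_cont: "continuous_on S (grid_bump' h a)"
proof -
  have "continuous_on S (\<lambda>x. if i = j then rho' (x $ i / h - of_int (a i)) / h
     else rho (x $ i / h - of_int (a i)))" for i j
    by (cases "i = j"; simp; cases "h = 0") (auto intro!: continuous_intros)
  then show ?thesis unfolding grid_bump'_def[abs_def] by (intro continuous_intros)
qed

lemma grid_bump_cont: "continuous_on S (grid_bump h a)"
  by (rule has_derivative_continuous_on[OF has_derivative_at_withinI[OF has_derivative_grid_bump]])

lemma grid_bump_nonneg: "0 \<le> grid_bump h a x"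
  by (simp add: grid_bump_def prod_nonneg rho_bounds)

lemma near_grid:
  assumes "h > 0" "1 > \<bar>x $ i / h - of_int (a i)\<bar>"
  shows "\<bar>grid_pt h a $ i - x $ i\<bar> < h"
proof -
  have "\<bar>grid_pt h a $ i - x $ i\<bar> = h * \<bar>x $ i / h - of_int (a i)\<bar>"
    using assms(1) by (simp add: grid_pt_def abs_mult[symmetric] abs_minus_commute field_simps flip: abs_mult_pos)
  with assms show ?thesis by simp
qed

lemma grid_bump_nonzero:
  assumes "h > 0" "grid_bump h a x \<noteq> 0 \<or> grid_bump' h a x \<noteq> 0"
  shows "\<forall>i. \<bar>grid_pt h a $ i - x $ i\<bar> < h"
proof
  fix i
  have "\<bar>x $ i / h - of_int (a i)\<bar> < 1"
  proof (rule ccontr)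
    assume "\<not> ?thesis"
    then have "rho (x $ i / h - of_int (a i)) = 0" "rho' (x $ i / h - of_int (a i)) = 0"
      using rho_out by auto
    then have "grid_bump h a x = 0" "grid_bump' h a x $ j = 0" for j
      unfolding grid_bump_def grid_bump'_def vec_lambda_beta by (intro prod_zero bexI[of _ i]; auto)+
    then have "grid_bump h a x = 0" "grid_bump' h a x = 0" by (auto simp: vec_eq_iff)
    with assms(2) show False by simp
  qed
  with assms(1) show "\<bar>grid_pt h a $ i - x $ i\<bar> < h" by (rule near_grid)
qed

text \<open>
  The corners of the grid cell of \<open>x\<close>, the only grid points whose bumps are felt at \<open>x\<close>.
\<close>

definition nbrs :: "real \<Rightarrow> real^'n \<Rightarrow> ('n \<Rightarrow> int) set" where
  "nbrs h x = PiE UNIV (\<lambda>i. {\<lfloor>x $ i / h\<rfloor>, \<lfloor>x $ i / h\<rfloor> + 1})"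

lemma finite_nbrs: "finite (nbrs h x)"
  unfolding nbrs_def by (rule finite_PiE) auto

lemma card_nbrs: "card (nbrs h (x::real^'n)) = 2 ^ CARD('n)"
  unfolding nbrs_def by (subst card_PiE) (auto simp: card_insert_if numeral_2_eq_2)

lemma nbrs_memI:
  assumes "h > 0" "\<forall>i. \<bar>grid_pt h a $ i - x $ i\<bar> < h"
  shows "a \<in> nbrs h x"
proof -
  have "a i = \<lfloor>x $ i / h\<rfloor> \<or> a i = \<lfloor>x $ i / h\<rfloor> + 1" for i
  proof -
    have "\<bar>h * of_int (a i) - x $ i\<bar> < h" using assms(2) by (simp add: grid_pt_def)
    then have "\<bar>of_int (a i) - x $ i / h\<bar> < 1"
      using assms(1) by (simp add: abs_less_iff field_simps)
    then show ?thesis by linarith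
  qed
  then show ?thesis by (auto simp: nbrs_def)
qed

text \<open>Over the corners of the cell a sum of products is a product of sums over two
  neighbouring integers. In the first case all factors are 1; in the second the factor of coordinate
  \<open>j\<close> is 0.\<close>

lemma sum_nbrs:
  assumes "h > 0" "finite A" "nbrs h x \<subseteq> A"
  shows "(\<Sum>a\<in>A. grid_bump h a x) = 1" and "(\<Sum>a\<in>A. grid_bump' h a x) = 0"
proof -
  have "(\<Sum>a\<in>A. grid_bump h a x) = (\<Sum>a\<in>nbrs h x. grid_bump h a x)"
    using assms grid_bump_nonzero nbrs_memI by (intro sum.mono_neutral_right) blast+
  also have "\<dots> = (\<Prod>i\<in>UNIV. \<Sum>m\<in>{\<lfloor>x $ i / h\<rfloor>, \<lfloor>x $ i / h\<rfloor> + 1}. rho (x $ i / h - of_int m))"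
    unfolding nbrs_def grid_bump_def by (subst prod_sum_PiE) auto
  also have "\<dots> = 1" using rho_partition by (intro prod.neutral) auto
  finally show "(\<Sum>a\<in>A. grid_bump h a x) = 1" .
  have "(\<Sum>a\<in>A. grid_bump' h a x) = (\<Sum>a\<in>nbrs h x. grid_bump' h a x)"
    using assms grid_bump_nonzero nbrs_memI by (intro sum.mono_neutral_right) blast+
  also have "\<dots> = 0"
  proof (subst vec_eq_iff, intro allI)
    fix j
    have "(\<Sum>a\<in>nbrs h x. grid_bump' h a x) $ j = (\<Sum>a\<in>nbrs h x. grid_bump' h a x $ j)"
      by simp
    also have "\<dots> = (\<Prod>i\<in>UNIV. \<Sum>m\<in>{\<lfloor>x $ i / h\<rfloor>, \<lfloor>x $ i / h\<rfloor> + 1}.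
        (if i = j then rho' (x $ i / h - of_int m) / h else rho (x $ i / h - of_int m)))"
      unfolding nbrs_def grid_bump'_def by (subst prod_sum_PiE) auto
    also have "\<dots> = 0"
      using rho'_partition[of "x $ j / h"]
      by (intro prod_zero bexI[of _ j]) (auto simp flip: add_divide_distrib)
    finally show "(\<Sum>a\<in>nbrs h x. grid_bump' h a x) $ j = 0 $ j" by simp
  qed
  finally show "(\<Sum>a\<in>A. grid_bump' h a x) = 0" .
qed

lemma grid_bump'_bound:
  assumes "h > 0"
  shows "\<bar>grid_bump' h a x $ j\<bar> \<le> 2 / h"
proof -
  have "\<bar>grid_bump' h a x $ j\<bar> = (\<Prod>i\<in>UNIV. \<bar>if i = j then rho' (x $ i / h - of_int (a i)) / h
                                     else rho (x $ i / h - of_int (a i))\<bar>)"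
    by (simp add: grid_bump'_def abs_prod)
  also have "\<dots> \<le> (\<Prod>i\<in>UNIV. if i = j then 2 / h else 1)"
  proof (rule prod_mono)
    fix i
    have "\<bar>rho' (x $ i / h - of_int (a i)) / h\<bar> \<le> 2 / h" "\<bar>rho (x $ i / h - of_int (a i))\<bar> \<le> 1"
      using assms rho'_bound rho_bounds by (simp_all add: divide_right_mono)
    then show "0 \<le> \<bar>if i = j then rho' (x $ i / h - of_int (a i)) / h else rho (x $ i / h - of_int (a i))\<bar> \<and>
       \<bar>if i = j then rho' (x $ i / h - of_int (a i)) / h else rho (x $ i / h - of_int (a i))\<bar> \<le> (if i = j then 2 / h else 1)"
      by (cases "i = j") auto
  qed
  also have "\<dots> = 2 / h" by simp
  finally show ?thesis .
qed

lemma finite_grid: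
  assumes "h > 0" "bounded U"
  shows "finite {a :: 'n::finite \<Rightarrow> int. grid_pt h a \<in> U}"
proof -
  obtain B where B: "\<And>x. x \<in> U \<Longrightarrow> norm x \<le> B" using assms(2) by (auto simp: bounded_iff)
  have "{a :: 'n \<Rightarrow> int. grid_pt h a \<in> U} \<subseteq> PiE UNIV (\<lambda>_. {\<lfloor>- (B / h)\<rfloor> .. \<lceil>B / h\<rceil>})"
  proof
    fix a :: "'n \<Rightarrow> int" assume "a \<in> {a. grid_pt h a \<in> U}"
    then have "norm (grid_pt h a) \<le> B" using B by blast
    then have "\<bar>grid_pt h a $ i\<bar> \<le> B" for i
      using component_le_norm_cart[of "grid_pt h a" i] by linarith
    then have "\<bar>of_int (a i)\<bar> \<le> B / h" for i
      using assms(1) by (simp add: grid_pt_def abs_mult field_simps)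
    then have "\<lfloor>- (B / h)\<rfloor> \<le> a i \<and> a i \<le> \<lceil>B / h\<rceil>" for i
      by (smt (verit, best) ceiling_mono ceiling_of_int floor_mono floor_of_int)
    then show "a \<in> PiE UNIV (\<lambda>_. {\<lfloor>- (B / h)\<rfloor> .. \<lceil>B / h\<rceil>})" by auto
  qed
  then show ?thesis by (rule finite_subset) (auto intro: finite_PiE)
qed

text \<open>
  The margin \<open>3 * h\<close> provides room on both sides: \<open>cub x (4 * h) \<subseteq> U\<close> forces the value 1, and a
  nonzero value forces \<open>cub x (2 * h) \<subseteq> U\<close>.
\<close>

definition eta :: "real \<Rightarrow> (real^'n) set \<Rightarrow> real^'n \<Rightarrow> real" where
  "eta h U x = (\<Sum>a | cub (grid_pt h a) (3 * h) \<subseteq> U. grid_bump h a x)"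

definition eta' :: "real \<Rightarrow> (real^'n) set \<Rightarrow> real^'n \<Rightarrow> real^'n" where
  "eta' h U x = (\<Sum>a | cub (grid_pt h a) (3 * h) \<subseteq> U. grid_bump' h a x)"

lemma has_derivative_eta:
  "(eta h U has_derivative (\<lambda>v. eta' h U x \<bullet> v)) (at x)"
  unfolding eta_def[abs_def] eta'_def inner_sum_left by (intro has_derivative_sum has_derivative_grid_bump)

lemma eta'_cont: "continuous_on S (eta' h U)"
  unfolding eta'_def[abs_def] by (intro continuous_on_sum grid_bump'_cont)

lemma eta_cont: "continuous_on S (eta h U)"
  unfolding eta_def[abs_def] by (intro continuous_on_sum grid_bump_cont)

lemma finite_eta:
  assumes "h > 0" "bounded U"
  shows "finite {a. cub (grid_pt h a) (3 * h) \<subseteq> U}"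
proof (rule finite_subset[OF _ finite_grid[OF assms]])
  show "{a. cub (grid_pt h a) (3 * h) \<subseteq> U} \<subseteq> {a. grid_pt h a \<in> U}"
    using assms cub_self[of "3 * h"] by force
qed

lemma eta_nonneg: "0 \<le> eta h U x"
  unfolding eta_def by (intro sum_nonneg grid_bump_nonneg)

lemma eta_le_1:
  assumes "h > 0" "bounded U"
  shows "eta h U x \<le> 1"
proof -
  let ?A = "{a. cub (grid_pt h a) (3 * h) \<subseteq> U}"
  have fin: "finite ?A" by (rule finite_eta[OF assms])
  have "(\<Sum>a\<in>?A. grid_bump h a x) \<le> (\<Sum>a\<in>?A \<union> nbrs h x. grid_bump h a x)"
    using fin by (intro sum_mono2) (auto simp: finite_nbrs grid_bump_nonneg)
  also have "\<dots> = 1" using fin by (intro sum_nbrs assms) (auto simp: finite_nbrs)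
  finally show ?thesis by (simp add: eta_def)
qed

lemma eta_nonzero_imp:
  assumes "h > 0" "eta h U x \<noteq> 0"
  shows "cub x (2 * h) \<subseteq> U"
proof -
  obtain a where a: "cub (grid_pt h a) (3 * h) \<subseteq> U" "grid_bump h a x \<noteq> 0"
    using assms(2) unfolding eta_def by (metis (mono_tags, lifting) mem_Collect_eq sum.neutral)
  then have "x \<in> cub (grid_pt h a) h"
    using grid_bump_nonzero[OF assms(1), of a x] by (auto simp: cub_def abs_minus_commute less_imp_le)
  from cub_trans[OF this, of "2 * h"] a(1) show ?thesis by auto
qed

lemma eta_eq_1:
  assumes "h > 0" "bounded U" "cub x (4 * h) \<subseteq> U"
  shows "eta h U x = 1"
proof -
  have "nbrs h x \<subseteq> {a. cub (grid_pt h a) (3 * h) \<subseteq> U}"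
  proof
    fix a assume a: "a \<in> nbrs h x"
    have "\<bar>grid_pt h a $ i - x $ i\<bar> \<le> h" for i
    proof -
      have "a i = \<lfloor>x $ i / h\<rfloor> \<or> a i = \<lfloor>x $ i / h\<rfloor> + 1" using a by (auto simp: nbrs_def)
      then have "\<bar>of_int (a i) - x $ i / h\<bar> \<le> 1" by linarith
      then show ?thesis using assms(1) by (simp add: abs_le_iff field_simps grid_pt_def)
    qed
    then have "grid_pt h a \<in> cub x h" by (simp add: cub_def)
    from cub_trans[OF this, of "3 * h"] assms(3) show "a \<in> {a. cub (grid_pt h a) (3 * h) \<subseteq> U}" by auto
  qed
  then show ?thesis unfolding eta_def using assms finite_eta by (intro sum_nbrs) auto
qed

lemma eta_support_subset: "h > 0 \<Longrightarrow> {x. eta h U x \<noteq> 0} \<subseteq> U"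
  using eta_nonzero_imp cub_self[of "2 * h"] by force

lemma gradient_zero_at_extremum:
  fixes f :: "real^'n \<Rightarrow> real"
  assumes der: "(f has_derivative (\<lambda>v. g \<bullet> v)) (at x)"
    and ext: "(\<forall>y. f y \<le> f x) \<or> (\<forall>y. f x \<le> f y)"
  shows "g = 0"
proof -
  have "(\<lambda>v. g \<bullet> v) = (\<lambda>v. 0)"
    using ext by (intro differential_zero_maxmin[of x UNIV f]) (use der in auto)
  then show ?thesis by (metis inner_eq_zero_iff)
qed

text \<open>0 and 1 bound the values of \<open>eta\<close> from below and above, so such a point is
  a global extremum, whether or not \<open>eta\<close> is constant nearby.\<close>

lemma eta'_zero:
  assumes "h > 0" "bounded U" "eta h U x = 0 \<or> eta h U x = 1"
  shows "eta' h U x = 0"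
proof (rule gradient_zero_at_extremum[OF has_derivative_eta[of h U x]])
  show "(\<forall>y. eta h U y \<le> eta h U x) \<or> (\<forall>y. eta h U x \<le> eta h U y)"
    using assms(3) eta_nonneg[of h U] eta_le_1[OF assms(1,2)] by (elim disjE) simp_all
qed

lemma eta'_bound:
  fixes x :: "real^'n"
  assumes "h > 0" "bounded U"
  shows "\<bar>eta' h U x $ j\<bar> \<le> 2 ^ CARD('n) * (2 / h)"
proof -
  let ?A = "{a. cub (grid_pt h a) (3 * h) \<subseteq> U}"
  have "eta' h U x $ j = (\<Sum>a\<in>?A. grid_bump' h a x $ j)" by (simp add: eta'_def)
  also have "\<dots> = (\<Sum>a\<in>?A \<inter> nbrs h x. grid_bump' h a x $ j)"
  proof (rule sum.mono_neutral_right)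
    show "\<forall>a\<in>?A - ?A \<inter> nbrs h x. grid_bump' h a x $ j = 0"
      using grid_bump_nonzero[OF assms(1), of _ x] nbrs_memI[OF assms(1), of _ x] by (metis Diff_iff IntI zero_index)
  qed (use finite_eta[OF assms] in auto)
  also have "\<bar>\<dots>\<bar> \<le> (\<Sum>a\<in>?A \<inter> nbrs h x. 2 / h)"
    by (rule order_trans[OF sum_abs]) (intro sum_mono grid_bump'_bound assms)
  also have "\<dots> \<le> (\<Sum>a\<in>nbrs h x. 2 / h)"
    using assms by (intro sum_mono2 finite_nbrs) auto
  finally show ?thesis by (simp add: card_nbrs)
qed

lemma eta_support_compact:
  assumes "h > 0" "bounded U"
  shows "compact (closure {x. eta h U x \<noteq> 0})" "closure {x. eta h U x \<noteq> 0} \<subseteq> U"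
proof -
  have "bounded {x. eta h U x \<noteq> 0}"
    using eta_support_subset[OF assms(1)] assms(2) bounded_subset by blast
  then show "compact (closure {x. eta h U x \<noteq> 0})" by simp
  show "closure {x. eta h U x \<noteq> 0} \<subseteq> U"
  proof
    fix x assume "x \<in> closure {x. eta h U x \<noteq> 0}"
    \<comment> \<open>The room of \<open>2 * h\<close> around points with nonzero \<open>eta\<close>
      also covers the limit points of such points.\<close>
    then obtain y where y: "eta h U y \<noteq> 0" "dist y x < 2 * h"
      using assms(1) by (auto simp: closure_approachable)
    then have "x \<in> cub y (2 * h)" using cball_subset_cub[of y "2 * h"] by auto
    with eta_nonzero_imp[OF assms(1) y(1)] show "x \<in> U" by blast
  qed
qed

section \<open>Integrals of Jacobian determinants\<close>

lemma has_derivative_scaleR_cart: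
  fixes F :: "real^'n \<Rightarrow> real^'m"
  assumes "(F has_derivative (*v) A) (at x)" "(\<psi> has_derivative (\<lambda>v. g \<bullet> v)) (at x)"
  shows "((\<lambda>x. \<psi> x *\<^sub>R F x) has_derivative (*v) (\<psi> x *\<^sub>R A + (\<chi> i j. g $ j * F x $ i))) (at x)"
proof -
  have "(\<lambda>h. \<psi> x *\<^sub>R (A *v h) + (g \<bullet> h) *\<^sub>R F x) = (*v) (\<psi> x *\<^sub>R A + (\<chi> i j. g $ j * F x $ i))"
    by (rule ext) (simp add: matrix_vector_mult_def vec_eq_iff inner_vec_def sum.distrib sum_distrib_left sum_distrib_right algebra_simps)
  with has_derivative_scaleR[OF assms(2,1)] show ?thesis by simp
qed

lemma has_derivative_add_cart:
  fixes A B :: "real^'n^'m"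
  assumes "(F has_derivative (*v) A) (at x)" "(G has_derivative (*v) B) (at x)"
  shows "((\<lambda>x. F x + G x) has_derivative (*v) (A + B)) (at x)"
proof -
  have "(\<lambda>h. A *v h + B *v h) = (*v) (A + B)"
    by (rule ext) (simp add: matrix_vector_mult_add_rdistrib)
  with has_derivative_add[OF assms] show ?thesis by simp
qed

lemma has_derivative_diff_cart:
  fixes A B :: "real^'n^'m"
  assumes "(F has_derivative (*v) A) (at x)" "(G has_derivative (*v) B) (at x)"
  shows "((\<lambda>x. F x - G x) has_derivative (*v) (A - B)) (at x)"
proof -
  have "(\<lambda>h. A *v h - B *v h) = (*v) (A - B)"
    by (rule ext) (simp add: matrix_vector_mult_diff_rdistrib)
  with has_derivative_diff[OF assms] show ?thesis by simp
qed

lemma continuous_on_det [continuous_intros]: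
  fixes A :: "'a::topological_space \<Rightarrow> real^'n^'n"
  shows "continuous_on S A \<Longrightarrow> continuous_on S (\<lambda>x. det (A x))"
  unfolding det_def by (intro continuous_intros)

lemma integrable_compact_support:
  fixes g :: "'a::euclidean_space \<Rightarrow> real"
  assumes "continuous_on UNIV g" "compact K" "\<And>x. x \<notin> K \<Longrightarrow> g x = 0"
  shows "integrable lborel g"
proof -
  have "integrable lborel (\<lambda>x. indicator K x *\<^sub>R g x)"
    by (rule borel_integrable_compact[OF assms(2) continuous_on_subset[OF assms(1)]]) simp
  moreover have "(\<lambda>x. indicator K x *\<^sub>R g x) = g" using assms(3) by (intro ext) (auto simp: indicator_def)
  ultimately show ?thesis by simp
qed

text \<open>The corresponding row of the Jacobian matrix is zero. This is how a saturated sigmoid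
  makes the integrands vanish.\<close>

lemma det_const_component:
  fixes F :: "real^'n \<Rightarrow> real^'n"
  assumes der: "(F has_derivative (*v) A) (at x)" and "e > 0" "\<And>z. z \<in> ball x e \<Longrightarrow> F z $ i = c"
  shows "det A = 0"
proof -
  have 1: "((\<lambda>z. F z $ i) has_derivative (\<lambda>h. (A *v h) $ i)) (at x)"
    by (rule bounded_linear.has_derivative[OF bounded_linear_vec_nth der])
  have "((\<lambda>z. F z $ i) has_derivative (\<lambda>h. 0)) (at x)"
    by (rule has_derivative_transform_within_open[OF has_derivative_const[of c] open_ball[of x e]])
       (use assms in auto)
  with 1 have 2: "(\<lambda>h. (A *v h) $ i) = (\<lambda>h. 0)" by (rule has_derivative_unique)
  have "A $ i \<bullet> h = 0" for h using fun_cong[OF 2, of h] by (simp add: matrix_vector_mul_component)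
  then have "A $ i = 0" by (metis inner_eq_zero_iff)
  then show ?thesis by (intro det_zero_row(1)[of i]) (simp add: row_def vec_eq_iff)
qed

text \<open>\<open>U\<close> and \<open>- ?K\<close> are open and cover the space: on the first the
  product rule applies, on the second \<open>f\<close> and \<open>C\<close> are 0.\<close>

lemma has_derivative_cutoff:
  fixes F :: "real^'n \<Rightarrow> real^'n"
  assumes "open U" "bounded U" "h > 0"
    and der: "\<And>x. x \<in> U \<Longrightarrow> (F has_derivative (*v) (A x)) (at x)"
    and contA: "continuous_on U A"
  defines "f x \<equiv> if x \<in> U then eta h U x *\<^sub>R F x else 0"
    and "C x \<equiv> if x \<in> U then eta h U x *\<^sub>R A x + (\<chi> i j. eta' h U x $ j * F x $ i) else 0"
  shows "(f has_derivative (*v) (C x)) (at x)" and "continuous_on UNIV C"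
    and "x \<notin> closure {x. eta h U x \<noteq> 0} \<Longrightarrow> f x = 0"
proof -
  let ?K = "closure {x. eta h U x \<noteq> 0}"
  have K: "compact ?K" "?K \<subseteq> U" using eta_support_compact[OF assms(3,2)] by auto
  have opK: "open (- ?K)" by (rule open_Compl) simp
  have eta0: "eta h U x = 0" if "x \<notin> ?K" for x
    using that closure_subset[of "{x. eta h U x \<noteq> 0}"] by blast
  have f0: "f y = 0" if "y \<notin> ?K" for y unfolding f_def eta0[OF that] by simp
  then show "x \<notin> ?K \<Longrightarrow> f x = 0" .
  have C0: "C x = 0" if "x \<notin> ?K" for x
    using eta'_zero[OF assms(3,2), of x] unfolding C_def eta0[OF that] by (simp add: vec_eq_iff)
  show "(f has_derivative (*v) (C x)) (at x)"
  proof (cases "x \<in> U")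
    case True
    have "((\<lambda>x. eta h U x *\<^sub>R F x) has_derivative (*v) (C x)) (at x)"
      unfolding C_def if_P[OF True] by (rule has_derivative_scaleR_cart[OF der[OF True] has_derivative_eta])
    then show ?thesis
      by (rule has_derivative_transform_within_open[OF _ \<open>open U\<close> True]) (simp add: f_def)
  next
    case False
    then have x: "x \<in> - ?K" using K by blast
    have "(f has_derivative (\<lambda>_. 0)) (at x)"
      by (rule has_derivative_transform_within_open[OF has_derivative_const opK x]) (use f0 in auto)
    moreover have "(*v) (C x) = (\<lambda>_. 0)" using C0[of x] x by (intro ext) simp
    ultimately show ?thesis by simp
  qed
  have contF: "continuous_on U F"
    by (rule has_derivative_continuous_on[OF has_derivative_at_withinI[OF der]])
  have "continuous_on U (\<lambda>x. eta h U x *\<^sub>R A x + (\<chi> i j. eta' h U x $ j * F x $ i))"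
    by (intro continuous_intros eta_cont eta'_cont contA contF)
  then have "continuous_on U C" by (rule continuous_on_eq) (simp add: C_def)
  moreover have "continuous_on (- ?K) C"
    by (rule continuous_on_eq[OF continuous_on_const[of _ 0]]) (use C0 in auto)
  ultimately have "continuous_on (U \<union> - ?K) C"
    by (intro continuous_on_open_Un \<open>open U\<close> opK)
  moreover have "U \<union> - ?K = UNIV" using K by blast
  ultimately show "continuous_on UNIV C" by simp
qed

lemma obtain_cutoff:
  fixes U :: "(real^'n) set"
  assumes "open U" "bounded U" "compact K" "K \<subseteq> U"
  obtains h where "h > 0" "\<And>x. x \<in> K \<Longrightarrow> eta h U x = 1"
proof -
  obtain h where h: "h > 0" "\<forall>x\<in>K. cub x h \<subseteq> U" using cub_in_open[OF assms(1,3,4)] by blast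
  show ?thesis
  proof (rule that[of "h / 4"])
    show "eta (h / 4) U x = 1" if "x \<in> K" for x
      by (rule eta_eq_1) (use h assms(2) that in auto)
  qed (use h in simp)
qed

text \<open>\<open>F\<close> is cut off to a compactly supported \<open>f\<close> with the same
  value and derivative on \<open>K\<close>. The determinants of \<open>f\<close> and of
  \<open>f + w\<close> have integral 0; off \<open>K\<close> the derivative of \<open>w\<close> is
  0, so that the difference of the determinants vanishes for \<open>F\<close> and for
  \<open>f\<close> alike.\<close>

lemma integral_det_perturbation:
  fixes F :: "real^'n \<Rightarrow> real^'n"
  assumes U: "open U" "bounded U"
    and derF: "\<And>x. x \<in> U \<Longrightarrow> (F has_derivative (*v) (A x)) (at x)" and contA: "continuous_on U A"
    and derw: "\<And>x. (w has_derivative (*v) (B x)) (at x)" and contB: "continuous_on UNIV B"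
    and K: "compact K" "K \<subseteq> U" and w0: "\<And>x. x \<notin> K \<Longrightarrow> w x = 0"
  shows "(LINT x:U|lborel. det (A x + B x) - det (A x)) = 0"
proof -
  obtain h where h: "h > 0" "\<And>x. x \<in> K \<Longrightarrow> eta h U x = 1" using obtain_cutoff[OF U K] by blast
  let ?K = "closure {x. eta h U x \<noteq> 0}"
  define f where "f x = (if x \<in> U then eta h U x *\<^sub>R F x else 0)" for x
  define C where "C x = (if x \<in> U then eta h U x *\<^sub>R A x + (\<chi> i j. eta' h U x $ j * F x $ i) else 0)" for x
  have f: "\<And>x. (f has_derivative (*v) (C x)) (at x)" and contC: "continuous_on UNIV C"
    and f0: "\<And>x. x \<notin> ?K \<Longrightarrow> f x = 0"
    unfolding f_def[abs_def] C_def[abs_def] by (rule has_derivative_cutoff[OF U h(1) derF contA]; assumption)+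
  have K': "compact ?K" "?K \<subseteq> U" using eta_support_compact[OF h(1) U(2)] by auto
  have C0: "C x = 0" if "x \<notin> ?K" for x by (rule derivative_outside_support[OF f _ that f0]) simp
  have B0: "B x = 0" if "x \<notin> K" for x
    by (rule derivative_outside_support[OF derw compact_imp_closed[OF K(1)] that w0])
  have 1: "(LINT x|lborel. det (C x)) = 0"
    by (rule integral_det_compact_support[OF f contC K'(1) f0])
  have 2: "(LINT x|lborel. det (C x + B x)) = 0"
    by (rule integral_det_compact_support[OF has_derivative_add_cart[OF f derw] _ compact_Un[OF K'(1) K(1)]])
       (use f0 w0 in \<open>auto intro!: continuous_intros contC contB\<close>)
  have i1: "integrable lborel (\<lambda>x. det (C x))"
    by (rule integrable_compact_support[OF _ K'(1)]) (auto intro!: continuous_intros contC simp: C0)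
  have i2: "integrable lborel (\<lambda>x. det (C x + B x))"
    by (rule integrable_compact_support[OF _ compact_Un[OF K'(1) K(1)]])
       (auto intro!: continuous_intros contC contB simp: C0 B0)
  have "(LINT x:U|lborel. det (A x + B x) - det (A x)) = (LINT x|lborel. det (C x + B x) - det (C x))"
    unfolding set_lebesgue_integral_def
  proof (rule Bochner_Integration.integral_cong[OF refl])
    fix x
    show "indicator U x *\<^sub>R (det (A x + B x) - det (A x)) = det (C x + B x) - det (C x)"
    proof (cases "x \<in> K")
      case True
      have "eta' h U x = 0" by (rule eta'_zero[OF h(1) U(2)]) (simp add: h(2) True)
      then have "C x = A x" using True K h(2) by (auto simp: C_def vec_eq_iff)
      with True K show ?thesis by auto
    next
      case False
      then show ?thesis by (simp add: B0)
    qed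
  qed
  also have "\<dots> = 0" using 1 2 by (simp add: Bochner_Integration.integral_diff[OF i2 i1])
  finally show ?thesis .
qed

lemma set_integrable_det_compact:
  fixes A :: "real^'n \<Rightarrow> real^'n^'n"
  assumes "continuous_on U A" "compact K" "K \<subseteq> U" "\<And>x. x \<in> U - K \<Longrightarrow> det (A x) = 0"
  shows "set_integrable lborel U (\<lambda>x. det (A x))"
    and "(LINT x:U|lborel. det (A x)) = (LINT x:K|lborel. det (A x))"
proof -
  have eq: "indicator U x *\<^sub>R det (A x) = indicator K x *\<^sub>R det (A x)" for x
    using assms by (auto simp: indicator_def)
  have "set_integrable lborel K (\<lambda>x. det (A x))" unfolding set_integrable_def
    by (intro borel_integrable_compact assms continuous_intros continuous_on_subset[OF assms(1)])
  then show "set_integrable lborel U (\<lambda>x. det (A x))"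
    and "(LINT x:U|lborel. det (A x)) = (LINT x:K|lborel. det (A x))"
    unfolding set_integrable_def set_lebesgue_integral_def eq by auto
qed

text \<open>
  Off \<open>K\<close> both maps locally have a common constant component, so that cutting off their
  difference outside \<open>K\<close> does not create a nonzero determinant.
\<close>

lemma integral_det_match:
  fixes F G :: "real^'n \<Rightarrow> real^'n"
  assumes U: "open U" "bounded U"
    and derF: "\<And>x. x \<in> U \<Longrightarrow> (F has_derivative (*v) (A x)) (at x)" and contA: "continuous_on U A"
    and derG: "\<And>x. x \<in> U \<Longrightarrow> (G has_derivative (*v) (B x)) (at x)" and contB: "continuous_on U B"
    and K: "compact K" "K \<subseteq> U"
    and off: "\<And>x. x \<in> U - K \<Longrightarrow> \<exists>i c. \<exists>e>0. \<forall>z\<in>ball x e. F z $ i = c \<and> G z $ i = c"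
  shows "(LINT x:U|lborel. det (A x)) = (LINT x:U|lborel. det (B x))"
    and "x \<in> U - K \<Longrightarrow> det (A x) = 0"
proof -
  have A0: "det (A x) = 0" and B0: "det (B x) = 0" if x: "x \<in> U - K" for x
  proof -
    obtain i c e where e: "e > 0" "\<forall>z\<in>ball x e. F z $ i = c \<and> G z $ i = c" using off[OF x] by blast
    show "det (A x) = 0" by (rule det_const_component[OF derF e(1), of _ i c]) (use x e in auto)
    show "det (B x) = 0" by (rule det_const_component[OF derG e(1), of _ i c]) (use x e in auto)
  qed
  show "x \<in> U - K \<Longrightarrow> det (A x) = 0" by (rule A0)
  obtain h where h: "h > 0" "\<And>x. x \<in> K \<Longrightarrow> eta h U x = 1" using obtain_cutoff[OF U K] by blast
  let ?K = "closure {x. eta h U x \<noteq> 0}"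
  define w where "w x = (if x \<in> U then eta h U x *\<^sub>R (G x - F x) else 0)" for x
  define C where "C x = (if x \<in> U then eta h U x *\<^sub>R (B x - A x)
      + (\<chi> i j. eta' h U x $ j * (G x - F x) $ i) else 0)" for x
  have w: "\<And>x. (w has_derivative (*v) (C x)) (at x)" and contC: "continuous_on UNIV C"
    and w0: "\<And>x. x \<notin> ?K \<Longrightarrow> w x = 0"
    unfolding w_def[abs_def] C_def[abs_def]
    by (rule has_derivative_cutoff[OF U h(1) has_derivative_diff_cart[OF derG derF] continuous_on_diff[OF contB contA]]; assumption)+
  have K': "compact ?K" "?K \<subseteq> U" using eta_support_compact[OF h(1) U(2)] by auto
  have 0: "(LINT x:U|lborel. det (A x + C x) - det (A x)) = 0"
    by (rule integral_det_perturbation[OF U derF contA w contC K' w0])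
  have eq: "det (A x + C x) = det (B x)" if x: "x \<in> U" for x
  proof (cases "x \<in> K")
    case True
    have "eta' h U x = 0" by (rule eta'_zero[OF h(1) U(2)]) (simp add: h(2) True)
    then have "A x + C x = B x" using True K h(2) by (auto simp: C_def vec_eq_iff)
    then show ?thesis by simp
  next
    case False
    \<comment> \<open>\<open>F + eta (G - F)\<close> inherits the constant component that
      \<open>F\<close> and \<open>G\<close> share, whatever the value of the cutoff.\<close>
    with x off obtain i c e where e: "e > 0" "\<forall>z\<in>ball x e. F z $ i = c \<and> G z $ i = c" by blast
    have "det (A x + C x) = 0"
      by (rule det_const_component[OF has_derivative_add_cart[OF derF[OF x] w] e(1), of i c])
         (use e(2) in \<open>auto simp: w_def\<close>)
    with B0 False x show ?thesis by simp
  qed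
  have "(LINT x:U|lborel. det (A x + C x) - det (A x)) = (LINT x:U|lborel. det (B x) - det (A x))"
    by (rule set_lebesgue_integral_cong) (use eq U in \<open>auto simp: borel_open\<close>)
  also have "\<dots> = (LINT x:U|lborel. det (B x)) - (LINT x:U|lborel. det (A x))"
    by (intro set_integral_diff set_integrable_det_compact[OF contA K A0] set_integrable_det_compact[OF contB K B0])
  finally show "(LINT x:U|lborel. det (A x)) = (LINT x:U|lborel. det (B x))" using 0 by simp
qed

section \<open>Smooth functions and test forms\<close>

text \<open>Coinduction for smoothness: the induction on the order is done once, and each kind of
  map only has to exhibit an invariant class \<open>C\<close>.\<close>

lemma smooth_onI:
  fixes C :: "('a::real_normed_vector \<Rightarrow> 'b::real_normed_vector) set"
  assumes diff: "\<And>f x. f \<in> C \<Longrightarrow> x \<in> S \<Longrightarrow> f differentiable (at x)"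
    and step: "\<And>f h. f \<in> C \<Longrightarrow> (\<lambda>x. frechet_derivative f (at x) h) \<in> C"
    and f: "f \<in> C"
  shows "smooth_on f S"
proof -
  have "Ck_on k f S" if "f \<in> C" for k f
    using that
  proof (induction k arbitrary: f)
    case 0
    then show ?case
      using diff differentiable_imp_continuous_within differentiable_at_withinI
      by (auto simp: continuous_on_eq_continuous_within) blast
  next
    case (Suc k)
    then show ?case using diff step by auto
  qed
  with f show ?thesis by (simp add: smooth_on_def)
qed

lemma real_polynomial_function_derivative:
  assumes "real_polynomial_function p"
  shows "\<exists>D. \<forall>x. (p has_derivative D x) (at x) \<and> (\<forall>h. real_polynomial_function (\<lambda>x. D x h))"
  using assms
proof induction
  case (linear f)
  then show ?case
    by (intro exI[of _ "\<lambda>_. f"]) (auto intro: bounded_linear_imp_has_derivative real_polynomial_function.intros(2))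
next
  case (const c)
  then show ?case by (intro exI[of _ "\<lambda>_ _. 0"]) auto
next
  case (add f g)
  then obtain D E where "\<forall>x. (f has_derivative D x) (at x) \<and> (\<forall>h. real_polynomial_function (\<lambda>x. D x h))"
    "\<forall>x. (g has_derivative E x) (at x) \<and> (\<forall>h. real_polynomial_function (\<lambda>x. E x h))" by blast
  then show ?case by (intro exI[of _ "\<lambda>x h. D x h + E x h"]) (auto intro: has_derivative_add)
next
  case (mult f g)
  then obtain D E where "\<forall>x. (f has_derivative D x) (at x) \<and> (\<forall>h. real_polynomial_function (\<lambda>x. D x h))"
    "\<forall>x. (g has_derivative E x) (at x) \<and> (\<forall>h. real_polynomial_function (\<lambda>x. E x h))" by blast
  with mult.hyps show ?case
    by (intro exI[of _ "\<lambda>x h. f x * E x h + D x h * g x"] allI conjI has_derivative_mult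
        real_polynomial_function.intros(3,4)) auto
qed

lemma polynomial_function_smooth_on:
  fixes p :: "'a::euclidean_space \<Rightarrow> 'b::euclidean_space"
  assumes "polynomial_function p"
  shows "smooth_on p S"
proof (rule smooth_onI[where C="{p. polynomial_function p}"])
  fix f :: "'a \<Rightarrow> 'b" assume "f \<in> {p. polynomial_function p}"
  then have f: "\<And>b. b \<in> Basis \<Longrightarrow> real_polynomial_function (\<lambda>x. f x \<bullet> b)"
    by (simp add: polynomial_function_iff_Basis_inner)
  have "\<forall>b\<in>Basis. \<exists>D. \<forall>x. ((\<lambda>x. f x \<bullet> b) has_derivative D x) (at x)
      \<and> (\<forall>h. real_polynomial_function (\<lambda>x. D x h))"
    using real_polynomial_function_derivative[OF f] by blast
  from bchoice[OF this] obtain D where D: "\<And>b x. b \<in> Basis \<Longrightarrow> ((\<lambda>x. f x \<bullet> b) has_derivative D b x) (at x)"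
    "\<And>b h. b \<in> Basis \<Longrightarrow> real_polynomial_function (\<lambda>x. D b x h)"
    by blast
  have der: "(f has_derivative (\<lambda>h. \<Sum>b\<in>Basis. D b x h *\<^sub>R b)) (at x)" for x
  proof -
    have "((\<lambda>x. \<Sum>b\<in>Basis. (f x \<bullet> b) *\<^sub>R b) has_derivative (\<lambda>h. \<Sum>b\<in>Basis. D b x h *\<^sub>R b)) (at x)"
      using D(1) by (intro has_derivative_sum has_derivative_scaleR_left) auto
    then show ?thesis by (simp add: euclidean_representation)
  qed
  then show "f differentiable (at x)" for x by (auto simp: differentiable_def)
  fix h
  have "(\<lambda>x. frechet_derivative f (at x) h) = (\<lambda>x. \<Sum>b\<in>Basis. D b x h *\<^sub>R b)"
    using frechet_derivative_at[OF der] by (metis (mono_tags, lifting))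
  moreover have "polynomial_function (\<lambda>x. \<Sum>b\<in>Basis. D b x h *\<^sub>R b)"
    using D(2) by (intro polynomial_function_sum polynomial_function_mult) (auto simp: real_polynomial_function_eq)
  ultimately show "(\<lambda>x. frechet_derivative f (at x) h) \<in> {p. polynomial_function p}" by simp
qed (use assms in simp)

text \<open>
  Derivatives of \<open>flat m\<close> are combinations of \<open>flat (m + 1)\<close> and \<open>flat (m + 2)\<close>, so the
  class \<open>bumps\<close> below is closed under directional derivatives, as \<open>smooth_onI\<close> requires.
\<close>

definition flat :: "nat \<Rightarrow> real \<Rightarrow> real" where
  "flat m t = (if t \<le> 0 then 0 else exp (- (1 / t)) / t ^ m)"

lemma flat_nonneg: "0 \<le> flat m t"
  by (simp add: flat_def)

lemma flat_deriv: "(flat m has_real_derivative flat (m + 2) t - of_nat m * flat (m + 1) t) (at t)"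
proof -
  consider "t > 0" | "t < 0" | "t = 0" by linarith
  then show ?thesis
  proof cases
    case 1
    have "((\<lambda>t. exp (- (1 / t)) / t ^ m) has_real_derivative flat (m + 2) t - of_nat m * flat (m + 1) t) (at t)"
    proof (cases m)
      case 0
      with 1 show ?thesis
        by (auto intro!: derivative_eq_intros simp: flat_def power2_eq_square field_simps)
    next
      case (Suc k)
      have p: "((\<lambda>t. t ^ Suc k) has_real_derivative (1 + real k) * t ^ k) (at t)"
        using DERIV_power_Suc[OF DERIV_ident, of k t] by simp
      have e: "((\<lambda>t. exp (- (1 / t))) has_real_derivative exp (- (1 / t)) / t\<^sup>2) (at t)"
        using 1 by (auto intro!: derivative_eq_intros simp: power2_eq_square)
      show ?thesis unfolding Suc
        by (rule DERIV_cong[OF DERIV_divide[OF e p]])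
           (use 1 in \<open>auto simp: flat_def power2_eq_square field_simps\<close>)
    qed
    then show ?thesis
      by (rule has_field_derivative_transform_within_open[where S="{0<..}"]) (use 1 in \<open>auto simp: flat_def\<close>)
  next
    case 2
    have "((\<lambda>t. 0) has_real_derivative flat (m + 2) t - of_nat m * flat (m + 1) t) (at t)"
      using 2 by (auto intro!: derivative_eq_intros simp: flat_def)
    then show ?thesis
      by (rule has_field_derivative_transform_within_open[where S="{..<0}"]) (use 2 in \<open>auto simp: flat_def\<close>)
  next
    case 3
    have "((\<lambda>h. (flat m (0 + h) - flat m 0) / h) \<longlongrightarrow> 0) (at 0)"
    proof (rule filterlim_split_at)
      show "((\<lambda>h. (flat m (0 + h) - flat m 0) / h) \<longlongrightarrow> 0) (at_left 0)"
        by (rule tendsto_eventually) (auto simp: eventually_at_left_field flat_def intro: exI[of _ "-1"])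
      \<comment> \<open>In terms of \<open>1 / h\<close> the difference quotient is a power divided
        by an exponential.\<close>
      have "((\<lambda>h. (inverse h) ^ (m + 1) / exp (inverse h)) \<longlongrightarrow> (0::real)) (at_right 0)"
        by (rule filterlim_compose[OF tendsto_power_div_exp_0 filterlim_inverse_at_top_right])
      then show "((\<lambda>h. (flat m (0 + h) - flat m 0) / h) \<longlongrightarrow> 0) (at_right 0)"
        by (rule Lim_transform_eventually)
           (auto simp: eventually_at_right_field flat_def exp_minus field_simps intro!: exI[of _ 1])
    qed
    then show ?thesis using 3 by (simp add: DERIV_def flat_def)
  qed
qed

inductive_set bumps :: "real \<Rightarrow> 'a::real_inner \<Rightarrow> ('a \<Rightarrow> real) set" for r y where
  base: "real_polynomial_function P \<Longrightarrow> (\<lambda>x. flat m (r - (x - y) \<bullet> (x - y)) * P x) \<in> bumps r y"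
| add: "f \<in> bumps r y \<Longrightarrow> g \<in> bumps r y \<Longrightarrow> (\<lambda>x. f x + g x) \<in> bumps r y"

lemma bumps_derivative:
  fixes y :: "'a::euclidean_space"
  assumes "f \<in> bumps r y"
  shows "\<exists>D. \<forall>x. (f has_derivative D x) (at x) \<and> (\<forall>h. (\<lambda>x. D x h) \<in> bumps r y)"
  using assms
proof induction
  case (base P m)
  obtain D where D: "\<And>x. (P has_derivative D x) (at x)" "\<And>h. real_polynomial_function (\<lambda>x. D x h)"
    using real_polynomial_function_derivative[OF base] by blast
  let ?q = "\<lambda>x. r - (x - y) \<bullet> (x - y)"
  let ?D = "\<lambda>x h. (flat (m + 2) (?q x) * (- 2 * ((x - y) \<bullet> h) * P x) +
      flat (m + 1) (?q x) * (2 * of_nat m * ((x - y) \<bullet> h) * P x)) + flat m (?q x) * D x h"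
  have "((\<lambda>x. flat m (?q x)) has_derivative
      (\<lambda>h. (flat (m + 2) (?q x) - of_nat m * flat (m + 1) (?q x)) * (- 2 * ((x - y) \<bullet> h)))) (at x)" for x
  proof -
    have "(?q has_derivative (\<lambda>h. - 2 * ((x - y) \<bullet> h))) (at x)"
      by (auto intro!: derivative_eq_intros simp: inner_commute)
    from has_derivative_compose[OF this flat_deriv[THEN has_field_derivative_imp_has_derivative]]
    show ?thesis by simp
  qed
  from has_derivative_mult[OF this D(1)]
  have 1: "((\<lambda>x. flat m (?q x) * P x) has_derivative ?D x) (at x)" for x
    by (rule has_derivative_eq_rhs) (auto simp: algebra_simps)
  have lin: "real_polynomial_function (\<lambda>x. (x - y) \<bullet> h)" for h
    by (auto simp: inner_diff_left intro!: real_polynomial_function_diff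
        real_polynomial_function.intros(1)[OF bounded_linear_inner_left] real_polynomial_function.intros(2))
  have 2: "(\<lambda>x. ?D x h) \<in> bumps r y" for h
    by (intro bumps.add bumps.base real_polynomial_function.intros(4) real_polynomial_function.intros(2) base.hyps D(2) lin)
  show ?case using 1 2 by (intro exI[of _ ?D]) blast
next
  case (add f g)
  then obtain D E where "\<forall>x. (f has_derivative D x) (at x) \<and> (\<forall>h. (\<lambda>x. D x h) \<in> bumps r y)"
    "\<forall>x. (g has_derivative E x) (at x) \<and> (\<forall>h. (\<lambda>x. E x h) \<in> bumps r y)" by blast
  then show ?case
    by (intro exI[of _ "\<lambda>x h. D x h + E x h"]) (auto intro: has_derivative_add bumps.add)
qed

lemma bumps_smooth_on:
  fixes y :: "'a::euclidean_space"
  assumes "f \<in> bumps r y"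
  shows "smooth_on f S"
proof (rule smooth_onI[where C="bumps r y"])
  fix f assume "f \<in> bumps r y"
  then obtain D where D: "\<And>x. (f has_derivative D x) (at x)" "\<And>h. (\<lambda>x. D x h) \<in> bumps r y"
    using bumps_derivative by blast
  show "f differentiable (at x)" for x using D(1) by (auto simp: differentiable_def)
  fix h
  have "(\<lambda>x. frechet_derivative f (at x) h) = (\<lambda>x. D x h)"
    using frechet_derivative_at[OF D(1)] by (metis (mono_tags, lifting))
  with D(2) show "(\<lambda>x. frechet_derivative f (at x) h) \<in> bumps r y" by simp
qed fact

lemma smooth_bump:
  fixes y :: "'a::euclidean_space"
  assumes "e > 0"
  shows "\<exists>\<phi>. smooth_on \<phi> UNIV \<and> closure {z. \<phi> z \<noteq> 0} \<subseteq> cball y e \<and> has_bochner_integral lborel \<phi> (1::real)"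
proof -
  define f where "f x = flat 0 (e\<^sup>2 - (x - y) \<bullet> (x - y)) * 1" for x
  have f: "f \<in> bumps (e\<^sup>2) y"
    unfolding f_def[abs_def] by (intro bumps.base real_polynomial_function.intros(2))
  have supp: "f x = 0" if "x \<notin> cball y e" for x
  proof -
    have "e < norm (x - y)" using that by (simp add: dist_norm norm_minus_commute)
    then have "e\<^sup>2 < (norm (x - y))\<^sup>2" using assms by (intro power_strict_mono) auto
    then show ?thesis by (simp add: f_def flat_def power2_norm_eq_inner)
  qed
  have pos: "f x > 0" if "x \<in> ball y e" for x
  proof -
    have "norm (x - y) < e" using that by (simp add: dist_norm norm_minus_commute)
    then have "(norm (x - y))\<^sup>2 < e\<^sup>2" using assms by (intro power_strict_mono) auto
    then show ?thesis by (simp add: f_def flat_def power2_norm_eq_inner)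
  qed
  have nn: "f x \<ge> 0" for x using flat_nonneg by (simp add: f_def)
  have cont: "continuous_on UNIV f"
    using bumps_smooth_on[OF f, of UNIV] unfolding smooth_on_def by (metis Ck_on.simps(1))
  have int: "integrable lborel f"
    by (rule integrable_compact_support[OF cont compact_cball supp])
  have I: "(LINT x|lborel. f x) > 0"
  proof (rule ccontr)
    assume "\<not> ?thesis"
    moreover have "(LINT x|lborel. f x) \<ge> 0" using nn by simp
    ultimately have "(LINT x|lborel. f x) = 0" by linarith
    then have "AE x in lborel. f x = 0"
      using integral_nonneg_eq_0_iff_AE[OF int] nn by simp
    then have "AE x in lborel. x \<notin> ball y e" by eventually_elim (use pos in force)
    then have "ball y e \<in> null_sets lborel"
      by (subst AE_iff_null_sets) auto
    then have "measure lborel (ball y e) = 0" by (simp add: measure_def null_setsD1)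
    moreover have "measure lborel (ball y e) > 0" using assms by (rule content_ball_pos)
    ultimately show False by simp
  qed
  let ?c = "1 / (LINT x|lborel. f x)"
  have "(\<lambda>x. flat 0 (e\<^sup>2 - (x - y) \<bullet> (x - y)) * ?c) \<in> bumps (e\<^sup>2) y"
    by (intro bumps.base real_polynomial_function.intros(2))
  then have sm: "smooth_on (\<lambda>x. f x * ?c) UNIV" unfolding f_def by (intro bumps_smooth_on) simp
  have "{z. f z * ?c \<noteq> 0} \<subseteq> cball y e" using supp by fastforce
  then have cl: "closure {z. f z * ?c \<noteq> 0} \<subseteq> cball y e" by (rule closure_minimal) simp
  have "has_bochner_integral lborel (\<lambda>x. f x * ?c) ((LINT x|lborel. f x) * ?c)"
    by (intro has_bochner_integral_mult_left has_bochner_integral_integrable int)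
  with I sm cl show ?thesis by (intro exI[of _ "\<lambda>x. f x * ?c"]) auto
qed

section \<open>Existence of test forms and of smooth approximations\<close>

text \<open>Without a test form every number would satisfy the description in
  \<open>smooth_degree\<close>, and \<open>THE\<close> would not single one out.\<close>

lemma degree_test_form_nonempty:
  assumes "compact (u ` frontier U)" "y \<notin> u ` frontier U"
  shows "degree_test_form u U y \<noteq> {}"
proof -
  let ?V = "connected_component_set (- u ` frontier U) y"
  have "open ?V" using assms(1) by (intro open_connected_component) (simp add: compact_imp_closed open_Compl)
  moreover have "y \<in> ?V" using assms(2) by (simp add: connected_component_refl)
  ultimately obtain e where "e > 0" "cball y e \<subseteq> ?V" using open_contains_cball by blast
  with smooth_bump[of e y] show ?thesis by (auto simp: degree_test_form_def)
qed

definition jac :: "(real^'n \<Rightarrow> real^'m) \<Rightarrow> real^'n \<Rightarrow> real^'n^'m" where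
  "jac u x = matrix (frechet_derivative u (at x))"

lemma smooth_on_jac:
  fixes u :: "real^'n \<Rightarrow> real^'m"
  assumes "smooth_on u W"
  shows "\<And>x. x \<in> W \<Longrightarrow> (u has_derivative (*v) (jac u x)) (at x)" and "continuous_on W (jac u)"
proof -
  have C1: "Ck_on (Suc 0) u W" using assms by (simp only: smooth_on_def)
  show "(u has_derivative (*v) (jac u x)) (at x)" if "x \<in> W" for x
  proof -
    have d: "(u has_derivative frechet_derivative u (at x)) (at x)"
      using C1 that by (simp add: frechet_derivative_works)
    then have "linear (frechet_derivative u (at x))" by (simp add: has_derivative_linear)
    then have "(*v) (jac u x) = frechet_derivative u (at x)" unfolding jac_def by (auto simp: matrix_works)
    with d show ?thesis by simp
  qed
  show "continuous_on W (jac u)" unfolding jac_def[abs_def] matrix_def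
    using C1 by (intro continuous_intros) auto
qed

lemma smooth_on_imp_continuous: "smooth_on f S \<Longrightarrow> continuous_on S f"
  unfolding smooth_on_def by (metis Ck_on.simps(1))

lemma smooth_closureD:
  fixes u :: "real^'n \<Rightarrow> real^'m"
  assumes "u \<in> smooth_closure U"
  obtains W where "open W" "closure U \<subseteq> W" "\<And>x. x \<in> W \<Longrightarrow> (u has_derivative (*v) (jac u x)) (at x)"
    "continuous_on W (jac u)" "continuous_on W u"
proof -
  obtain W where W: "open W" "closure U \<subseteq> W" "smooth_on u W"
    using assms by (auto simp: smooth_closure_def)
  show thesis
    by (rule that[OF W(1,2) smooth_on_jac[OF W(3)] smooth_on_imp_continuous[OF W(3)]])
qed

lemma smooth_approximation:
  fixes u :: "real^'n \<Rightarrow> real^'m"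
  assumes "bounded U" "continuous_on (closure U) u" "e > 0"
  shows "\<exists>v\<in>smooth_closure U. \<forall>x\<in>closure U. norm (v x - u x) < e"
proof -
  obtain p where "polynomial_function p" "\<And>x. x \<in> closure U \<Longrightarrow> norm (u x - p x) < e"
    using Stone_Weierstrass_polynomial_function[of "closure U" u e] assms by (auto simp: compact_closure)
  then show ?thesis
    by (intro bexI[of _ p]) (auto simp: norm_minus_commute smooth_closure_def intro!: polynomial_function_smooth_on exI[of _ UNIV])
qed

section \<open>An integral formula for the degree\<close>

text \<open>
  \<open>kap e\<close> is the Jacobian determinant of \<open>z \<mapsto> (\<sigma>(z\<^sub>i / e))\<^sub>i\<close> for \<open>\<sigma> = sig\<close>: a continuous
  probability density vanishing off \<open>{0<..<e}\<close> in each coordinate, which replaces the smooth test form.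
\<close>

definition kap :: "real \<Rightarrow> real^'n \<Rightarrow> real" where
  "kap e z = (\<Prod>i\<in>UNIV. sig' (z $ i / e) / e)"

definition sig_mat :: "real \<Rightarrow> real^'n \<Rightarrow> real^'n^'n \<Rightarrow> real^'n^'n" where
  "sig_mat e z A = (\<chi> i. (sig' (z $ i / e) / e) *s A $ i)"

lemma det_sig_mat: "det (sig_mat e z A) = kap e z * det A"
  unfolding sig_mat_def kap_def det_rows_mul by simp

lemma kap_cont [continuous_intros]:
  "continuous_on S g \<Longrightarrow> continuous_on S (\<lambda>x. kap e (g x))"
  unfolding kap_def by (cases "e = 0") (auto intro!: continuous_intros)

lemma sig_mat_cont [continuous_intros]:
  assumes "continuous_on S g" "continuous_on S A"
  shows "continuous_on S (\<lambda>x. sig_mat e (g x) (A x))"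
proof -
  have "continuous_on S (\<lambda>x. sig' (g x $ i / e) / e)" for i
    by (cases "e = 0") (auto intro!: continuous_intros assms)
  note c = this
  show ?thesis unfolding sig_mat_def vector_scalar_mult_def
    by (intro continuous_on_vec_lambda continuous_on_mult c continuous_on_component assms)
qed

lemma kap_nonneg: "0 < e \<Longrightarrow> 0 \<le> kap e z"
  unfolding kap_def by (intro prod_nonneg) (simp add: sig'_bounds)

lemma kap_nonzero:
  assumes "e > 0" "kap e z \<noteq> 0"
  shows "0 < z $ i" "z $ i < e"
proof -
  have "sig' (z $ i / e) \<noteq> 0" using assms unfolding kap_def by (simp add: prod_zero_iff)
  then have "0 < z $ i / e" "z $ i / e < 1" using sig'_out[of "z $ i / e"] by linarith+
  then show "0 < z $ i" "z $ i < e" using assms(1) by (simp_all add: zero_less_divide_iff)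
qed

lemma has_derivative_vec_cart:
  fixes g :: "'n::finite \<Rightarrow> real^'m \<Rightarrow> real"
  assumes "\<And>i. (g i has_derivative (\<lambda>h. A $ i \<bullet> h)) (at x)"
  shows "((\<lambda>x. \<chi> i. g i x) has_derivative (*v) A) (at x)"
  unfolding has_derivative_componentwise_within[where f="\<lambda>x. \<chi> i. g i x"]
  using assms by (auto simp: Basis_vec_def inner_axis matrix_vector_mul_component)

lemma has_derivative_nth_cart:
  fixes v :: "real^'n \<Rightarrow> real^'m"
  assumes "(v has_derivative (*v) A) (at x)"
  shows "((\<lambda>x. v x $ i) has_derivative (\<lambda>h. A $ i \<bullet> h)) (at x)"
  using bounded_linear.has_derivative[OF bounded_linear_vec_nth assms, of i]
  by (simp add: matrix_vector_mul_component)

lemma has_derivative_sig_vec: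
  fixes v :: "real^'n \<Rightarrow> real^'n"
  assumes "(v has_derivative (*v) A) (at x)" "e \<noteq> 0"
  shows "((\<lambda>x. \<chi> i. sig ((v x - y) $ i / e)) has_derivative (*v) (sig_mat e (v x - y) A)) (at x)"
proof (rule has_derivative_vec_cart)
  fix i
  have "((\<lambda>x. (v x - y) $ i / e) has_derivative (\<lambda>h. (A $ i \<bullet> h) / e)) (at x)"
    using assms(2) by (auto intro!: derivative_eq_intros has_derivative_nth_cart[OF assms(1)])
  from sig_derivative[OF this]
  show "((\<lambda>x. sig ((v x - y) $ i / e)) has_derivative (\<lambda>h. sig_mat e (v x - y) A $ i \<bullet> h)) (at x)"
    by (simp add: sig_mat_def inner_vec_def sum_distrib_left sum_divide_distrib mult_ac)
qed

text \<open>
  Both integrands are Jacobian determinants of maps \<open>x \<mapsto> (\<sigma>((v(x) - y)\<^sub>i / e))\<^sub>i\<close>, and these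
  have a common component 0 or 1 off \<open>K\<close>.
\<close>

lemma integral_kap_match:
  fixes v1 v2 :: "real^'n \<Rightarrow> real^'n"
  assumes U: "open U" "bounded U" and e: "e1 > 0" "e2 > 0"
    and der1: "\<And>x. x \<in> U \<Longrightarrow> (v1 has_derivative (*v) (A1 x)) (at x)" and cont1: "continuous_on U A1"
    and der2: "\<And>x. x \<in> U \<Longrightarrow> (v2 has_derivative (*v) (A2 x)) (at x)" and cont2: "continuous_on U A2"
    and K: "compact K" "K \<subseteq> U"
    and off: "\<And>x. x \<in> U - K \<Longrightarrow> \<exists>i. (v1 x $ i < y1 $ i \<and> v2 x $ i < y2 $ i) \<or>
                 (v1 x $ i > y1 $ i + e1 \<and> v2 x $ i > y2 $ i + e2)"
  shows "(LINT x:U|lborel. kap e1 (v1 x - y1) * det (A1 x)) =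
         (LINT x:U|lborel. kap e2 (v2 x - y2) * det (A2 x))"
proof -
  have c1: "continuous_on U v1" and c2: "continuous_on U v2"
    by (rule has_derivative_continuous_on[OF has_derivative_at_withinI[OF der1]]; assumption)
       (rule has_derivative_continuous_on[OF has_derivative_at_withinI[OF der2]]; assumption)
  have t: "((\<lambda>z. v1 z $ i) \<longlongrightarrow> v1 x $ i) (nhds x)" "((\<lambda>z. v2 z $ i) \<longlongrightarrow> v2 x $ i) (nhds x)" if "x \<in> U" for x i
    using has_derivative_continuous[OF der1[OF that]] has_derivative_continuous[OF der2[OF that]]
    by (auto intro!: tendsto_vec_nth simp: isCont_def tendsto_at_iff_tendsto_nhds)
  have "(LINT x:U|lborel. det (sig_mat e1 (v1 x - y1) (A1 x))) = (LINT x:U|lborel. det (sig_mat e2 (v2 x - y2) (A2 x)))"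
  proof (rule integral_det_match(1)[OF U has_derivative_sig_vec[OF der1] _ has_derivative_sig_vec[OF der2] _ K])
    fix x assume x: "x \<in> U - K"
    then have xU: "x \<in> U" by simp
    from off[OF x] obtain i where i: "(v1 x $ i < y1 $ i \<and> v2 x $ i < y2 $ i) \<or>
                 (v1 x $ i > y1 $ i + e1 \<and> v2 x $ i > y2 $ i + e2)" by blast
    show "\<exists>i c. \<exists>e>0. \<forall>z\<in>ball x e. (\<chi> i. sig ((v1 z - y1) $ i / e1)) $ i = c \<and> (\<chi> i. sig ((v2 z - y2) $ i / e2)) $ i = c"
      using i
    proof
      assume i: "v1 x $ i < y1 $ i \<and> v2 x $ i < y2 $ i"
      have "\<forall>\<^sub>F z in nhds x. v1 z $ i < y1 $ i \<and> v2 z $ i < y2 $ i"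
        using order_tendstoD(2)[OF t(1)[OF xU]] order_tendstoD(2)[OF t(2)[OF xU]] i by (intro eventually_conj) auto
      then obtain e where "e > 0" "\<forall>z. dist z x < e \<longrightarrow> v1 z $ i < y1 $ i \<and> v2 z $ i < y2 $ i"
        by (auto simp: eventually_nhds_metric)
      then show ?thesis using e
        by (intro exI[of _ i] exI[of _ 0] exI[of _ e]) (auto intro!: sig_le0 simp: dist_commute divide_le_0_iff less_imp_le)
    next
      assume i: "v1 x $ i > y1 $ i + e1 \<and> v2 x $ i > y2 $ i + e2"
      have "\<forall>\<^sub>F z in nhds x. v1 z $ i > y1 $ i + e1 \<and> v2 z $ i > y2 $ i + e2"
        using order_tendstoD(1)[OF t(1)[OF xU]] order_tendstoD(1)[OF t(2)[OF xU]] i by (intro eventually_conj) auto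
      then obtain d where d: "d > 0" "\<And>z. dist z x < d \<Longrightarrow> v1 z $ i > y1 $ i + e1 \<and> v2 z $ i > y2 $ i + e2"
        by (auto simp: eventually_nhds_metric)
      have "(v1 z - y1) $ i / e1 \<ge> 1 \<and> (v2 z - y2) $ i / e2 \<ge> 1" if "z \<in> ball x d" for z
        using d(2)[of z] that e by (simp add: dist_commute)
      then show ?thesis using d(1)
        by (intro exI[of _ i] exI[of _ 1] exI[of _ d]) (auto intro!: sig_ge1)
    qed
  qed (use e in \<open>auto intro!: continuous_intros c1 c2 cont1 cont2\<close>)
  then show ?thesis by (simp add: det_sig_mat)
qed

lemma compact_preimage_cub:
  fixes u :: "real^'n \<Rightarrow> real^'n"
  assumes "bounded U" "open U" "continuous_on (closure U) u"
    and "\<forall>x\<in>frontier U. \<exists>i. r < \<bar>u x $ i - y $ i\<bar>"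
  shows "compact {x\<in>closure U. u x \<in> cub y r}" "{x\<in>closure U. u x \<in> cub y r} \<subseteq> U"
proof -
  have "closed (closure U \<inter> u -` cub y r)"
    by (rule continuous_closed_preimage[OF assms(3)]) (auto simp: cub_eq_cbox)
  moreover have "bounded (closure U \<inter> u -` cub y r)"
    using assms(1) bounded_closure bounded_Int by blast
  moreover have "closure U \<inter> u -` cub y r = {x\<in>closure U. u x \<in> cub y r}" by blast
  ultimately show "compact {x\<in>closure U. u x \<in> cub y r}" by (simp only: compact_eq_bounded_closed)
  show "{x\<in>closure U. u x \<in> cub y r} \<subseteq> U"
  proof
    fix x assume x: "x \<in> {x\<in>closure U. u x \<in> cub y r}"
    have "x \<notin> frontier U"
    proof
      assume "x \<in> frontier U"
      with assms(4) obtain i where "r < \<bar>u x $ i - y $ i\<bar>" by blast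
      with x show False by (auto simp: cub_def dest: spec[of _ i])
    qed
    with x show "x \<in> U" using assms(2) by (simp add: frontier_def interior_open)
  qed
qed

text \<open>Changes the approximation, the base point and the width of the kernel at once. Off the
  preimage of \<open>cub y (2 * \<delta>)\<close> some coordinate of \<open>u\<close> differs from
  that of \<open>y\<close> by more than \<open>2 * \<delta>\<close>. There \<open>v1\<close> and
  \<open>v2\<close> stay more than \<open>\<delta>\<close> away on the same side, beyond the
  supports of both kernels, which lie within \<open>\<delta>\<close> of \<open>y\<close>.\<close>

lemma integral_kap_const:
  fixes u v1 v2 :: "real^'n \<Rightarrow> real^'n"
  assumes U: "open U" "bounded U" and u: "continuous_on (closure U) u"
    and \<delta>: "\<forall>x\<in>frontier U. \<exists>i. 2 * \<delta> < \<bar>u x $ i - y $ i\<bar>"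
    and V: "open V" "V \<subseteq> U" "{x\<in>closure U. u x \<in> cub y (2 * \<delta>)} \<subseteq> V"
    and e: "e1 > 0" "e2 > 0"
    and der1: "\<And>x. x \<in> V \<Longrightarrow> (v1 has_derivative (*v) (A1 x)) (at x)" and cont1: "continuous_on V A1"
    and der2: "\<And>x. x \<in> V \<Longrightarrow> (v2 has_derivative (*v) (A2 x)) (at x)" and cont2: "continuous_on V A2"
    and cl1: "\<And>x i. x \<in> V \<Longrightarrow> \<bar>v1 x $ i - u x $ i\<bar> < \<delta>"
    and cl2: "\<And>x i. x \<in> V \<Longrightarrow> \<bar>v2 x $ i - u x $ i\<bar> < \<delta>"
    and w1: "\<And>i. y $ i - \<delta> \<le> w1 $ i \<and> w1 $ i + e1 \<le> y $ i + \<delta>"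
    and w2: "\<And>i. y $ i - \<delta> \<le> w2 $ i \<and> w2 $ i + e2 \<le> y $ i + \<delta>"
  shows "(LINT x:V|lborel. kap e1 (v1 x - w1) * det (A1 x)) =
         (LINT x:V|lborel. kap e2 (v2 x - w2) * det (A2 x))"
proof (rule integral_kap_match[OF V(1) bounded_subset[OF U(2) V(2)] e der1 cont1 der2 cont2
      compact_preimage_cub(1)[OF U(2,1) u \<delta>] V(3)])
  fix x assume x: "x \<in> V - {x \<in> closure U. u x \<in> cub y (2 * \<delta>)}"
  then have "x \<in> closure U" using V(2) closure_subset by blast
  with x obtain i where i: "\<bar>u x $ i - y $ i\<bar> > 2 * \<delta>" by (auto simp: cub_def not_le)
  have "\<bar>v1 x $ i - u x $ i\<bar> < \<delta>" "\<bar>v2 x $ i - u x $ i\<bar> < \<delta>" using cl1 cl2 x by auto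
  with i w1[of i] w2[of i] e show "\<exists>i. (v1 x $ i < w1 $ i \<and> v2 x $ i < w2 $ i) \<or>
                 (v1 x $ i > w1 $ i + e1 \<and> v2 x $ i > w2 $ i + e2)"
    by (intro exI[of _ i]) argo
qed

lemma integral_sig':
  assumes "e > 0"
  shows "(\<integral>\<^sup>+t. ennreal (sig' ((c - t) / e) / e) \<partial>lborel) = 1"
proof -
  have "(\<integral>\<^sup>+t. ennreal (sig' ((c - t) / e) / e) * indicator {c - e..c} t \<partial>lborel) =
     ennreal (- sig ((c - c) / e) - - sig ((c - (c - e)) / e))"
  proof (rule nn_integral_FTC_Icc)
    show "(\<lambda>t. sig' ((c - t) / e) / e) \<in> borel_measurable borel"
      using assms by (intro borel_measurable_continuous_onI continuous_intros) auto
    show "DERIV (\<lambda>t. - sig ((c - t) / e)) t :> sig' ((c - t) / e) / e" for t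
    proof -
      have "((\<lambda>t. (c - t) / e) has_real_derivative - (1 / e)) (at t)"
        using assms by (auto intro!: derivative_eq_intros)
      from DERIV_minus[OF DERIV_chain2[OF sig_deriv this]] show ?thesis by simp
    qed
    show "0 \<le> sig' ((c - t) / e) / e" for t using assms sig'_bounds by simp
  qed (use assms in auto)
  moreover have "ennreal (sig' ((c - t) / e) / e) * indicator {c - e..c} t = ennreal (sig' ((c - t) / e) / e)" for t
    using assms sig'_out[of "(c - t) / e"] by (auto simp: indicator_def field_simps)
  ultimately show ?thesis using assms by (simp add: sig_ge1 sig_le0)
qed

lemma integral_kap:
  fixes z :: "real^'n"
  assumes "e > 0"
  shows "has_bochner_integral lborel (\<lambda>w. kap e (z - w)) 1"
proof (rule has_bochner_integral_nn_integral)
  show "(\<lambda>w. kap e (z - w)) \<in> borel_measurable lborel"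
    by (auto intro!: borel_measurable_continuous_onI continuous_intros)
  have "(\<integral>\<^sup>+w. ennreal (kap e (z - w)) \<partial>lborel) =
     (\<integral>\<^sup>+w. (\<Prod>b\<in>Basis. ennreal (sig' ((z \<bullet> b - w \<bullet> b) / e) / e)) \<partial>lborel)"
    using assms sig'_bounds by (simp add: prod_Basis_cart inner_axis kap_def prod_ennreal)
  also have "\<dots> = (\<Prod>b\<in>(Basis :: (real^'n) set). \<integral>\<^sup>+t. ennreal (sig' ((z \<bullet> b - t) / e) / e) \<partial>lborel)"
    using assms by (intro nn_integral_lborel_prod measurable_compose[OF _ measurable_ennreal]
        borel_measurable_continuous_onI continuous_intros) auto
  also have "\<dots> = 1" using integral_sig'[OF assms] by simp
  finally show "(\<integral>\<^sup>+w. ennreal (kap e (z - w)) \<partial>lborel) = ennreal 1" by simp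
qed (use assms kap_nonneg in auto)

lemma uniformly_far:
  fixes v :: "real^'n \<Rightarrow> real^'n"
  assumes "closed S" "compact (v ` F)" "S \<inter> v ` F = {}"
  shows "\<exists>d>0. \<forall>w\<in>S. \<forall>x\<in>F. \<exists>i. 2 * d < \<bar>v x $ i - w $ i\<bar>"
proof -
  obtain d where d: "d > 0" "\<And>w z. w \<in> S \<Longrightarrow> z \<in> v ` F \<Longrightarrow> d \<le> dist w z"
    using separate_closed_compact[OF assms] by blast
  \<comment> \<open>\<open>norm_le_cub\<close> costs the factor \<open>CARD('n)\<close>; with 4 in
    place of 2 the bound below is \<open>d / 2\<close>, strictly less than \<open>d\<close>.\<close>
  define d' where "d' = d / (4 * real CARD('n))"
  have "\<exists>i. 2 * d' < \<bar>v x $ i - w $ i\<bar>" if "w \<in> S" "x \<in> F" for w x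
  proof (rule ccontr)
    assume "\<not> ?thesis"
    then have "v x \<in> cub w (2 * d')" by (auto simp: cub_def not_less)
    then have "norm (v x - w) \<le> real CARD('n) * (2 * d')" by (rule norm_le_cub)
    also have "\<dots> < d" using d(1) by (simp add: d'_def)
    finally show False using d(2)[of w "v x"] that by (auto simp: dist_norm norm_minus_commute)
  qed
  moreover have "d' > 0" using d(1) by (simp add: d'_def)
  ultimately show ?thesis by blast
qed

lemma uniformly_far_point:
  fixes v :: "real^'n \<Rightarrow> real^'n"
  assumes "compact (v ` F)" "y \<notin> v ` F"
  shows "\<exists>d>0. \<forall>x\<in>F. \<exists>i. 2 * d < \<bar>v x $ i - y $ i\<bar>"
  using uniformly_far[of "{y}" v F] assms by auto

text \<open>
  The integral of \<open>kap e (v x - w) * det (A x)\<close> is locally constant in \<open>w\<close> off \<open>v(\<partial>U)\<close>.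
  Averaging it over \<open>w\<close> with weight \<open>\<phi>\<close> and letting \<open>e\<close> tend to 0 recovers the left-hand side.
\<close>

lemma test_form_integral:
  fixes v :: "real^'n \<Rightarrow> real^'n"
  assumes U: "open U" "bounded U" and W: "open W" "closure U \<subseteq> W"
    and der: "\<And>x. x \<in> W \<Longrightarrow> (v has_derivative (*v) (A x)) (at x)"
    and contA: "continuous_on W A" and contv: "continuous_on W v"
    and \<delta>: "\<delta> > 0" "\<forall>x\<in>frontier U. \<exists>i. 2 * \<delta> < \<bar>v x $ i - y $ i\<bar>"
    and \<phi>: "\<phi> \<in> degree_test_form v U y"
  shows "(LINT x:U|lborel. \<phi> (v x) * det (A x)) = (LINT x:U|lborel. kap \<delta> (v x - y) * det (A x))"
proof -
  define J where "J e w = (LINT x:U|lborel. kap e (v x - w) * det (A x))" for e w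
  define good where "good d w \<longleftrightarrow> (\<forall>x\<in>frontier U. \<exists>i. 2 * d < \<bar>v x $ i - w $ i\<bar>)" for d w
  have UW: "U \<subseteq> W" using W(2) closure_subset by blast
  have contU: "continuous_on (closure U) v" by (rule continuous_on_subset[OF contv W(2)])
  have cl: "compact (closure U)" using U(2) by (simp add: compact_closure)
  have J_eq: "J e1 w1 = J e2 w2" if "d > 0" "good d w" "0 < e1" "0 < e2"
    "\<And>i. w $ i - d \<le> w1 $ i \<and> w1 $ i + e1 \<le> w $ i + d"
    "\<And>i. w $ i - d \<le> w2 $ i \<and> w2 $ i + e2 \<le> w $ i + d" for d w e1 e2 w1 w2
    unfolding J_def
  proof (rule integral_kap_const[OF U contU that(2)[unfolded good_def] U(1) _ _ that(3,4)])
    show "{x \<in> closure U. v x \<in> cub w (2 * d)} \<subseteq> U"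
      by (rule compact_preimage_cub[OF U(2,1) contU that(2)[unfolded good_def]])
    show "(v has_derivative (*v) (A x)) (at x)" if "x \<in> U" for x using der UW that by blast
    then show "(v has_derivative (*v) (A x)) (at x)" if "x \<in> U" for x using that by blast
    show "continuous_on U A" by (rule continuous_on_subset[OF contA UW])
    then show "continuous_on U A" .
  qed (use that in auto)
  let ?F = "v ` frontier U"
  have Fc: "compact ?F"
    by (intro compact_continuous_image continuous_on_subset[OF contv])
       (use U(2) W(2) in \<open>auto simp: frontier_def compact_frontier_bounded[unfolded frontier_def]\<close>)
  have good_y: "good \<delta> y" using \<delta>(2) by (simp add: good_def)
  have good_ex: "\<exists>d>0. good d w" if "w \<notin> ?F" for w
    using uniformly_far_point[OF Fc that] unfolding good_def .
  \<comment> \<open>By \<open>J_eq\<close> all admissible widths give the same value; choosing one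
    turns it into a function of the point \<open>w\<close> alone.\<close>
  define j where "j w = J (SOME d. 0 < d \<and> good d w) w" for w
  have j: "J e w' = j w" if "d > 0" "good d w" "0 < e"
    "\<And>i. w $ i - d \<le> w' $ i \<and> w' $ i + e \<le> w $ i + d" for d w e w'
  proof -
    define d0 where "d0 = (SOME d. 0 < d \<and> good d w)"
    have d0: "0 < d0 \<and> good d0 w" unfolding d0_def by (rule someI[of _ d]) (use that in simp)
    have "J e w' = J (min d d0) w" by (rule J_eq[OF that(1-3)]) (use that d0 in auto)
    also have "\<dots> = J d0 w" by (rule J_eq[of d0 w]) (use that d0 in auto)
    finally show ?thesis by (simp add: j_def d0_def)
  qed
  define V where "V = connected_component_set (- ?F) y"
  have VF: "V \<subseteq> - ?F" unfolding V_def by (rule connected_component_subset)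
  \<comment> \<open>Moving \<open>w\<close> by \<open>d / 2\<close> leaves a distance of more than
    \<open>3 * d / 2\<close>, so the radius \<open>d / 4\<close> is admissible at
    \<open>z\<close>.\<close>
  have loc: "j z = j w" if "w \<notin> ?F" "d > 0" "good d w" "z \<in> cub w (d / 2)" for w z d
  proof -
    note th = that
    have zi: "\<bar>z $ i - w $ i\<bar> \<le> d / 2" for i using that(4) by (simp add: cub_def)
    have gz: "good (d / 4) z" unfolding good_def
    proof
      fix x assume "x \<in> frontier U"
      then obtain i where "2 * d < \<bar>v x $ i - w $ i\<bar>" using th(3) unfolding good_def by blast
      then show "\<exists>i. 2 * (d / 4) < \<bar>v x $ i - z $ i\<bar>" using zi[of i] th(2) by (intro exI[of _ i]) argo
    qed
    have "J (d / 4) z = j w"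
    proof (rule j[OF that(2,3)])
      show "w $ i - d \<le> z $ i \<and> z $ i + d / 4 \<le> w $ i + d" for i using zi[of i] that(2) by argo
    qed (use that in simp)
    moreover have "J (d / 4) z = j z" by (rule j[OF _ gz]) (use that in auto)
    ultimately show ?thesis by simp
  qed
  have "j constant_on V"
  proof (rule locally_constant_imp_constant)
    show "connected V" unfolding V_def by (rule connected_connected_component)
    fix w assume w: "w \<in> V"
    with VF have wF: "w \<notin> ?F" by blast
    from good_ex[OF this] obtain d where d: "d > 0" "good d w" by blast
    show "\<exists>T. openin (top_of_set V) T \<and> w \<in> T \<and> (\<forall>x\<in>T. j x = j w)"
    proof (intro exI conjI ballI)
      show "openin (top_of_set V) (V \<inter> ball w (d / 2))" by (simp add: openin_open_Int)
      show "w \<in> V \<inter> ball w (d / 2)" using w d by simp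
      show "j x = j w" if "x \<in> V \<inter> ball w (d / 2)" for x
      proof (rule loc[OF wF d])
        have "x \<in> cball w (d / 2)" using that by simp
        then show "x \<in> cub w (d / 2)" using cball_subset_cub by blast
      qed
    qed
  qed
  moreover have yV: "y \<in> V"
  proof -
    have "y \<notin> ?F" using good_y \<delta>(1) unfolding good_def by force
    then show ?thesis by (simp add: V_def connected_component_refl)
  qed
  ultimately have jV: "j w = j y" if "w \<in> V" for w using that unfolding constant_on_def by metis
  define C where "C = closure {z. \<phi> z \<noteq> 0}"
  have CV: "C \<subseteq> V" and sm: "smooth_on \<phi> UNIV" and int\<phi>: "has_bochner_integral lborel \<phi> 1"
    using \<phi> by (auto simp: degree_test_form_def C_def V_def)
  have cont\<phi>: "continuous_on S \<phi>" for S
    using smooth_on_imp_continuous[OF sm] continuous_on_subset by blast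
  \<comment> \<open>A single width for all \<open>w\<close> in the support of \<open>\<phi>\<close>:
    \<open>C\<close> is closed and disjoint from the compact set \<open>?F\<close>.\<close>
  obtain d0 where d0: "d0 > 0" "\<And>w. w \<in> C \<Longrightarrow> good d0 w"
    using uniformly_far[of C v "frontier U"] Fc CV VF unfolding good_def C_def by blast
  have \<phi>J: "\<phi> w * J e w = \<phi> w * j y" if "0 < e" "e \<le> d0" for e w
  proof (cases "w \<in> C")
    case True
    have "J e w = j w" by (rule j[OF d0(1) d0(2)[OF True] that(1)]) (use that in auto)
    with jV True CV show ?thesis by auto
  next
    case False
    then have "\<phi> w = 0" using closure_subset[of "{z. \<phi> z \<noteq> 0}"] by (auto simp: C_def)
    then show ?thesis by simp
  qed
  \<comment> \<open>The mollification of \<open>\<phi>\<close> by \<open>kap e\<close>, evaluated at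
    \<open>v x\<close>.\<close>
  define \<Phi> where "\<Phi> e x = (LINT w|lborel. \<phi> w * kap e (v x - w))" for e x
  have bv: "bounded (v ` closure U)"
    by (intro compact_imp_bounded compact_continuous_image contU cl)
  then obtain R where R: "\<And>x. x \<in> closure U \<Longrightarrow> norm (v x) \<le> R" by (auto simp: bounded_iff)
  define B where "B = cball (0::real^'n) (R + real CARD('n))"
  have kapB: "w \<in> B" if "x \<in> closure U" "0 < e" "e \<le> 1" "kap e (v x - w) \<noteq> 0" for x e w
  proof -
    have "\<bar>w $ i - v x $ i\<bar> \<le> e" for i
      using kap_nonzero[OF that(2,4), of i] by simp
    then have "w \<in> cub (v x) e" by (simp add: cub_def)
    then have "norm (w - v x) \<le> real CARD('n) * e" by (rule norm_le_cub)
    also have "\<dots> \<le> real CARD('n) * 1" using that by (intro mult_left_mono) auto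
    finally show ?thesis using R[OF that(1)] norm_triangle_sub[of w "v x"] by (simp add: B_def)
  qed
  \<comment> \<open>Integrating over \<open>x\<close> first gives \<open>\<phi> w * J e w\<close>,
    that is, the constant \<open>j y\<close> times \<open>\<phi> w\<close>, and
    \<open>\<phi>\<close> has integral 1.\<close>
  have fubini: "(LINT x:U|lborel. \<Phi> e x * det (A x)) = j y"
    and int\<Phi>: "set_integrable lborel U (\<lambda>x. \<Phi> e x * det (A x))" if e: "0 < e" "e \<le> d0" "e \<le> 1" for e
  proof -
    define g where "g = (\<lambda>(x, w). \<phi> w * kap e (v x - w) * det (A x))"
    have "continuous_on (closure U \<times> B) g" unfolding g_def case_prod_beta
      by (intro continuous_intros continuous_on_compose2[OF cont\<phi>[of UNIV]]
          continuous_on_compose2[OF contA] continuous_on_compose2[OF contv]) (use W(2) in auto)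
    then have "integrable (lborel :: ((real^'n) \<times> (real^'n)) measure) (\<lambda>z. indicator (closure U \<times> B) z *\<^sub>R g z)"
      by (intro borel_integrable_compact compact_Times cl) (auto simp: B_def)
    moreover have "U \<times> UNIV \<in> sets (lborel :: ((real^'n) \<times> (real^'n)) measure)"
      unfolding sets_lborel by (intro borel_open open_Times U(1) open_UNIV)
    ultimately have "integrable (lborel :: ((real^'n) \<times> (real^'n)) measure)
        (\<lambda>z. indicator (U \<times> UNIV) z *\<^sub>R (indicator (closure U \<times> B) z *\<^sub>R g z))"
      by (rule integrable_mult_indicator[rotated])
    moreover have "(\<lambda>z. indicator (U \<times> UNIV) z *\<^sub>R (indicator (closure U \<times> B) z *\<^sub>R g z)) =
        (\<lambda>(x, w). indicator U x * (\<phi> w * kap e (v x - w) * det (A x)))"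
    proof (rule ext, clarify)
      fix x w
      have "x \<in> U \<Longrightarrow> x \<in> closure U" using closure_subset by blast
      then show "indicator (U \<times> UNIV) (x, w) *\<^sub>R (indicator (closure U \<times> B) (x, w) *\<^sub>R g (x, w)) =
         indicator U x * (\<phi> w * kap e (v x - w) * det (A x))"
        using kapB[OF _ e(1,3), of x w] by (auto simp: g_def indicator_def)
    qed
    ultimately have "integrable (lborel \<Otimes>\<^sub>M lborel)
        (\<lambda>(x, w). indicator U x * (\<phi> w * kap e (v x - w) * det (A x)))"
      by (simp add: lborel_prod)
    note int = this
    have inner: "(LINT w|lborel. indicator U x * (\<phi> w * kap e (v x - w) * det (A x))) =
        indicator U x * (\<Phi> e x * det (A x))" for x
      unfolding \<Phi>_def by (simp flip: integral_mult_right_zero integral_mult_left_zero add: mult_ac)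
    show "set_integrable lborel U (\<lambda>x. \<Phi> e x * det (A x))"
      using lborel_pair.integrable_fst'[OF int] by (simp add: set_integrable_def \<Phi>_def)
    from lborel_pair.Fubini_integral[OF int]
    have "(LINT w|lborel. LINT x|lborel. indicator U x * (\<phi> w * kap e (v x - w) * det (A x))) =
      (LINT x|lborel. LINT w|lborel. indicator U x * (\<phi> w * kap e (v x - w) * det (A x)))" .
    also have "(LINT w|lborel. LINT x|lborel. indicator U x * (\<phi> w * kap e (v x - w) * det (A x))) =
        (LINT w|lborel. \<phi> w * j y)"
    proof (rule Bochner_Integration.integral_cong[OF refl])
      fix w
      have "(LINT x|lborel. indicator U x * (\<phi> w * kap e (v x - w) * det (A x))) = \<phi> w * J e w"
        unfolding J_def set_lebesgue_integral_def by (subst integral_mult_right_zero[symmetric]) (simp add: mult_ac)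
      then show "(LINT x|lborel. indicator U x * (\<phi> w * kap e (v x - w) * det (A x))) = \<phi> w * j y"
        using \<phi>J[OF e(1,2)] by simp
    qed
    also have "\<dots> = j y" using has_bochner_integral_integral_eq[OF int\<phi>] by simp
    also have "(LINT x|lborel. LINT w|lborel. indicator U x * (\<phi> w * kap e (v x - w) * det (A x))) =
       (LINT x:U|lborel. \<Phi> e x * det (A x))"
      by (simp add: set_lebesgue_integral_def \<Phi>_def)
    finally show "(LINT x:U|lborel. \<Phi> e x * det (A x)) = j y" by simp
  qed
  have contdet: "continuous_on (closure U) (\<lambda>x. det (A x))"
    by (intro continuous_intros continuous_on_subset[OF contA W(2)])
  have set_int: "set_integrable lborel U f" if "continuous_on (closure U) f" for f :: "real^'n \<Rightarrow> real"
  proof (rule set_integrable_subset)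
    show "set_integrable lborel (closure U) f" unfolding set_integrable_def
      by (intro borel_integrable_compact cl that)
  qed (use U closure_subset in \<open>auto simp: borel_open\<close>)
  have cont\<phi>v: "continuous_on (closure U) (\<lambda>x. \<phi> (v x))"
    by (rule continuous_on_compose2[OF cont\<phi>[of UNIV] contU]) auto
  define I where "I = (LINT x:U|lborel. \<phi> (v x) * det (A x))"
  define M where "M = (LINT x:U|lborel. \<bar>det (A x)\<bar>)"
  have intI: "set_integrable lborel U (\<lambda>x. \<phi> (v x) * det (A x))"
    by (intro set_int continuous_intros cont\<phi>v contdet)
  have intM: "set_integrable lborel U (\<lambda>x. \<omega> * \<bar>det (A x)\<bar>)" for \<omega>
    by (intro set_int continuous_intros contdet)
  have est: "\<bar>j y - I\<bar> \<le> \<omega> * M" if \<omega>: "\<omega> > 0" for \<omega>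
  proof -
    have "uniformly_continuous_on B \<phi>"
      by (rule compact_uniformly_continuous[OF cont\<phi>]) (simp add: B_def)
    then obtain \<eta> where \<eta>: "\<eta> > 0" "\<And>z z'. z \<in> B \<Longrightarrow> z' \<in> B \<Longrightarrow> dist z' z < \<eta> \<Longrightarrow> dist (\<phi> z') (\<phi> z) < \<omega>"
      using \<omega> unfolding uniformly_continuous_on_def by metis
    define e where "e = min (min d0 1) (\<eta> / (2 * real CARD('n)))"
    have e: "0 < e" "e \<le> d0" "e \<le> 1" using d0(1) \<eta>(1) by (auto simp: e_def)
    have close: "\<bar>\<Phi> e x - \<phi> (v x)\<bar> \<le> \<omega>" if x: "x \<in> U" for x
    proof -
      have xc: "x \<in> closure U" using x closure_subset by blast
      have vB: "v x \<in> B" using R[OF xc] by (simp add: B_def add_increasing2)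
      have k0: "kap e (v x - w) = 0" if "w \<notin> B" for w using kapB[OF xc e(1,3)] that by blast
      have i1: "integrable lborel (\<lambda>w. \<phi> w * kap e (v x - w))"
        by (rule integrable_compact_support[of _ B]) (auto intro!: continuous_intros cont\<phi> simp: k0, simp add: B_def)
      note ik = integral_kap[OF e(1), of "v x"]
      have i2: "integrable lborel (\<lambda>w. c * kap e (v x - w))" for c
        using ik by (intro integrable_mult_right) (simp add: has_bochner_integral_iff)
      have int1: "(LINT w|lborel. c * kap e (v x - w)) = c" for c
        using ik by (simp add: has_bochner_integral_iff)
      have "\<bar>\<Phi> e x - \<phi> (v x)\<bar> = \<bar>LINT w|lborel. \<phi> w * kap e (v x - w) - \<phi> (v x) * kap e (v x - w)\<bar>"
        unfolding Bochner_Integration.integral_diff[OF i1 i2] int1 \<Phi>_def ..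
      also have "\<dots> \<le> (LINT w|lborel. \<bar>\<phi> w * kap e (v x - w) - \<phi> (v x) * kap e (v x - w)\<bar>)"
        by (rule integral_abs_bound)
      also have "\<dots> \<le> (LINT w|lborel. \<omega> * kap e (v x - w))"
      proof (rule integral_mono)
        fix w
        show "\<bar>\<phi> w * kap e (v x - w) - \<phi> (v x) * kap e (v x - w)\<bar> \<le> \<omega> * kap e (v x - w)"
        proof (cases "kap e (v x - w) = 0")
          case False
          have wB: "w \<in> B" using k0 False by blast
          have "\<bar>w $ i - v x $ i\<bar> \<le> e" for i
            using kap_nonzero[OF e(1) False, of i] by simp
          then have "w \<in> cub (v x) e" by (simp add: cub_def)
          then have "norm (w - v x) \<le> real CARD('n) * e" by (rule norm_le_cub)
          also have "\<dots> \<le> real CARD('n) * (\<eta> / (2 * real CARD('n)))" by (intro mult_left_mono) (auto simp: e_def)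
          also have "\<dots> < \<eta>" using \<eta>(1) by simp
          finally have "\<bar>\<phi> w - \<phi> (v x)\<bar> \<le> \<omega>" using \<eta>(2)[OF vB wB] by (simp add: dist_norm less_imp_le)
          then show ?thesis
            using kap_nonneg[OF e(1), of "v x - w"]
            by (simp add: mult_right_mono abs_mult flip: left_diff_distrib)
        qed simp
      qed (intro integrable_abs Bochner_Integration.integrable_diff i1 i2)+
      also have "\<dots> = \<omega>" by (rule int1)
      finally show ?thesis .
    qed
    have "\<bar>j y - I\<bar> = \<bar>LINT x:U|lborel. \<Phi> e x * det (A x) - \<phi> (v x) * det (A x)\<bar>"
      unfolding I_def using fubini[OF e] by (simp add: set_integral_diff[OF int\<Phi>[OF e] intI])
    also have "\<dots> \<le> (LINT x:U|lborel. \<bar>\<Phi> e x * det (A x) - \<phi> (v x) * det (A x)\<bar>)"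
      using set_integral_norm_bound[OF set_integral_diff(1)[OF int\<Phi>[OF e] intI]] by simp
    also have "\<dots> \<le> (LINT x:U|lborel. \<omega> * \<bar>det (A x)\<bar>)"
    proof (rule set_integral_mono)
      show "\<bar>\<Phi> e x * det (A x) - \<phi> (v x) * det (A x)\<bar> \<le> \<omega> * \<bar>det (A x)\<bar>" if "x \<in> U" for x
        using close[OF that] by (simp add: mult_right_mono abs_mult flip: left_diff_distrib)
    qed (intro intM set_integrable_abs set_integral_diff int\<Phi>[OF e] intI)+
    also have "\<dots> = \<omega> * M" by (simp add: M_def)
    finally show ?thesis .
  qed
  have "\<bar>j y - I\<bar> \<le> 0"
  proof (rule field_le_epsilon)
    fix t :: real assume t: "t > 0"
    have M0: "M \<ge> 0" unfolding M_def set_lebesgue_integral_def by simp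
    have "\<bar>j y - I\<bar> \<le> t / (M + 1) * M" by (rule est) (use t M0 in simp)
    also have "\<dots> \<le> t" using t M0 by (simp add: field_simps)
    finally show "\<bar>j y - I\<bar> \<le> 0 + t" by simp
  qed
  moreover have "J \<delta> y = j y" by (rule j[OF \<delta>(1) good_y \<delta>(1)]) (use \<delta>(1) in auto)
  ultimately show ?thesis by (simp add: I_def J_def)
qed

section \<open>Explicit formulas for the degree of smooth and of continuous maps\<close>

lemma smooth_degree_eqI:
  assumes "compact (u ` frontier U)" "y \<notin> u ` frontier U"
    and "\<And>\<phi>. \<phi> \<in> degree_test_form u U y \<Longrightarrow>
        (LINT x:U|lborel. \<phi> (u x) * det (jac u x)) = c"
  shows "smooth_degree u U y = c"
  unfolding smooth_degree_def jac_def[symmetric]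
proof (rule the_equality)
  fix c' assume "\<forall>\<phi>\<in>degree_test_form u U y. (LINT x:U|lborel. \<phi> (u x) * det (jac u x)) = c'"
  then show "c' = c" using degree_test_form_nonempty[OF assms(1,2)] assms(3) by (metis all_not_in_conv)
qed (use assms(3) in blast)

lemma compact_image_frontier:
  fixes u :: "real^'n \<Rightarrow> real^'m"
  assumes "bounded U" "continuous_on (closure U) u"
  shows "compact (u ` frontier U)"
  by (intro compact_continuous_image continuous_on_subset[OF assms(2)] compact_frontier_bounded[OF assms(1)])
    (auto simp: frontier_def)

lemma smooth_degree_eq:
  fixes v :: "real^'n \<Rightarrow> real^'n"
  assumes U: "open U" "bounded U" and v: "v \<in> smooth_closure U"
    and \<delta>: "\<delta> > 0" "\<forall>x\<in>frontier U. \<exists>i. 2 * \<delta> < \<bar>v x $ i - y $ i\<bar>"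
  shows "smooth_degree v U y = (LINT x:U|lborel. kap \<delta> (v x - y) * det (jac v x))"
proof -
  obtain W where W: "open W" "closure U \<subseteq> W" "\<And>x. x \<in> W \<Longrightarrow> (v has_derivative (*v) (jac v x)) (at x)"
    "continuous_on W (jac v)" "continuous_on W v"
    using smooth_closureD[OF v] by metis
  show ?thesis
  proof (rule smooth_degree_eqI)
    show "compact (v ` frontier U)"
      by (rule compact_image_frontier[OF U(2) continuous_on_subset[OF W(5,2)]])
    show "y \<notin> v ` frontier U" using \<delta> by force
  qed (rule test_form_integral[OF U W \<delta>])
qed

text \<open>All smooth maps within \<open>\<delta>\<close> of \<open>u\<close> have the same smooth
  degree, so along an approximating sequence it is eventually constant. The existence of one such
  sequence makes the described number unique.\<close>

theorem brouwer_degree_eq: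
  fixes u :: "real^'n \<Rightarrow> real^'n"
  assumes U: "open U" "bounded U" and u: "continuous_on (closure U) u"
    and \<delta>: "\<delta> > 0" "\<forall>x\<in>frontier U. \<exists>i. 2 * \<delta> < \<bar>u x $ i - y $ i\<bar>"
    and v: "v \<in> smooth_closure U" "\<And>x i. x \<in> closure U \<Longrightarrow> \<bar>v x $ i - u x $ i\<bar> < \<delta>"
  shows "brouwer_degree u U y = (LINT x:U|lborel. kap \<delta> (v x - y) * det (jac v x))"
proof -
  define c where "c = (LINT x:U|lborel. kap \<delta> (v x - y) * det (jac v x))"
  have yu: "y \<notin> u ` frontier U" using \<delta> by force
  have UK: "{x \<in> closure U. u x \<in> cub y (2 * \<delta>)} \<subseteq> U"
    by (rule compact_preimage_cub[OF U(2,1) u \<delta>(2)])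
  have sub: "U \<subseteq> closure U" by (rule closure_subset)
  have deg: "smooth_degree g U y = c"
    if g: "g \<in> smooth_closure U" and gu: "\<And>x i. x \<in> closure U \<Longrightarrow> \<bar>g x $ i - u x $ i\<bar> < \<delta>" for g
  proof -
    obtain W where W: "open W" "closure U \<subseteq> W" "\<And>x. x \<in> W \<Longrightarrow> (g has_derivative (*v) (jac g x)) (at x)"
      "continuous_on W (jac g)" "continuous_on W g"
      using smooth_closureD[OF g] by metis
    obtain W' where W': "open W'" "closure U \<subseteq> W'" "\<And>x. x \<in> W' \<Longrightarrow> (v has_derivative (*v) (jac v x)) (at x)"
      "continuous_on W' (jac v)" "continuous_on W' v"
      using smooth_closureD[OF v(1)] by metis
    have UW: "U \<subseteq> W" "U \<subseteq> W'" using sub W(2) W'(2) by auto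
    have far: "\<forall>x\<in>frontier U. \<exists>i. \<delta> < \<bar>g x $ i - y $ i\<bar>"
    proof
      fix x assume x: "x \<in> frontier U"
      then obtain i where i: "2 * \<delta> < \<bar>u x $ i - y $ i\<bar>" using \<delta>(2) by blast
      have "\<bar>g x $ i - u x $ i\<bar> < \<delta>" using gu x by (simp add: frontier_def)
      with i show "\<exists>i. \<delta> < \<bar>g x $ i - y $ i\<bar>" by (intro exI[of _ i]) argo
    qed
    \<comment> \<open>\<open>g\<close> may be closer to \<open>y\<close> than \<open>u\<close> by
      \<open>\<delta>\<close>, which leaves \<open>\<delta>\<close> of the distance
      \<open>2 * \<delta>\<close>; hence half the width.\<close>
    have "smooth_degree g U y = (LINT x:U|lborel. kap (\<delta> / 2) (g x - y) * det (jac g x))"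
      using \<delta>(1) far by (intro smooth_degree_eq[OF U g]) auto
    also have "\<dots> = c" unfolding c_def
    proof (rule integral_kap_const[OF U u \<delta>(2) U(1) order_refl UK])
      show "(g has_derivative (*v) (jac g x)) (at x)" if "x \<in> U" for x using W(3) UW that by blast
      show "(v has_derivative (*v) (jac v x)) (at x)" if "x \<in> U" for x using W'(3) UW that by blast
      show "continuous_on U (jac g)" by (rule continuous_on_subset[OF W(4) UW(1)])
      show "continuous_on U (jac v)" by (rule continuous_on_subset[OF W'(4) UW(2)])
      show "\<bar>g x $ i - u x $ i\<bar> < \<delta>" if "x \<in> U" for x i using gu that sub by blast
      show "\<bar>v x $ i - u x $ i\<bar> < \<delta>" if "x \<in> U" for x i using v(2) that sub by blast
    qed (use \<delta>(1) in auto)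
    finally show ?thesis .
  qed
  have lim: "(\<lambda>k. smooth_degree (g k) U y) \<longlonglongrightarrow> c"
    if g: "\<forall>k. g k \<in> smooth_closure U" "uniform_limit (closure U) g u sequentially" for g
  proof (rule tendsto_eventually)
    have "\<forall>\<^sub>F k in sequentially. \<forall>x\<in>closure U. dist (g k x) (u x) < \<delta>"
      using g(2) \<delta>(1) by (simp add: uniform_limit_iff)
    then show "\<forall>\<^sub>F k in sequentially. smooth_degree (g k) U y = c"
    proof eventually_elim
      case (elim k)
      have "\<bar>g k x $ i - u x $ i\<bar> < \<delta>" if "x \<in> closure U" for x i
        using component_le_norm_cart[of "g k x - u x" i] elim that by (force simp: dist_norm)
      with g(1) show ?case by (intro deg) auto
    qed
  qed
  have "\<forall>k. \<exists>g\<in>smooth_closure U. \<forall>x\<in>closure U. norm (g x - u x) < 1 / real (Suc k)"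
    by (intro allI smooth_approximation[OF U(2) u]) simp
  then obtain g where g: "\<And>k. g k \<in> smooth_closure U" "\<And>k x. x \<in> closure U \<Longrightarrow> norm (g k x - u x) < 1 / real (Suc k)"
    by metis
  have ug: "uniform_limit (closure U) g u sequentially"
    unfolding uniform_limit_iff
  proof (intro allI impI)
    fix e :: real assume "e > 0"
    then have "\<forall>\<^sub>F k in sequentially. 1 / real (Suc k) < e"
      using order_tendstoD(2)[OF LIMSEQ_inverse_real_of_nat, of e] by (simp add: inverse_eq_divide)
    then show "\<forall>\<^sub>F k in sequentially. \<forall>x\<in>closure U. dist (g k x) (u x) < e"
    proof eventually_elim
      case (elim k)
      show ?case using g(2)[of _ k] elim by (auto simp: dist_norm intro: less_trans)
    qed
  qed
  have "(THE c. \<forall>g. (\<forall>k. g k \<in> smooth_closure U) \<and> uniform_limit (closure U) g u sequentially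
             \<longrightarrow> (\<lambda>k. smooth_degree (g k) U y) \<longlonglongrightarrow> c) = c"
  proof (rule the_equality)
    fix c' assume "\<forall>g. (\<forall>k. g k \<in> smooth_closure U) \<and> uniform_limit (closure U) g u sequentially
             \<longrightarrow> (\<lambda>k. smooth_degree (g k) U y) \<longlonglongrightarrow> c'"
    then have "(\<lambda>k. smooth_degree (g k) U y) \<longlonglongrightarrow> c'" using g(1) ug by blast
    with lim[OF _ ug] g(1) show "c' = c" using LIMSEQ_unique by blast
  qed (use lim in blast)
  with yu show ?thesis by (simp add: brouwer_degree_def c_def)
qed

lemma brouwer_degree_smooth:
  fixes v :: "real^'n \<Rightarrow> real^'n"
  assumes U: "open U" "bounded U" and v: "v \<in> smooth_closure U" and y: "y \<notin> v ` frontier U"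
  shows "brouwer_degree v U y = smooth_degree v U y"
proof -
  obtain W where "closure U \<subseteq> W" "continuous_on W v" using smooth_closureD[OF v] by metis
  then have cont: "continuous_on (closure U) v" using continuous_on_subset by blast
  obtain \<delta> where \<delta>: "\<delta> > 0" "\<forall>x\<in>frontier U. \<exists>i. 2 * \<delta> < \<bar>v x $ i - y $ i\<bar>"
    using uniformly_far_point[OF compact_image_frontier[OF U(2) cont] y] by blast
  have "brouwer_degree v U y = (LINT x:U|lborel. kap \<delta> (v x - y) * det (jac v x))"
    by (rule brouwer_degree_eq[OF U cont \<delta> v]) (use \<delta> in simp)
  also have "\<dots> = smooth_degree v U y" by (rule smooth_degree_eq[OF U v \<delta>, symmetric])
  finally show ?thesis .
qed

lemma brouwer_degree_cong:
  assumes "\<And>x. x \<in> closure U \<Longrightarrow> u x = u' x"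
  shows "brouwer_degree u U = brouwer_degree u' U"
proof -
  have "u ` frontier U = u' ` frontier U"
    using assms by (intro image_cong) (auto simp: frontier_def)
  moreover have "uniform_limit (closure U) g u sequentially = uniform_limit (closure U) g u' sequentially" for g
    using assms by (intro uniform_limit_cong') auto
  ultimately show ?thesis unfolding brouwer_degree_def by (intro ext) (simp only:)
qed

text \<open>For \<open>u' = u\<close> this is local constancy in the point, for \<open>z = y\<close>
  stability under uniform convergence. A smooth map close to \<open>u'\<close> is also within
  \<open>\<delta>\<close> of \<open>u\<close>, so both degrees are kernel integrals of the same
  map.\<close>

lemma brouwer_degree_near:
  fixes u u' :: "real^'n \<Rightarrow> real^'n"
  assumes U: "open U" "bounded U" and u: "continuous_on (closure U) u" and u': "continuous_on (closure U) u'"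
    and \<delta>: "\<delta> > 0" "\<forall>x\<in>frontier U. \<exists>i. 2 * \<delta> < \<bar>u x $ i - y $ i\<bar>"
    and close: "\<And>x i. x \<in> closure U \<Longrightarrow> \<bar>u' x $ i - u x $ i\<bar> \<le> \<delta> / 4"
    and z: "z \<in> cub y (\<delta> / 4)"
  shows "brouwer_degree u' U z = brouwer_degree u U y"
proof -
  obtain v where v: "v \<in> smooth_closure U" "\<And>x. x \<in> closure U \<Longrightarrow> norm (v x - u' x) < \<delta> / 4"
    using smooth_approximation[OF U(2) u', of "\<delta> / 4"] \<delta>(1) by auto
  obtain W where W: "open W" "closure U \<subseteq> W" "\<And>x. x \<in> W \<Longrightarrow> (v has_derivative (*v) (jac v x)) (at x)"
    "continuous_on W (jac v)" "continuous_on W v"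
    using smooth_closureD[OF v(1)] by metis
  have UW: "U \<subseteq> W" using closure_subset W(2) by blast
  have vu': "\<bar>v x $ i - u' x $ i\<bar> < \<delta> / 4" if "x \<in> closure U" for x i
    using component_le_norm_cart[of "v x - u' x" i] v(2)[OF that] by simp
  have vu: "\<bar>v x $ i - u x $ i\<bar> < \<delta>" if "x \<in> closure U" for x i
    using vu'[OF that, of i] close[OF that, of i] \<delta>(1) by argo
  have zi: "\<bar>z $ i - y $ i\<bar> \<le> \<delta> / 4" for i using z by (simp add: cub_def)
  have "brouwer_degree u' U z = (LINT x:U|lborel. kap (\<delta> / 4) (v x - z) * det (jac v x))"
  proof (rule brouwer_degree_eq[OF U u' _ _ v(1) vu'])
    show "\<forall>x\<in>frontier U. \<exists>i. 2 * (\<delta> / 4) < \<bar>u' x $ i - z $ i\<bar>"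
    proof
      fix x assume x: "x \<in> frontier U"
      then obtain i where i: "2 * \<delta> < \<bar>u x $ i - y $ i\<bar>" using \<delta>(2) by blast
      have "\<bar>u' x $ i - u x $ i\<bar> \<le> \<delta> / 4" using close x by (simp add: frontier_def)
      with i zi[of i] \<delta>(1) show "\<exists>i. 2 * (\<delta> / 4) < \<bar>u' x $ i - z $ i\<bar>" by (intro exI[of _ i]) argo
    qed
  qed (use \<delta> in auto)
  also have "\<dots> = (LINT x:U|lborel. kap \<delta> (v x - y) * det (jac v x))"
  proof (rule integral_kap_const[OF U u \<delta>(2) U(1) order_refl compact_preimage_cub(2)[OF U(2,1) u \<delta>(2)]])
    show "(v has_derivative (*v) (jac v x)) (at x)" if "x \<in> U" for x using W(3) UW that by blast
    then show "(v has_derivative (*v) (jac v x)) (at x)" if "x \<in> U" for x using that by blast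
    show "continuous_on U (jac v)" by (rule continuous_on_subset[OF W(4) UW])
    then show "continuous_on U (jac v)" .
    show "\<bar>v x $ i - u x $ i\<bar> < \<delta>" if "x \<in> U" for x i using vu that closure_subset by blast
    then show "\<bar>v x $ i - u x $ i\<bar> < \<delta>" if "x \<in> U" for x i using that by blast
    show "y $ i - \<delta> \<le> z $ i \<and> z $ i + \<delta> / 4 \<le> y $ i + \<delta>" for i using zi[of i] \<delta>(1) by argo
  qed (use \<delta>(1) in auto)
  also have "\<dots> = brouwer_degree u U y"
    by (rule brouwer_degree_eq[OF U u \<delta> v(1) vu, symmetric])
  finally show ?thesis .
qed

lemma brouwer_degree_measurable:
  fixes u :: "real^'n \<Rightarrow> real^'n"
  assumes U: "open U" "bounded U" and u: "continuous_on (closure U) u"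
  shows "brouwer_degree u U \<in> borel_measurable borel"
proof -
  let ?F = "u ` frontier U"
  have Fc: "compact ?F" by (rule compact_image_frontier[OF U(2) u])
  have op: "open (- ?F)" using Fc by (simp add: compact_imp_closed open_Compl)
  have "continuous_on (- ?F) (brouwer_degree u U)"
    unfolding continuous_on_eq_continuous_at[OF op]
  proof
    fix y assume "y \<in> - ?F"
    then obtain \<delta> where \<delta>: "\<delta> > 0" "\<forall>x\<in>frontier U. \<exists>i. 2 * \<delta> < \<bar>u x $ i - y $ i\<bar>"
      using uniformly_far_point[OF Fc] by blast
    have "\<forall>\<^sub>F z in nhds y. z \<in> ball y (\<delta> / 4)"
      using \<delta>(1) by (intro eventually_nhds_in_open) auto
    then have "\<forall>\<^sub>F z in nhds y. brouwer_degree u U z = brouwer_degree u U y"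
    proof eventually_elim
      case (elim z)
      then have "z \<in> cball y (\<delta> / 4)" by simp
      then have "z \<in> cub y (\<delta> / 4)" using cball_subset_cub by blast
      then show ?case using \<delta> by (intro brouwer_degree_near[OF U u u \<delta>]) auto
    qed
    then show "isCont (brouwer_degree u U) y"
      unfolding isCont_def by (intro tendsto_eventually) (simp add: eventually_nhds_conv_at)
  qed
  then have "(\<lambda>y. if y \<in> - ?F then brouwer_degree u U y else 0) \<in> borel_measurable borel"
    by (intro borel_measurable_continuous_on_if borel_open op) auto
  moreover have "(\<lambda>y. if y \<in> - ?F then brouwer_degree u U y else 0) = brouwer_degree u U"
    by (auto simp: brouwer_degree_def)
  ultimately show ?thesis by simp
qed

section \<open>Approximating the degree at a dyadic scale\<close>

text \<open>
  The Hoelder condition in the maximum norm, for which balls are the cubes \<open>cub\<close>.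
\<close>

definition holder_cub :: "real \<Rightarrow> real \<Rightarrow> (real^'n) set \<Rightarrow> (real^'n \<Rightarrow> real^'n) \<Rightarrow> bool" where
  "holder_cub \<alpha> E U u \<longleftrightarrow> (\<forall>h>0. \<forall>x\<in>U. \<forall>z\<in>U. z \<in> cub x h \<longrightarrow> u z \<in> cub (u x) (E * h powr \<alpha>))"

text \<open>Grid points outside \<open>U\<close> are left out, so this approximates \<open>u\<close>
  where \<open>cub x h \<subseteq> U\<close>: there all corners of the cell belong to
  \<open>U\<close> and the weights add up to 1.\<close>

definition interp :: "real \<Rightarrow> (real^'n) set \<Rightarrow> (real^'n \<Rightarrow> real^'n) \<Rightarrow> real^'n \<Rightarrow> real^'n" where
  "interp h U u x = (\<chi> i. \<Sum>a | grid_pt h a \<in> U. grid_bump h a x * u (grid_pt h a) $ i)"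

definition interp' :: "real \<Rightarrow> (real^'n) set \<Rightarrow> (real^'n \<Rightarrow> real^'n) \<Rightarrow> real^'n \<Rightarrow> real^'n^'n" where
  "interp' h U u x = (\<chi> i j. \<Sum>a | grid_pt h a \<in> U. grid_bump' h a x $ j * u (grid_pt h a) $ i)"

lemma has_derivative_interp: "(interp h U u has_derivative (*v) (interp' h U u x)) (at x)"
  unfolding interp_def[abs_def]
proof (rule has_derivative_vec_cart)
  fix i
  have "interp' h U u x $ i \<bullet> v = (\<Sum>a | grid_pt h a \<in> U. (grid_bump' h a x \<bullet> v) * u (grid_pt h a) $ i)" for v
    unfolding interp'_def inner_vec_def by (simp add: sum_distrib_right sum_distrib_left mult_ac) (rule sum.swap)
  then have "(\<bullet>) (interp' h U u x $ i) = (\<lambda>v. \<Sum>a | grid_pt h a \<in> U. (grid_bump' h a x \<bullet> v) * u (grid_pt h a) $ i)" by blast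
  then show "((\<lambda>x. \<Sum>a | grid_pt h a \<in> U. grid_bump h a x * u (grid_pt h a) $ i) has_derivative (\<bullet>) (interp' h U u x $ i)) (at x)"
    by (simp only:) (intro has_derivative_sum has_derivative_mult_left has_derivative_grid_bump)
qed

lemma interp_cont: "continuous_on S (interp h U u)"
  by (rule has_derivative_continuous_on[OF has_derivative_at_withinI[OF has_derivative_interp]])

lemma interp'_cont: "continuous_on S (interp' h U u)"
  unfolding interp'_def[abs_def] by (intro continuous_intros grid_bump'_cont)

lemma nbrs_cub:
  assumes "h > 0" "a \<in> nbrs h x"
  shows "grid_pt h a \<in> cub x h"
proof -
  have "\<bar>grid_pt h a $ i - x $ i\<bar> \<le> h" for i
  proof -
    have "a i = \<lfloor>x $ i / h\<rfloor> \<or> a i = \<lfloor>x $ i / h\<rfloor> + 1" using assms(2) by (auto simp: nbrs_def)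
    then have "\<bar>of_int (a i) - x $ i / h\<bar> \<le> 1" by linarith
    then show ?thesis using assms(1) by (simp add: abs_le_iff field_simps grid_pt_def)
  qed
  then show ?thesis by (simp add: cub_def)
qed

text \<open>The weights add up to 1 and their gradients to 0, so \<open>u x\<close> can be
  subtracted from every grid value. Only the oscillation of \<open>u\<close> over the cell remains,
  times the size of the weights or of their gradients.\<close>

lemma interp_bounds:
  fixes x :: "real^'n"
  assumes h: "h > 0" and U: "bounded U" and x: "cub x h \<subseteq> U" and osc: "holder_cub \<alpha> E U u"
  shows "\<bar>interp h U u x $ i - u x $ i\<bar> \<le> E * h powr \<alpha>"
    and "\<bar>interp' h U u x $ i $ j\<bar> \<le> 2 ^ CARD('n) * (2 / h) * (E * h powr \<alpha>)"
proof -
  let ?G = "{a. grid_pt h a \<in> U}"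
  have fin: "finite ?G" by (rule finite_grid[OF h U])
  have sub: "nbrs h x \<subseteq> ?G" using nbrs_cub[OF h] x by blast
  note one = sum_nbrs[OF h fin sub]
  have xU: "x \<in> U" using x cub_self[of h x] h by auto
  have near: "\<bar>u (grid_pt h a) $ i - u x $ i\<bar> \<le> E * h powr \<alpha>" if "a \<in> nbrs h x" for a
    using osc h xU nbrs_cub[OF h that] x unfolding holder_cub_def by (auto simp: cub_def)
  have nz: "a \<in> nbrs h x" if "grid_bump h a x \<noteq> 0 \<or> grid_bump' h a x \<noteq> 0" for a
    by (rule nbrs_memI[OF h grid_bump_nonzero[OF h that]])
  have "interp h U u x $ i - u x $ i = (\<Sum>a\<in>?G. grid_bump h a x * u (grid_pt h a) $ i) - (\<Sum>a\<in>?G. grid_bump h a x) * u x $ i"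
    by (simp add: interp_def one)
  also have "\<dots> = (\<Sum>a\<in>?G. grid_bump h a x * (u (grid_pt h a) $ i - u x $ i))"
    by (simp add: sum_distrib_right sum_subtractf right_diff_distrib)
  also have "\<bar>\<dots>\<bar> \<le> (\<Sum>a\<in>?G. grid_bump h a x * (E * h powr \<alpha>))"
  proof (rule order_trans[OF sum_abs sum_mono])
    fix a assume "a \<in> ?G"
    show "\<bar>grid_bump h a x * (u (grid_pt h a) $ i - u x $ i)\<bar> \<le> grid_bump h a x * (E * h powr \<alpha>)"
      using near[of a] nz[of a] grid_bump_nonneg[of h a x] by (cases "grid_bump h a x = 0") (auto simp: abs_mult intro!: mult_left_mono)
  qed
  also have "\<dots> = E * h powr \<alpha>" by (simp add: one flip: sum_distrib_right)
  finally show "\<bar>interp h U u x $ i - u x $ i\<bar> \<le> E * h powr \<alpha>" .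
  have E0: "0 \<le> E * h powr \<alpha>"
  proof -
    have "nbrs h x \<noteq> {}" using card_nbrs[of h x] by auto
    then show ?thesis using near by (meson abs_ge_zero equals0I order_trans)
  qed
  have "interp' h U u x $ i $ j = (\<Sum>a\<in>?G. grid_bump' h a x $ j * u (grid_pt h a) $ i) - (\<Sum>a\<in>?G. grid_bump' h a x) $ j * u x $ i"
    unfolding one by (simp add: interp'_def)
  also have "\<dots> = (\<Sum>a\<in>?G. grid_bump' h a x $ j * (u (grid_pt h a) $ i - u x $ i))"
    by (simp add: sum_distrib_right sum_subtractf right_diff_distrib)
  also have "\<dots> = (\<Sum>a\<in>nbrs h x. grid_bump' h a x $ j * (u (grid_pt h a) $ i - u x $ i))"
  proof (rule sum.mono_neutral_right[OF fin sub])
    show "\<forall>a\<in>?G - nbrs h x. grid_bump' h a x $ j * (u (grid_pt h a) $ i - u x $ i) = 0"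
      using nz by (metis DiffD2 mult_zero_left zero_index)
  qed
  also have "\<bar>\<dots>\<bar> \<le> (\<Sum>a\<in>nbrs h x. (2 / h) * (E * h powr \<alpha>))"
  proof (rule order_trans[OF sum_abs sum_mono])
    fix a assume "a \<in> nbrs h x"
    with near[of a] grid_bump'_bound[OF h, of a x j] show "\<bar>grid_bump' h a x $ j * (u (grid_pt h a) $ i - u x $ i)\<bar> \<le> (2 / h) * (E * h powr \<alpha>)"
      unfolding abs_mult using h by (intro mult_mono) auto
  qed
  finally show "\<bar>interp' h U u x $ i $ j\<bar> \<le> 2 ^ CARD('n) * (2 / h) * (E * h powr \<alpha>)"
    by (simp add: card_nbrs)
qed

lemma det_bound:
  fixes A :: "real^'n^'n"
  assumes "\<And>i j. \<bar>A $ i $ j\<bar> \<le> c"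
  shows "\<bar>det A\<bar> \<le> fact CARD('n) * c ^ CARD('n)"
proof -
  have "\<bar>det A\<bar> \<le> (\<Sum>p | p permutes (UNIV::'n set). \<bar>of_int (sign p) * (\<Prod>i\<in>UNIV. A $ i $ p i)\<bar>)"
    unfolding det_def by (rule sum_abs)
  also have "\<dots> \<le> (\<Sum>p | p permutes (UNIV::'n set). c ^ CARD('n))"
  proof (rule sum_mono)
    fix p :: "'n \<Rightarrow> 'n"
    have "\<bar>of_int (sign p) * (\<Prod>i\<in>UNIV. A $ i $ p i)\<bar> = (\<Prod>i\<in>UNIV. \<bar>A $ i $ p i\<bar>)"
      by (simp add: abs_mult abs_prod sign_def)
    also have "\<dots> \<le> (\<Prod>i\<in>(UNIV::'n set). c)" using assms by (intro prod_mono) auto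
    finally show "\<bar>of_int (sign p) * (\<Prod>i\<in>UNIV. A $ i $ p i)\<bar> \<le> c ^ CARD('n)" by simp
  qed
  also have "\<dots> = fact CARD('n) * c ^ CARD('n)" by (simp add: card_permutations)
  finally show ?thesis .
qed

text \<open>
  \<open>dlev\<close> is \<open>d_h\<close> of the introduction, \<open>lev_map\<close> the map whose Jacobian matrix \<open>lev_mat\<close> it integrates.
\<close>

definition lev_mat :: "real \<Rightarrow> real \<Rightarrow> real \<Rightarrow> (real^'n) set \<Rightarrow> (real^'n \<Rightarrow> real^'n) \<Rightarrow> real^'n \<Rightarrow> real^'n \<Rightarrow> real^'n^'n" where
  "lev_mat \<alpha> E h U u y x = sig_mat (E * h powr \<alpha>) (interp h U u x - y) (interp' h U u x)"

definition lev_map :: "real \<Rightarrow> real \<Rightarrow> real \<Rightarrow> (real^'n) set \<Rightarrow> (real^'n \<Rightarrow> real^'n) \<Rightarrow> real^'n \<Rightarrow> real^'n \<Rightarrow> real^'n" where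
  "lev_map \<alpha> E h U u y x = (\<chi> i. sig ((interp h U u x - y) $ i / (E * h powr \<alpha>)))"

definition dlev :: "real \<Rightarrow> real \<Rightarrow> real \<Rightarrow> (real^'n) set \<Rightarrow> (real^'n \<Rightarrow> real^'n) \<Rightarrow> real^'n \<Rightarrow> real" where
  "dlev \<alpha> E h U u y = (LINT x:{x. eta h U x = 1}|lborel. det (lev_mat \<alpha> E h U u y x))"

lemma has_derivative_lev_map:
  "E > 0 \<Longrightarrow> h > 0 \<Longrightarrow> (lev_map \<alpha> E h U u y has_derivative (*v) (lev_mat \<alpha> E h U u y x)) (at x)"
  unfolding lev_map_def[abs_def] lev_mat_def
  by (rule has_derivative_sig_vec[OF has_derivative_interp]) simp

lemma lev_mat_cont: "continuous_on S (lev_mat \<alpha> E h U u y)"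
  unfolding lev_mat_def[abs_def] by (intro continuous_intros interp_cont interp'_cont)

text \<open>Let \<epsilon> be \<open>E * h powr \<alpha>\<close>. The factor 2/\<epsilon> from
  \<open>sig'\<close> cancels the \<epsilon> in the gradient of the interpolation and leaves a bound
  in \<open>1 / h\<close> alone. The threshold of twice \<epsilon> is the interpolation error plus
  the width of the sigmoid.\<close>

lemma lev_bounds:
  fixes x :: "real^'n"
  assumes E: "E > 0" and h: "h > 0" and U: "bounded U" and x: "cub x h \<subseteq> U" and osc: "holder_cub \<alpha> E U u"
  shows "\<bar>lev_mat \<alpha> E h U u y x $ i $ j\<bar> \<le> 2 ^ (CARD('n) + 2) / h"
    and "u x $ i - y $ i < - 2 * (E * h powr \<alpha>) \<Longrightarrow> lev_mat \<alpha> E h U u y x $ i = 0 \<and> lev_map \<alpha> E h U u y x $ i = 0"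
    and "u x $ i - y $ i > 2 * (E * h powr \<alpha>) \<Longrightarrow> lev_mat \<alpha> E h U u y x $ i = 0 \<and> lev_map \<alpha> E h U u y x $ i = 1"
proof -
  let ?e = "E * h powr \<alpha>"
  have e: "?e > 0" using E h by simp
  note b = interp_bounds[OF h U x osc]
  have "\<bar>lev_mat \<alpha> E h U u y x $ i $ j\<bar> = \<bar>sig' ((interp h U u x - y) $ i / ?e)\<bar> / ?e * \<bar>interp' h U u x $ i $ j\<bar>"
    using e E by (simp add: lev_mat_def sig_mat_def abs_mult)
  also have "\<dots> \<le> 2 / ?e * (2 ^ CARD('n) * (2 / h) * ?e)"
    using b(2)[of i j] e sig'_bounds[of "(interp h U u x - y) $ i / ?e"] h
    by (intro mult_mono divide_right_mono) auto
  also have "\<dots> = 2 ^ (CARD('n) + 2) / h" using e E by (simp add: power_add)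
  finally show "\<bar>lev_mat \<alpha> E h U u y x $ i $ j\<bar> \<le> 2 ^ (CARD('n) + 2) / h" .
  {
    assume "u x $ i - y $ i < - 2 * ?e"
    then have "(interp h U u x - y) $ i \<le> 0" using b(1)[of i] e by (simp add: abs_le_iff)
    then have q: "(interp h U u x - y) $ i / ?e \<le> 0" using e by (simp add: divide_le_0_iff)
    show "lev_mat \<alpha> E h U u y x $ i = 0 \<and> lev_map \<alpha> E h U u y x $ i = 0"
      unfolding lev_mat_def lev_map_def sig_mat_def vec_lambda_beta sig'_out[OF disjI1[OF q]] sig_le0[OF q] by simp
  next
    assume "u x $ i - y $ i > 2 * ?e"
    then have "(interp h U u x - y) $ i \<ge> ?e" using b(1)[of i] e by (simp add: abs_le_iff)
    then have q: "(interp h U u x - y) $ i / ?e \<ge> 1" using e by simp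
    show "lev_mat \<alpha> E h U u y x $ i = 0 \<and> lev_map \<alpha> E h U u y x $ i = 1"
      unfolding lev_mat_def lev_map_def sig_mat_def vec_lambda_beta sig'_out[OF disjI2[OF q]] sig_ge1[OF q] by simp
  }
qed

lemma eta_one_compact:
  assumes "h > 0" "bounded U"
  shows "compact {x. eta h U x = 1}"
proof -
  have "closed {x. eta h U x = 1}"
    by (intro closed_Collect_eq eta_cont continuous_on_const)
  moreover have "{x. eta h U x = 1} \<subseteq> U" using eta_support_subset[OF assms(1), of U] by auto
  then have "bounded {x. eta h U x = 1}" using assms(2) bounded_subset by blast
  ultimately show ?thesis by (simp add: compact_eq_bounded_closed)
qed

lemma dlev_integrable:
  assumes "h > 0" "bounded U"
  shows "integrable lborel (\<lambda>x. indicator {x. eta h U x = 1} x * det (lev_mat \<alpha> E k U u y x))"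
  using borel_integrable_compact[OF eta_one_compact[OF assms], of "\<lambda>x. det (lev_mat \<alpha> E k U u y x)"]
  by (simp add: continuous_on_det lev_mat_cont)

text \<open>The 3 counts the determinants in the integrand of \<open>dlev_step_pointwise\<close>,
  whose entries are at most \<open>2 ^ (CARD('n) + 5) / h\<close> in absolute value.\<close>

definition lev_const :: "'n::finite itself \<Rightarrow> real" where
  "lev_const _ = 3 * (fact CARD('n) * (2 ^ (CARD('n) + 5)) ^ CARD('n))"

text \<open>
  With \<open>f\<close> and \<open>f'\<close> the maps of scales \<open>h\<close> and \<open>h/2\<close>, the integrals of \<open>det Df\<close> and
  \<open>det D(f + w)\<close> agree for \<open>w = \<eta> (f' - f)\<close>. Where the cutoff \<open>\<eta>\<close> is 1, \<open>f + w\<close> equals \<open>f'\<close>, so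
  only the strip where it is not contributes to the difference.
\<close>

lemma dlev_step_pointwise:
  fixes U :: "(real^'n) set" and u :: "real^'n \<Rightarrow> real^'n"
  assumes \<alpha>: "\<alpha> > 0" and E: "E > 0" and h: "h > 0" and U: "open U" "bounded U" and osc: "holder_cub \<alpha> E U u"
  shows "\<exists>g. integrable lborel g \<and> dlev \<alpha> E (h / 2) U u y - dlev \<alpha> E h U u y = (LINT x|lborel. g x) \<and>
     (\<forall>x. \<bar>g x\<bar> \<le> lev_const TYPE('n) / h ^ CARD('n) \<and>
       (g x \<noteq> 0 \<longrightarrow> cub x h \<subseteq> U \<and> \<not> cub x (4 * h) \<subseteq> U \<and> u x \<in> cub y (2 * (E * h powr \<alpha>))))"
proof -
  define F where "F = lev_mat \<alpha> E h U u y"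
  define F' where "F' = lev_mat \<alpha> E (h / 2) U u y"
  define f where "f = lev_map \<alpha> E h U u y"
  define f' where "f' = lev_map \<alpha> E (h / 2) U u y"
  define B where "B x = eta h U x *\<^sub>R (F' x - F x) + (\<chi> i j. eta' h U x $ j * (f' x - f x) $ i)" for x
  define w where "w x = eta h U x *\<^sub>R (f' x - f x)" for x
  have h2: "h / 2 > 0" using h by simp
  have derf: "(f has_derivative (*v) (F x)) (at x)" "(f' has_derivative (*v) (F' x)) (at x)" for x
    unfolding f_def F_def f'_def F'_def using E h h2 by (intro has_derivative_lev_map; simp)+
  have contf: "continuous_on S f" "continuous_on S f'" for S
    by (rule has_derivative_continuous_on[OF has_derivative_at_withinI[OF derf(1)]]
         has_derivative_continuous_on[OF has_derivative_at_withinI[OF derf(2)]])+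
  have contF: "continuous_on S F" "continuous_on S F'" for S
    unfolding F_def F'_def by (rule lev_mat_cont)+
  have derw: "(w has_derivative (*v) (B x)) (at x)" for x
    unfolding w_def[abs_def] B_def by (intro has_derivative_scaleR_cart has_derivative_diff_cart derf has_derivative_eta)
  have contB: "continuous_on S B" for S
    unfolding B_def[abs_def] by (intro continuous_intros contF contf eta_cont eta'_cont)
  let ?K = "closure {x. eta h U x \<noteq> 0}"
  have K: "compact ?K" "?K \<subseteq> U" by (rule eta_support_compact[OF h U(2)])+
  have w0: "w x = 0" if "x \<notin> ?K" for x
    using that closure_subset[of "{x. eta h U x \<noteq> 0}"] by (auto simp: w_def)
  have B0: "B x = 0" if "x \<notin> ?K" for x
    by (rule derivative_outside_support[OF derw _ that w0]) simp
  have pert: "(LINT x:U|lborel. det (F x + B x) - det (F x)) = 0"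
    by (rule integral_det_perturbation[OF U derf(1) contF(1) derw contB K w0])
  let ?S = "{x. eta h U x = 1}" and ?S' = "{x. eta (h / 2) U x = 1}"
  \<comment> \<open>The difference of the two \<open>dlev\<close> integrands minus a term of
    integral 0, arranged to cancel where \<open>eta h U\<close> is 1.\<close>
  define g where "g x = indicator ?S' x * det (F' x) - indicator ?S x * det (F x) - (det (F x + B x) - det (F x))" for x
  have i1: "integrable lborel (\<lambda>x. indicator ?S' x * det (F' x))" unfolding F'_def by (rule dlev_integrable[OF h2 U(2)])
  have i2: "integrable lborel (\<lambda>x. indicator ?S x * det (F x))" unfolding F_def by (rule dlev_integrable[OF h U(2)])
  have i3: "integrable lborel (\<lambda>x. det (F x + B x) - det (F x))"
    by (rule integrable_compact_support[OF _ K(1)]) (auto intro!: continuous_intros contF contB simp: B0)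
  have intg: "integrable lborel g" unfolding g_def[abs_def] by (intro Bochner_Integration.integrable_diff i1 i2 i3)
  have "(LINT x:U|lborel. det (F x + B x) - det (F x)) = (LINT x|lborel. det (F x + B x) - det (F x))"
    unfolding set_lebesgue_integral_def
  proof (rule Bochner_Integration.integral_cong[OF refl])
    fix x
    have "x \<notin> U \<Longrightarrow> B x = 0" using B0[of x] K(2) by blast
    then show "indicator U x *\<^sub>R (det (F x + B x) - det (F x)) = det (F x + B x) - det (F x)"
      by (cases "x \<in> U") auto
  qed
  with pert have z: "(LINT x|lborel. det (F x + B x) - det (F x)) = 0" by simp
  have "(LINT x|lborel. g x) = dlev \<alpha> E (h / 2) U u y - dlev \<alpha> E h U u y"
    unfolding g_def dlev_def set_lebesgue_integral_def
    using z i1 i2 i3 by (simp add: Bochner_Integration.integral_diff F_def F'_def)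
  moreover have "\<bar>g x\<bar> \<le> lev_const TYPE('n) / h ^ CARD('n) \<and>
       (g x \<noteq> 0 \<longrightarrow> cub x h \<subseteq> U \<and> \<not> cub x (4 * h) \<subseteq> U \<and> u x \<in> cub y (2 * (E * h powr \<alpha>)))" for x
  proof (cases "g x = 0")
    case True
    then show ?thesis using h by (simp add: lev_const_def)
  next
    case False
    have ne1: "eta h U x \<noteq> 1"
    proof
      assume 1: "eta h U x = 1"
      then have "cub x (2 * h) \<subseteq> U" using eta_nonzero_imp[OF h, of U x] by simp
      \<comment> \<open>\<open>cub x (2 * h)\<close> is \<open>cub x (4 * (h / 2))\<close>, as the
        cutoff of the finer scale requires.\<close>
      then have 2: "eta (h / 2) U x = 1" by (intro eta_eq_1[OF h2 U(2)]) simp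
      have "eta' h U x = 0" using eta'_zero[OF h U(2)] 1 by blast
      then have "B x = F' x - F x" by (simp add: B_def 1 vec_eq_iff)
      then have "g x = 0" by (simp add: g_def 1 2)
      with False show False by simp
    qed
    have not4: "\<not> cub x (4 * h) \<subseteq> U" using eta_eq_1[OF h U(2)] ne1 by blast
    have cubh: "cub x h \<subseteq> U"
    proof (cases "eta h U x = 0")
      case True
      have "eta' h U x = 0" using eta'_zero[OF h U(2)] True by blast
      then have "B x = 0" by (simp add: B_def True vec_eq_iff)
      then have "eta (h / 2) U x \<noteq> 0" using False True by (auto simp: g_def)
      from eta_nonzero_imp[OF h2 this] show ?thesis by simp
    next
      case nz: False
      from eta_nonzero_imp[OF h nz] cub_mono[of h "2 * h" x] h show ?thesis by auto
    qed
    have cubh2: "cub x (h / 2) \<subseteq> U" using cubh cub_mono[of "h / 2" h x] h by auto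
    let ?e = "E * h powr \<alpha>" and ?e' = "E * (h / 2) powr \<alpha>"
    have e: "?e > 0" "?e' > 0" using E h by auto
    have ee: "?e' \<le> ?e" using E h \<alpha> by (intro mult_left_mono powr_mono2) auto
    note lb = lev_bounds[where y=y, OF E h U(2) cubh osc, folded F_def f_def]
    note lb' = lev_bounds[where y=y, OF E h2 U(2) cubh2 osc, folded F'_def f'_def]
    \<comment> \<open>Otherwise both sigmoids are saturated in coordinate \<open>i\<close>: row
      \<open>i\<close> of \<open>F\<close>, of \<open>F'\<close> and of \<open>F + B\<close> is
      zero, and all three determinants vanish.\<close>
    have "\<bar>u x $ i - y $ i\<bar> \<le> 2 * ?e" for i
    proof (rule ccontr)
      assume "\<not> ?thesis"
      then consider "u x $ i - y $ i < - 2 * ?e" | "u x $ i - y $ i > 2 * ?e" by linarith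
      then have rows: "F x $ i = 0 \<and> F' x $ i = 0 \<and> f x $ i = f' x $ i"
      proof cases
        case 1
        with lb(2)[of i] lb'(2)[of i] ee show ?thesis by simp
      next
        case 2
        with lb(3)[of i] lb'(3)[of i] ee show ?thesis by simp
      qed
      then have "(F x + B x) $ i = 0" by (simp add: B_def vec_eq_iff)
      have z: "det A = 0" if "A $ i = 0" for A :: "real^'n^'n"
        using that by (intro det_zero_row(1)[of i]) (simp add: row_def vec_eq_iff)
      have "g x = 0" unfolding g_def using rows z \<open>(F x + B x) $ i = 0\<close> by simp
      with False show False by simp
    qed
    then have ux: "u x \<in> cub y (2 * ?e)" by (simp add: cub_def)
    let ?c = "2 ^ (CARD('n) + 5) / h"
    let ?p = "2 ^ CARD('n) / h"
    have p0: "?p > 0" using h by simp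
    have a1: "\<bar>F x $ i $ j\<bar> \<le> 4 * ?p" for i j using lb(1)[of i j] by (simp add: power_add)
    have a2: "\<bar>F' x $ i $ j\<bar> \<le> 8 * ?p" for i j using lb'(1)[of i j] by (simp add: power_add)
    have a3: "\<bar>eta' h U x $ j\<bar> \<le> 2 * ?p" for j using eta'_bound[OF h U(2), of x j] by (simp add: mult_ac)
    have a4: "\<bar>f' x $ i - f x $ i\<bar> \<le> 1" for i
      using sig_bounds unfolding f_def f'_def lev_map_def vec_lambda_beta by (smt (verit))
    \<comment> \<open>The multiples of \<open>?p\<close> add up to 4 + (8 + 4) + 2 = 18, rounded up
      to 32 = 2^5.\<close>
    have a5: "\<bar>(F x + B x) $ i $ j\<bar> \<le> ?c" for i j
    proof -
      have "\<bar>eta h U x * (F' x $ i $ j - F x $ i $ j)\<bar> \<le> 1 * \<bar>F' x $ i $ j - F x $ i $ j\<bar>"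
        unfolding abs_mult using eta_nonneg[of h U x] eta_le_1[OF h U(2), of x] by (intro mult_right_mono) auto
      moreover have "\<bar>eta' h U x $ j * (f' x $ i - f x $ i)\<bar> \<le> (2 * ?p) * 1"
        unfolding abs_mult using a3[of j] a4[of i] p0 by (intro mult_mono) auto
      moreover have "(F x + B x) $ i $ j = F x $ i $ j + (eta h U x * (F' x $ i $ j - F x $ i $ j) + eta' h U x $ j * (f' x $ i - f x $ i))"
        by (simp add: B_def)
      ultimately have "\<bar>(F x + B x) $ i $ j\<bar> \<le> 32 * ?p" using a1[of i j] a2[of i j] p0 by argo
      also have "\<dots> = ?c" by (simp add: power_add)
      finally show ?thesis .
    qed
    have "?c = 32 * ?p" by (simp add: power_add)
    then have c: "8 * ?p \<le> ?c" "4 * ?p \<le> ?c" using p0 by linarith+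
    define D where "D = fact CARD('n) * ?c ^ CARD('n)"
    have "\<bar>det (F x)\<bar> \<le> D" "\<bar>det (F' x)\<bar> \<le> D" "\<bar>det (F x + B x)\<bar> \<le> D"
      unfolding D_def by (rule det_bound; use a1 a2 a5 c in \<open>meson order_trans\<close>)+
    then have "\<bar>g x\<bar> \<le> 3 * D" using ne1 unfolding g_def by (auto simp: indicator_def)
    also have "\<dots> = lev_const TYPE('n) / h ^ CARD('n)" by (simp add: lev_const_def D_def power_divide)
    finally show ?thesis using ux cubh not4 by blast
  qed
  ultimately show ?thesis using intg by (intro exI[of _ g]) simp
qed

text \<open>Once \<open>E * h powr \<alpha> < \<delta>\<close> and the preimage of
  \<open>cub y (2 * \<delta>)\<close> lies where \<open>eta\<close> is 1, \<open>dlev\<close> is a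
  kernel integral of the interpolation, which \<open>integral_kap_const\<close> exchanges for a
  smooth approximation.\<close>

lemma dlev_limit:
  fixes U :: "(real^'n) set" and u :: "real^'n \<Rightarrow> real^'n"
  assumes \<alpha>: "\<alpha> > 0" and E: "E > 0" and U: "open U" "bounded U" and osc: "holder_cub \<alpha> E U u"
    and u: "continuous_on (closure U) u" and y: "y \<notin> u ` frontier U"
  shows "\<exists>h0>0. \<forall>h. 0 < h \<longrightarrow> h < h0 \<longrightarrow> dlev \<alpha> E h U u y = brouwer_degree u U y"
proof -
  obtain \<delta> where \<delta>: "\<delta> > 0" "\<forall>x\<in>frontier U. \<exists>i. 2 * \<delta> < \<bar>u x $ i - y $ i\<bar>"
    using uniformly_far_point[OF compact_image_frontier[OF U(2) u] y] by blast
  let ?K = "{x\<in>closure U. u x \<in> cub y (2 * \<delta>)}"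
  note K = compact_preimage_cub[OF U(2,1) u \<delta>(2)]
  obtain h1 where h1: "h1 > 0" "\<forall>x\<in>?K. cub x h1 \<subseteq> U" using cub_in_open[OF U(1) K] by blast
  obtain v where v: "v \<in> smooth_closure U" "\<And>x. x \<in> closure U \<Longrightarrow> norm (v x - u x) < \<delta>"
    using smooth_approximation[OF U(2) u \<delta>(1)] by blast
  have vu: "\<bar>v x $ i - u x $ i\<bar> < \<delta>" if "x \<in> closure U" for x i
    using component_le_norm_cart[of "v x - u x" i] v(2)[OF that] by simp
  obtain W where W: "open W" "closure U \<subseteq> W" "\<And>x. x \<in> W \<Longrightarrow> (v has_derivative (*v) (jac v x)) (at x)"
    "continuous_on W (jac v)" "continuous_on W v"
    using smooth_closureD[OF v(1)] by metis
  \<comment> \<open>\<open>h1 / 4\<close> puts \<open>?K\<close> where \<open>eta\<close> is 1; the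
    power gives \<open>E * h powr \<alpha> \<le> \<delta> / 2\<close>.\<close>
  define h0 where "h0 = min (h1 / 4) ((\<delta> / (2 * E)) powr (1 / \<alpha>))"
  have "dlev \<alpha> E h U u y = brouwer_degree u U y" if h: "0 < h" "h < h0" for h
  proof -
    let ?e = "E * h powr \<alpha>"
    have "h powr \<alpha> \<le> ((\<delta> / (2 * E)) powr (1 / \<alpha>)) powr \<alpha>"
      using h \<alpha> by (intro powr_mono2) (auto simp: h0_def)
    also have "\<dots> = \<delta> / (2 * E)" using \<alpha> \<delta>(1) E by (simp add: powr_powr)
    finally have e: "?e < \<delta>" "?e > 0" using E \<delta>(1) h by (auto simp: field_simps)
    \<comment> \<open>The interpolation is close to \<open>u\<close> only away from the frontier, so
      it is compared with \<open>v\<close> on \<open>?V\<close>, and the domain is enlarged to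
      \<open>U\<close> afterwards.\<close>
    let ?V = "{x. eta h U x \<noteq> 0}"
    have V: "open ?V" by (intro open_Collect_neq eta_cont continuous_on_const)
    have VU: "?V \<subseteq> U" by (rule eta_support_subset[OF h(1)])
    have K1: "eta h U x = 1" if "x \<in> ?K" for x
    proof (rule eta_eq_1[OF h(1) U(2)])
      have "cub x (4 * h) \<subseteq> cub x h1" using h by (intro cub_mono) (simp add: h0_def)
      with h1(2) that show "cub x (4 * h) \<subseteq> U" by blast
    qed
    have KV: "?K \<subseteq> ?V" using K1 by auto
    have VW: "?V \<subseteq> W" using VU closure_subset W(2) by blast
    have Vcl: "?V \<subseteq> closure U" using VU closure_subset by blast
    have near: "\<bar>interp h U u x $ i - u x $ i\<bar> \<le> ?e" if "x \<in> ?V" for x i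
    proof (rule interp_bounds(1)[OF h(1) U(2) _ osc])
      have "cub x h \<subseteq> cub x (2 * h)" using h by (intro cub_mono) simp
      with eta_nonzero_imp[OF h(1), of U x] that show "cub x h \<subseteq> U" by auto
    qed
    have k0: "kap ?e (interp h U u x - y) = 0" if x: "x \<in> ?V - ?K" for x
    proof (rule ccontr)
      assume nz: "kap ?e (interp h U u x - y) \<noteq> 0"
      from x Vcl obtain i where i: "\<bar>u x $ i - y $ i\<bar> > 2 * \<delta>" by (auto simp: cub_def not_le)
      have "0 < interp h U u x $ i - y $ i" "interp h U u x $ i - y $ i < ?e"
        using kap_nonzero[OF e(2) nz, of i] by simp_all
      with near[of x i] x i e show False by auto
    qed
    have "dlev \<alpha> E h U u y = (LINT x:?V|lborel. kap ?e (interp h U u x - y) * det (interp' h U u x))"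
      unfolding dlev_def lev_mat_def det_sig_mat set_lebesgue_integral_def
    proof (rule Bochner_Integration.integral_cong[OF refl])
      fix x
      show "indicator {x. eta h U x = 1} x *\<^sub>R (kap ?e (interp h U u x - y) * det (interp' h U u x)) =
        indicator ?V x *\<^sub>R (kap ?e (interp h U u x - y) * det (interp' h U u x))"
        using k0[of x] K1[of x] by (cases "x \<in> ?K") (auto simp: indicator_def)
    qed
    also have "\<dots> = (LINT x:?V|lborel. kap \<delta> (v x - y) * det (jac v x))"
    proof (rule integral_kap_const[OF U u \<delta>(2) V VU KV e(2) \<delta>(1) has_derivative_interp interp'_cont])
      show "(v has_derivative (*v) (jac v x)) (at x)" if "x \<in> ?V" for x using W(3) VW that by blast
      show "continuous_on ?V (jac v)" by (rule continuous_on_subset[OF W(4) VW])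
      show "\<bar>interp h U u x $ i - u x $ i\<bar> < \<delta>" if "x \<in> ?V" for x i using near[OF that, of i] e by linarith
      show "\<bar>v x $ i - u x $ i\<bar> < \<delta>" if "x \<in> ?V" for x i using vu that Vcl by blast
    qed (use e \<delta>(1) in auto)
    also have "\<dots> = (LINT x:U|lborel. kap \<delta> (v x - y) * det (jac v x))"
      unfolding set_lebesgue_integral_def
    proof (rule Bochner_Integration.integral_cong[OF refl])
      fix x
      have "kap \<delta> (v x - y) = 0" if x: "x \<in> U" "x \<notin> ?V"
      proof (rule ccontr)
        assume nz: "kap \<delta> (v x - y) \<noteq> 0"
        have xc: "x \<in> closure U" using x(1) closure_subset by blast
        with x KV have "x \<notin> ?K" by blast
        with xc obtain i where i: "\<bar>u x $ i - y $ i\<bar> > 2 * \<delta>" by (auto simp: cub_def not_le)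
        have "0 < v x $ i - y $ i" "v x $ i - y $ i < \<delta>"
          using kap_nonzero[OF \<delta>(1) nz, of i] by simp_all
        with vu[OF xc, of i] i show False by auto
      qed
      then show "indicator ?V x *\<^sub>R (kap \<delta> (v x - y) * det (jac v x)) = indicator U x *\<^sub>R (kap \<delta> (v x - y) * det (jac v x))"
        using VU by (auto simp: indicator_def)
    qed
    also have "\<dots> = brouwer_degree u U y"
      by (rule brouwer_degree_eq[OF U u \<delta> v(1) vu, symmetric])
    finally show ?thesis .
  qed
  moreover have "h0 > 0" using h1 \<delta>(1) E by (simp add: h0_def)
  ultimately show ?thesis by blast
qed

section \<open>Box coverings and bounds in Lebesgue spaces\<close>

lemma One_cart [simp]: "(One :: real^'n) $ i = 1"
proof -
  have "(One :: real^'n) \<bullet> axis i 1 = (\<Sum>b\<in>(Basis :: (real^'n) set). if b = axis i 1 then 1 else 0)"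
    unfolding inner_sum_left by (rule sum.cong[OF refl]) (simp add: inner_Basis)
  then show ?thesis by (simp add: inner_axis)
qed

lemma mem_cbox_One:
  "x \<in> cbox a (a + r *\<^sub>R (One :: real^'n)) \<longleftrightarrow> (\<forall>i. a $ i \<le> x $ i \<and> x $ i \<le> a $ i + r)"
  unfolding mem_box_cart vector_add_component vector_scaleR_component One_cart by simp

lemma box_number_le:
  assumes "finite A" "E \<subseteq> (\<Union>a\<in>A. cbox a (a + r *\<^sub>R One))"
  shows "box_number r E \<le> card A"
  unfolding box_number_def by (rule Least_le) (use assms in blast)

lemma grid_cover:
  fixes l b :: "'n::finite \<Rightarrow> real"
  assumes r: "r > 0" and lb: "\<And>i. l i \<le> b i"
  shows "\<exists>A. finite A \<and> card A \<le> (\<Prod>i\<in>UNIV. nat \<lfloor>(b i - l i) / r\<rfloor> + 1) \<and>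
     {x. \<forall>i. l i \<le> x $ i \<and> x $ i \<le> b i} \<subseteq> (\<Union>a\<in>A. cbox a (a + r *\<^sub>R (One :: real^'n)))"
proof -
  define M where "M = PiE (UNIV :: 'n set) (\<lambda>i. {..nat \<lfloor>(b i - l i) / r\<rfloor>})"
  define c :: "('n \<Rightarrow> nat) \<Rightarrow> real^'n" where "c m = (\<chi> i. l i + r * real (m i))" for m
  have fin: "finite M" unfolding M_def by (rule finite_PiE) auto
  have "card M = (\<Prod>i\<in>UNIV. nat \<lfloor>(b i - l i) / r\<rfloor> + 1)"
    unfolding M_def by (subst card_PiE) auto
  then have "card (c ` M) \<le> (\<Prod>i\<in>UNIV. nat \<lfloor>(b i - l i) / r\<rfloor> + 1)"
    using card_image_le[OF fin, of c] by simp
  moreover have "{x. \<forall>i. l i \<le> x $ i \<and> x $ i \<le> b i} \<subseteq> (\<Union>a\<in>c ` M. cbox a (a + r *\<^sub>R One))"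
  proof
    fix x :: "real^'n" assume x: "x \<in> {x. \<forall>i. l i \<le> x $ i \<and> x $ i \<le> b i}"
    define m where "m i = nat \<lfloor>(x $ i - l i) / r\<rfloor>" for i
    have nn: "0 \<le> (x $ i - l i) / r" for i using x r by simp
    have "m \<in> M" unfolding M_def m_def using x r
      by (auto intro!: nat_mono floor_mono divide_right_mono)
    moreover have "x \<in> cbox (c m) (c m + r *\<^sub>R One)"
      unfolding mem_cbox_One
    proof
      fix i
      have "real (m i) \<le> (x $ i - l i) / r" "(x $ i - l i) / r \<le> real (m i) + 1"
        using nn[of i] unfolding m_def by linarith+
      then show "c m $ i \<le> x $ i \<and> x $ i \<le> c m $ i + r"
        using r by (simp add: c_def field_simps)
    qed
    ultimately show "x \<in> (\<Union>a\<in>c ` M. cbox a (a + r *\<^sub>R One))" by blast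
  qed
  ultimately show ?thesis using fin by (intro exI[of _ "c ` M"]) simp
qed

lemma box_number_cover:
  fixes E :: "(real^'n) set"
  assumes "bounded E" "r > 0"
  shows "\<exists>A. finite A \<and> card A = box_number r E \<and> E \<subseteq> (\<Union>a\<in>A. cbox a (a + r *\<^sub>R One))"
proof -
  obtain B where B: "\<And>x. x \<in> E \<Longrightarrow> norm x \<le> B" using assms(1) by (auto simp: bounded_iff)
  have E: "E \<subseteq> {x. \<forall>i. - \<bar>B\<bar> \<le> x $ i \<and> x $ i \<le> \<bar>B\<bar>}"
  proof clarify
    fix x i assume "x \<in> E"
    then show "- \<bar>B\<bar> \<le> x $ i \<and> x $ i \<le> \<bar>B\<bar>"
      using B[of x] component_le_norm_cart[of x i] by (auto simp: abs_le_iff)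
  qed
  obtain A where A: "finite A" "{x::real^'n. \<forall>i. - \<bar>B\<bar> \<le> x $ i \<and> x $ i \<le> \<bar>B\<bar>} \<subseteq> (\<Union>a\<in>A. cbox a (a + r *\<^sub>R One))"
    using grid_cover[OF assms(2), of "\<lambda>_. - \<bar>B\<bar>" "\<lambda>_. \<bar>B\<bar>"] by auto
  have "E \<subseteq> (\<Union>a\<in>A. cbox a (a + r *\<^sub>R One))" by (rule order_trans[OF E A(2)])
  with A(1) have "\<exists>m A. finite A \<and> card A = m \<and> E \<subseteq> (\<Union>a\<in>A. cbox a (a + r *\<^sub>R One))"
    by (intro exI[of _ "card A"] exI[of _ A] conjI refl)
  then show ?thesis unfolding box_number_def by (rule LeastI_ex[of "\<lambda>m. \<exists>A. finite A \<and> card A = m \<and> E \<subseteq> (\<Union>a\<in>A. cbox a (a + r *\<^sub>R One))"])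
qed

lemma measure_cub: "r \<ge> 0 \<Longrightarrow> measure lborel (cub p r) = (2 * r) ^ CARD('n)"
  for p :: "real^'n"
proof -
  assume r: "r \<ge> 0"
  have "cbox (\<chi> i. p $ i - r) (\<chi> i. p $ i + r) \<noteq> {}"
    using cub_self[OF r, of p] by (auto simp: cub_eq_cbox)
  then show ?thesis by (simp add: cub_eq_cbox content_cbox_cart)
qed

lemma emeasure_cub: "r \<ge> 0 \<Longrightarrow> emeasure lborel (cub p r) = ennreal ((2 * r) ^ CARD('n))"
  for p :: "real^'n"
  using emeasure_bounded_finite[OF bounded_cub, of p r]
  by (subst emeasure_eq_ennreal_measure) (simp_all add: measure_cub)

lemma cub_borel [measurable]: "cub p r \<in> sets borel"
  by (simp add: cub_eq_cbox)

text \<open>The connected set \<open>cub x (4 * h)\<close> meets \<open>U\<close> and its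
  complement, hence the frontier. The box of side \<open>h\<close> that covers the point found there
  accounts for the bounds \<open>4 * h\<close> and \<open>4 * h + h\<close>.\<close>

lemma strip_cover:
  fixes x :: "real^'n"
  assumes h: "h > 0" and x: "cub x h \<subseteq> U" "\<not> cub x (4 * h) \<subseteq> U"
    and A: "frontier U \<subseteq> (\<Union>a\<in>A. cbox a (a + h *\<^sub>R One))"
  shows "\<exists>a\<in>A. \<forall>i. a $ i - 4 * h \<le> x $ i \<and> x $ i \<le> a $ i + 5 * h"
proof -
  have "connected (cub x (4 * h))" by (simp add: cub_eq_cbox convex_connected)
  moreover have "cub x (4 * h) \<inter> U \<noteq> {}" using x(1) cub_self[of h x] cub_self[of "4 * h" x] h by auto
  moreover have "cub x (4 * h) - U \<noteq> {}" using x(2) by blast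
  ultimately have "cub x (4 * h) \<inter> frontier U \<noteq> {}" by (rule connected_Int_frontier)
  then obtain z where z: "z \<in> cub x (4 * h)" "z \<in> frontier U" by blast
  with A obtain a where a: "a \<in> A" "z \<in> cbox a (a + h *\<^sub>R One)" by blast
  have "a $ i - 4 * h \<le> x $ i \<and> x $ i \<le> a $ i + 5 * h" for i
  proof -
    have "\<bar>z $ i - x $ i\<bar> \<le> 4 * h" using z(1) by (simp add: cub_def)
    moreover have "a $ i \<le> z $ i \<and> z $ i \<le> a $ i + h" using a(2) by (simp add: mem_cbox_One)
    ultimately show ?thesis by (simp add: abs_le_iff)
  qed
  with a(1) show ?thesis by blast
qed

text \<open>The strip lies in the enlarged boxes \<open>D a\<close> of side \<open>9 * h\<close>. By
  the Hoelder condition \<open>u\<close> varies on \<open>U \<inter> D a\<close> by at most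
  \<open>9 * ?e\<close>, so \<open>D a\<close> contributes at \<open>y\<close> only if
  \<open>y\<close> is within \<open>11 * ?e\<close> of the value at a sample point. Its volume
  cancels the \<open>1 / h ^ CARD('n)\<close> of the integrand.\<close>

lemma dlev_step:
  fixes U :: "(real^'n) set" and u :: "real^'n \<Rightarrow> real^'n"
  assumes \<alpha>: "\<alpha> > 0" "\<alpha> \<le> 1" and E: "E > 0" and h: "h > 0" and U: "open U" "bounded U" and osc: "holder_cub \<alpha> E U u"
    and A: "finite A" "frontier U \<subseteq> (\<Union>a\<in>A. cbox a (a + h *\<^sub>R One))"
  shows "\<exists>p. \<forall>y. \<bar>dlev \<alpha> E (h / 2) U u y - dlev \<alpha> E h U u y\<bar> \<le>
     lev_const TYPE('n) * 9 ^ CARD('n) * (\<Sum>a\<in>A. indicator (cub (p a) (11 * (E * h powr \<alpha>))) y)"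
proof -
  let ?e = "E * h powr \<alpha>"
  define D where "D a = cbox (\<chi> i. a $ i - 4 * h) (\<chi> i. a $ i + 5 * h)" for a :: "real^'n"
  \<comment> \<open>An arbitrary point if \<open>D a\<close> misses \<open>U\<close>; such a box
    contains no point with \<open>g x \<noteq> 0\<close>.\<close>
  define q where "q a = (SOME x. x \<in> U \<inter> D a)" for a
  have mD: "measure lborel (D a) = (9 * h) ^ CARD('n)" for a
  proof -
    have "a \<in> D a" using h by (simp add: D_def mem_box_cart)
    then have "D a \<noteq> {}" by blast
    then show ?thesis by (simp add: D_def content_cbox_cart)
  qed
  have Dint: "integrable lborel (\<lambda>x. indicator (D a) x :: real)" for a
    unfolding D_def using emeasure_bounded_finite[OF bounded_cbox]
    by (intro integrable_real_indicator) auto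
  have "\<bar>dlev \<alpha> E (h / 2) U u y - dlev \<alpha> E h U u y\<bar> \<le>
     lev_const TYPE('n) * 9 ^ CARD('n) * (\<Sum>a\<in>A. indicator (cub (u (q a)) (11 * ?e)) y)" for y
  proof -
    obtain g where g: "integrable lborel g" "dlev \<alpha> E (h / 2) U u y - dlev \<alpha> E h U u y = (LINT x|lborel. g x)"
      "\<And>x. \<bar>g x\<bar> \<le> lev_const TYPE('n) / h ^ CARD('n)"
      "\<And>x. g x \<noteq> 0 \<Longrightarrow> cub x h \<subseteq> U \<and> \<not> cub x (4 * h) \<subseteq> U \<and> u x \<in> cub y (2 * ?e)"
      using dlev_step_pointwise[OF \<alpha>(1) E h U osc, of y] by blast
    let ?c = "lev_const TYPE('n) / h ^ CARD('n)"
    let ?I = "\<lambda>a. indicator (cub (u (q a)) (11 * ?e)) y :: real"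
    have c0: "?c \<ge> 0" using h by (simp add: lev_const_def)
    have bound: "\<bar>g x\<bar> \<le> (\<Sum>a\<in>A. ?c * ?I a * indicator (D a) x)" for x
    proof (cases "g x = 0")
      case True
      then show ?thesis unfolding True abs_zero using c0 by (intro sum_nonneg mult_nonneg_nonneg) auto
    next
      case False
      note g4 = g(4)[OF False]
      obtain a where a: "a \<in> A" "\<forall>i. a $ i - 4 * h \<le> x $ i \<and> x $ i \<le> a $ i + 5 * h"
        using strip_cover[OF h _ _ A(2)] g4 by blast
      have xD: "x \<in> D a" using a(2) by (simp add: D_def mem_box_cart)
      have xU: "x \<in> U" using g4 cub_self[of h x] h by auto
      have qa: "q a \<in> U \<inter> D a" unfolding q_def by (rule someI[of _ x]) (use xD xU in blast)
      have "\<bar>x $ i - q a $ i\<bar> \<le> 9 * h" for i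
      proof -
        have "a $ i - 4 * h \<le> x $ i" "x $ i \<le> a $ i + 5 * h" using a(2) by auto
        moreover have "a $ i - 4 * h \<le> q a $ i" "q a $ i \<le> a $ i + 5 * h"
          using qa by (auto simp: D_def mem_box_cart)
        ultimately show ?thesis by (simp add: abs_le_iff)
      qed
      then have "x \<in> cub (q a) (9 * h)" by (simp add: cub_def)
      then have "u x \<in> cub (u (q a)) (E * (9 * h) powr \<alpha>)"
        using osc qa xU h unfolding holder_cub_def by simp
      moreover have "E * (9 * h) powr \<alpha> \<le> 9 * ?e"
      proof -
        have "(9::real) powr \<alpha> \<le> 9 powr 1" using \<alpha> by (intro powr_mono) auto
        then have "(9 * h) powr \<alpha> \<le> 9 * h powr \<alpha>" using h by (simp add: powr_mult mult_right_mono)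
        then show ?thesis using E by simp
      qed
      ultimately have 1: "u x \<in> cub (u (q a)) (9 * ?e)" using cub_mono by blast
      have "y \<in> cub (u x) (2 * ?e)" using g4 cub_sym by blast
      with cub_trans[OF 1, of "2 * ?e"] have "y \<in> cub (u (q a)) (9 * ?e + 2 * ?e)" by blast
      then have "y \<in> cub (u (q a)) (11 * ?e)" by (simp add: algebra_simps)
      then have "\<bar>g x\<bar> \<le> ?c * ?I a * indicator (D a) x" using g(3)[of x] xD by simp
      also have "\<dots> \<le> (\<Sum>a\<in>A. ?c * ?I a * indicator (D a) x)"
        by (intro member_le_sum a(1) A(1) mult_nonneg_nonneg c0 indicator_pos_le)
      finally show ?thesis .
    qed
    have "\<bar>LINT x|lborel. g x\<bar> \<le> (LINT x|lborel. \<bar>g x\<bar>)" by (rule integral_abs_bound)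
    also have "\<dots> \<le> (LINT x|lborel. (\<Sum>a\<in>A. ?c * ?I a * indicator (D a) x))"
      by (intro integral_mono integrable_abs g(1) Bochner_Integration.integrable_sum integrable_mult_right Dint bound)
    also have "\<dots> = (\<Sum>a\<in>A. ?c * ?I a * (9 * h) ^ CARD('n))"
      by (subst Bochner_Integration.integral_sum) (auto intro!: integrable_mult_right Dint simp: mD)
    also have "\<dots> = lev_const TYPE('n) * 9 ^ CARD('n) * (\<Sum>a\<in>A. ?I a)"
      using h by (simp add: sum_distrib_left power_mult_distrib mult_ac)
    finally show ?thesis using g(2) by simp
  qed
  then show ?thesis by (intro exI[of _ "\<lambda>a. u (q a)"]) blast
qed

text \<open>The first term of the telescoping sum over the scales. It vanishes for \<open>y\<close>
  away from the bounded range of \<open>u\<close>, which makes its powers integrable in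
  \<open>y\<close>.\<close>

lemma dlev_base:
  fixes U :: "(real^'n) set" and u :: "real^'n \<Rightarrow> real^'n"
  assumes E: "E > 0" and U: "open U" "bounded U" and osc: "holder_cub \<alpha> E U u"
    and S: "\<And>x. x \<in> U \<Longrightarrow> norm (u x) \<le> S"
  shows "\<bar>dlev \<alpha> E 1 U u y\<bar> \<le> lev_const TYPE('n) * measure lborel U * indicator (cub 0 (\<bar>S\<bar> + 2 * E)) y"
proof -
  let ?g = "\<lambda>x. indicator {x. eta 1 U x = 1} x * det (lev_mat \<alpha> E 1 U u y x)"
  let ?I = "indicator (cub 0 (\<bar>S\<bar> + 2 * E)) y :: real"
  have bound: "\<bar>?g x\<bar> \<le> lev_const TYPE('n) * ?I * indicator U x" for x
  proof (cases "?g x = 0")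
    case True
    then show ?thesis unfolding True by (simp add: lev_const_def)
  next
    case False
    then have e1: "eta 1 U x = 1" and dn: "det (lev_mat \<alpha> E 1 U u y x) \<noteq> 0" by (auto simp: indicator_def split: if_splits)
    then have "cub x 2 \<subseteq> U" using eta_nonzero_imp[of 1 U x] by simp
    then have x: "cub x 1 \<subseteq> U" using cub_mono[of 1 2 x] by auto
    then have xU: "x \<in> U" using cub_self[of 1 x] by auto
    note lb = lev_bounds[where y=y, OF E zero_less_one U(2) x osc, simplified]
    have "\<bar>y $ i\<bar> \<le> \<bar>S\<bar> + 2 * E" for i
    proof -
      have "\<bar>u x $ i - y $ i\<bar> \<le> 2 * E"
      proof (rule ccontr)
        assume "\<not> ?thesis"
        then have "u x $ i - y $ i < - (2 * E) \<or> u x $ i - y $ i > 2 * E" by linarith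
        then have "lev_mat \<alpha> E 1 U u y x $ i = 0" using lb(2)[of i] lb(3)[of i] by blast
        then have "det (lev_mat \<alpha> E 1 U u y x) = 0"
          by (intro det_zero_row(1)[of i]) (simp add: row_def vec_eq_iff)
        with dn show False by simp
      qed
      moreover have "\<bar>u x $ i\<bar> \<le> S" using S[OF xU] component_le_norm_cart[of "u x" i] by linarith
      ultimately show ?thesis by linarith
    qed
    then have I: "?I = 1" by (simp add: cub_def)
    have "\<bar>det (lev_mat \<alpha> E 1 U u y x)\<bar> \<le> fact CARD('n) * (2 ^ (CARD('n) + 2)) ^ CARD('n)"
      by (rule det_bound) (use lb(1) in simp)
    also have "\<dots> \<le> lev_const TYPE('n)"
    proof -
      have "((2::real) ^ (CARD('n) + 2)) ^ CARD('n) \<le> (2 ^ (CARD('n) + 5)) ^ CARD('n)"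
        by (intro power_mono power_increasing) auto
      then have "fact CARD('n) * ((2::real) ^ (CARD('n) + 2)) ^ CARD('n) \<le> 1 * (fact CARD('n) * (2 ^ (CARD('n) + 5)) ^ CARD('n))"
        by (simp add: mult_left_mono)
      also have "\<dots> \<le> 3 * (fact CARD('n) * (2 ^ (CARD('n) + 5)) ^ CARD('n))" by (intro mult_right_mono) auto
      finally show ?thesis by (simp add: lev_const_def)
    qed
    finally show ?thesis using I xU e1 by simp
  qed
  have Ub: "emeasure lborel U < \<infinity>" by (rule emeasure_bounded_finite[OF U(2)])
  have intg: "integrable lborel ?g" by (rule dlev_integrable[OF zero_less_one U(2)])
  have "\<bar>dlev \<alpha> E 1 U u y\<bar> \<le> (LINT x|lborel. \<bar>?g x\<bar>)"
    unfolding dlev_def set_lebesgue_integral_def real_scaleR_def by (rule integral_abs_bound)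
  also have "\<dots> \<le> (LINT x|lborel. lev_const TYPE('n) * ?I * indicator U x)"
    using Ub U(1) by (intro integral_mono integrable_abs intg integrable_mult_right integrable_real_indicator bound)
       (auto simp: borel_open)
  also have "\<dots> = lev_const TYPE('n) * measure lborel U * ?I" by simp
  finally show ?thesis .
qed

text \<open>
  Weights with sum at most 1 replace the triangle inequality in \<open>L\<^sup>q\<close>, which is not available.
\<close>

lemma sum_weights_dominated:
  fixes a w :: "nat \<Rightarrow> real"
  assumes D: "0 \<le> D" "D \<le> (\<Sum>k<K. a k)" and w: "\<And>k. 0 < w k" "(\<Sum>k<K. w k) \<le> 1" and K: "K > 0"
  shows "\<exists>k<K. w k * D \<le> a k"
proof (rule ccontr)
  assume "\<not> ?thesis"
  then have "(\<Sum>k<K. a k) < (\<Sum>k<K. w k * D)" using K by (intro sum_strict_mono) auto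
  also have "\<dots> \<le> 1 * D" unfolding sum_distrib_right[symmetric] using w D by (intro mult_right_mono) auto
  finally show False using D by simp
qed

text \<open>Meant for a counting function bounded by \<open>N\<close>: its power is reduced to its
  first power, so a sum of \<open>N\<close> indicators of cubes integrates to at most
  \<open>N powr q\<close> times the volume of one cube.\<close>

lemma powr_le_card_mult:
  fixes t :: real
  assumes "0 \<le> t" "t \<le> N" "1 \<le> q"
  shows "t powr q \<le> N powr (q - 1) * t"
proof (cases "t = 0")
  case False
  then have "t powr q = t powr (q - 1) * t" using assms powr_add[of t "q - 1" 1] by simp
  also have "\<dots> \<le> N powr (q - 1) * t" using assms by (intro mult_right_mono powr_mono2) auto
  finally show ?thesis .
qed simp

text \<open>Telescoping from scale 1 bounds the degree at \<open>y\<close> by a sum of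
  \<open>a k y\<close>, in which some index dominates after weighting. That index depends on
  \<open>y\<close>; summing the powers over all \<open>k\<close> removes the dependence, and the sum
  is integrated term by term.\<close>

lemma degree_Lq_bound:
  fixes U :: "(real^'n) set" and N :: "nat \<Rightarrow> real"
  assumes \<alpha>: "0 < \<alpha>" "\<alpha> \<le> 1" and U: "open U" "bounded U" and E: "E > 0" and q: "1 \<le> q"
    and w: "\<And>k. 0 < w k" "\<And>K. (\<Sum>k<K. w k) \<le> (1::real)"
    and N: "\<And>k. N k = real (box_number ((1/2) ^ k) (frontier U))"
    and summ: "summable (\<lambda>k. (1 / w (Suc k)) powr q * N k powr q * (((1/2) ^ k) powr \<alpha>) ^ CARD('n))"
  shows "\<exists>M. \<forall>u. continuous_on (closure U) u \<longrightarrow> holder_cub \<alpha> E U u \<longrightarrow> (\<forall>x\<in>U. norm (u x) \<le> S) \<longrightarrow>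
     (\<integral>\<^sup>+y. ennreal (\<bar>brouwer_degree u U y\<bar> powr q) \<partial>lborel) \<le> ennreal M"
proof -
  let ?h = "\<lambda>k::nat. (1/2::real) ^ k"
  let ?e = "\<lambda>k. 11 * (E * ?h k powr \<alpha>)"
  let ?C0 = "lev_const TYPE('n) * measure lborel U" and ?R = "\<bar>S\<bar> + 2 * E"
  let ?C1 = "lev_const TYPE('n) * 9 ^ CARD('n)"
  have L0: "lev_const TYPE('n) \<ge> 0" by (simp add: lev_const_def)
  have C0: "?C0 \<ge> 0" and C1: "?C1 \<ge> 0" using L0 by simp_all
  have e0: "?e k \<ge> 0" for k using E by simp
  have R0: "?R \<ge> 0" using E by simp
  have bF: "bounded (frontier U)" using compact_frontier_bounded[OF U(2)] compact_imp_bounded by blast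
  have "\<forall>k. \<exists>A. finite A \<and> card A = box_number (?h k) (frontier U) \<and> frontier U \<subseteq> (\<Union>a\<in>A. cbox a (a + ?h k *\<^sub>R One))"
    by (intro allI box_number_cover[OF bF]) simp
  from choice[OF this] obtain A where A0: "\<forall>k. finite (A k) \<and> card (A k) = box_number (?h k) (frontier U)
    \<and> frontier U \<subseteq> (\<Union>a\<in>A k. cbox a (a + ?h k *\<^sub>R One))" ..
  then have A: "\<And>k. finite (A k)" "\<And>k. real (card (A k)) = N k"
    "\<And>k. frontier U \<subseteq> (\<Union>a\<in>A k. cbox a (a + ?h k *\<^sub>R One))"
    unfolding N by simp_all
  \<comment> \<open>A bound for the integral of \<open>(a k y / w k) powr q\<close>: index 0 is the
    value at scale 1, index \<open>Suc j\<close> the step from scale \<open>?h j\<close> to its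
    half.\<close>
  define b where "b k = (case k of 0 \<Rightarrow> (?C0 / w 0) powr q * (2 * ?R) ^ CARD('n)
     | Suc j \<Rightarrow> ?C1 powr q * (22 * E) ^ CARD('n) *
         ((1 / w (Suc j)) powr q * N j powr q * (?h j powr \<alpha>) ^ CARD('n)))" for k
  have b0: "b k \<ge> 0" for k
    using E R0 by (auto simp: b_def split: nat.split intro!: mult_nonneg_nonneg)
  have "summable (\<lambda>k. b (Suc k))" unfolding b_def using summ by (simp add: summable_mult)
  then have sb: "summable b" by (simp only: summable_Suc_iff)
  have "(\<integral>\<^sup>+y. ennreal (\<bar>brouwer_degree u U y\<bar> powr q) \<partial>lborel) \<le> ennreal (suminf b)"
    if u: "continuous_on (closure U) u" "holder_cub \<alpha> E U u" "\<forall>x\<in>U. norm (u x) \<le> S" for u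
  proof -
    have "\<forall>k. \<exists>p. \<forall>y. \<bar>dlev \<alpha> E (?h k / 2) U u y - dlev \<alpha> E (?h k) U u y\<bar> \<le>
       ?C1 * (\<Sum>a\<in>A k. indicator (cub (p a) (?e k)) y)"
      by (intro allI dlev_step[OF \<alpha> E _ U u(2) A(1) A(3)]) simp
    from choice[OF this] obtain p where "\<forall>k. \<forall>y. \<bar>dlev \<alpha> E (?h k / 2) U u y - dlev \<alpha> E (?h k) U u y\<bar> \<le>
       ?C1 * (\<Sum>a\<in>A k. indicator (cub (p k a) (?e k)) y)" ..
    then have p: "\<And>k y. \<bar>dlev \<alpha> E (?h k / 2) U u y - dlev \<alpha> E (?h k) U u y\<bar> \<le>
       ?C1 * (\<Sum>a\<in>A k. indicator (cub (p k a) (?e k)) y)" by blast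
    define a where "a k y = (case k of 0 \<Rightarrow> ?C0 * indicator (cub 0 ?R) y
       | Suc j \<Rightarrow> ?C1 * (\<Sum>c\<in>A j. indicator (cub (p j c) (?e j)) y))" for k y
    have a0: "a k y \<ge> 0" for k y
      using C0 C1 by (auto simp: a_def split: nat.split intro!: mult_nonneg_nonneg sum_nonneg)
    have am: "a k \<in> borel_measurable borel" for k
      unfolding a_def by (cases k) (auto intro!: borel_measurable_times borel_measurable_sum)
    have dl: "\<bar>dlev \<alpha> E (?h K) U u y\<bar> \<le> (\<Sum>k<Suc K. a k y)" for K y
    proof (induction K)
      case 0
      show ?case using dlev_base[OF E U u(2), of S y] u(3) by (simp add: a_def)
    next
      case (Suc K)
      have "\<bar>dlev \<alpha> E (?h (Suc K)) U u y\<bar> \<le> \<bar>dlev \<alpha> E (?h K) U u y\<bar> + \<bar>dlev \<alpha> E (?h K / 2) U u y - dlev \<alpha> E (?h K) U u y\<bar>"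
        by simp
      also have "\<dots> \<le> (\<Sum>k<Suc K. a k y) + a (Suc K) y" using Suc p[of K y] by (simp add: a_def)
      finally show ?case by simp
    qed
    have pw: "ennreal (\<bar>brouwer_degree u U y\<bar> powr q) \<le> (\<Sum>k. ennreal ((a k y / w k) powr q))" for y
    proof (cases "y \<in> u ` frontier U")
      case True
      then show ?thesis by (simp add: brouwer_degree_def)
    next
      case False
      obtain h0 where h0: "h0 > 0" "\<And>h. 0 < h \<Longrightarrow> h < h0 \<Longrightarrow> dlev \<alpha> E h U u y = brouwer_degree u U y"
        using dlev_limit[OF \<alpha>(1) E U u(2,1) False] by blast
      obtain K where K: "?h K < h0" using real_arch_pow_inv[OF h0(1), of "1/2"] by auto
      have D: "\<bar>brouwer_degree u U y\<bar> \<le> (\<Sum>k<Suc K. a k y)"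
        using dl[of K y] h0(2)[OF _ K] by simp
      obtain k where k: "w k * \<bar>brouwer_degree u U y\<bar> \<le> a k y"
        using sum_weights_dominated[OF _ D w(1) w(2)] by auto
      then have "\<bar>brouwer_degree u U y\<bar> \<le> a k y / w k" using w(1)[of k] by (simp add: field_simps)
      then have "ennreal (\<bar>brouwer_degree u U y\<bar> powr q) \<le> ennreal ((a k y / w k) powr q)"
        using q by (intro ennreal_leI powr_mono2) auto
      also have "\<dots> = (\<Sum>k\<in>{k}. ennreal ((a k y / w k) powr q))" by simp
      also have "\<dots> \<le> (\<Sum>k. ennreal ((a k y / w k) powr q))"
        by (rule sum_le_suminf[OF summableI]) simp_all
      finally show ?thesis .
    qed
    have int: "(\<integral>\<^sup>+y. ennreal ((a k y / w k) powr q) \<partial>lborel) \<le> ennreal (b k)" for k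
    proof (cases k)
      case 0
      have "ennreal ((a k y / w k) powr q) = ennreal ((?C0 / w 0) powr q) * indicator (cub 0 ?R) y" for y
        by (simp add: a_def 0 indicator_def)
      then have "(\<integral>\<^sup>+y. ennreal ((a k y / w k) powr q) \<partial>lborel) = ennreal ((?C0 / w 0) powr q) * emeasure lborel (cub (0::real^'n) ?R)"
        by (simp add: nn_integral_cmult_indicator)
      also have "\<dots> = ennreal (b k)" using R0 by (simp add: b_def 0 emeasure_cub ennreal_mult')
      finally show ?thesis by simp
    next
      case (Suc j)
      let ?s = "\<lambda>y. \<Sum>c\<in>A j. indicator (cub (p j c) (?e j)) y :: real"
      let ?c = "(?C1 / w k) powr q * N j powr (q - 1)"
      have N0: "N j \<ge> 0" by (simp add: N)
      have le: "ennreal ((a k y / w k) powr q) \<le> (\<Sum>c\<in>A j. ennreal ?c * indicator (cub (p j c) (?e j)) y)" for y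
      proof -
        have s0: "0 \<le> ?s y" by (intro sum_nonneg) simp
        have "?s y \<le> (\<Sum>c\<in>A j. 1)" by (intro sum_mono) (simp add: indicator_def)
        then have sN: "?s y \<le> N j" using A(2)[of j] by simp
        have "(a k y / w k) powr q = (?C1 / w k) powr q * ?s y powr q"
          using C1 w(1)[of k] s0 by (simp add: a_def Suc flip: powr_mult)
        also have "\<dots> \<le> (?C1 / w k) powr q * (N j powr (q - 1) * ?s y)"
          by (intro mult_left_mono powr_le_card_mult s0 sN q) simp
        also have "\<dots> = (\<Sum>c\<in>A j. ?c * indicator (cub (p j c) (?e j)) y)"
          by (simp add: sum_distrib_left mult_ac)
        finally have "ennreal ((a k y / w k) powr q) \<le> ennreal (\<Sum>c\<in>A j. ?c * indicator (cub (p j c) (?e j)) y)"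
          by (rule ennreal_leI)
        also have "\<dots> = (\<Sum>c\<in>A j. ennreal (?c * indicator (cub (p j c) (?e j)) y))"
          by (rule sum_ennreal[symmetric]) simp
        also have "\<dots> = (\<Sum>c\<in>A j. ennreal ?c * indicator (cub (p j c) (?e j)) y)"
          by (intro sum.cong refl) (simp add: indicator_def)
        finally show ?thesis .
      qed
      have "(\<integral>\<^sup>+y. ennreal ((a k y / w k) powr q) \<partial>lborel) \<le> (\<integral>\<^sup>+y. (\<Sum>c\<in>A j. ennreal ?c * indicator (cub (p j c) (?e j)) y) \<partial>lborel)"
        by (intro nn_integral_mono le)
      also have "\<dots> = (\<Sum>c\<in>A j. ennreal ?c * emeasure lborel (cub (p j c) (?e j)))"
        by (subst nn_integral_sum) (auto intro!: sum.cong nn_integral_cmult_indicator)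
      also have "\<dots> = (\<Sum>c\<in>A j. ennreal (?c * (2 * ?e j) ^ CARD('n)))"
        using e0[of j] by (intro sum.cong refl) (simp add: emeasure_cub ennreal_mult')
      also have "\<dots> = ennreal (N j * (?c * (2 * ?e j) ^ CARD('n)))"
        using e0[of j] A(2)[of j] by (subst sum_ennreal) auto
      also have "N j * (?c * (2 * ?e j) ^ CARD('n)) = b k"
      proof -
        have e1: "N j * N j powr (q - 1) = N j powr q"
        proof (cases "N j = 0")
          case False
          then show ?thesis using N0 by (simp add: powr_diff)
        qed simp
        have e2: "(?C1 / w k) powr q = ?C1 powr q * (1 / w k) powr q"
          using C1 w(1)[of k] by (simp flip: powr_mult)
        have "2 * ?e j = (22 * E) * ?h j powr \<alpha>" by simp
        then have e3: "(2 * ?e j) ^ CARD('n) = (22 * E) ^ CARD('n) * (?h j powr \<alpha>) ^ CARD('n)"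
          by (simp only: power_mult_distrib)
        have "N j * (?c * (2 * ?e j) ^ CARD('n)) = (?C1 / w k) powr q * (N j * N j powr (q - 1)) * (2 * ?e j) ^ CARD('n)"
          by (simp only: mult_ac)
        also have "\<dots> = b k" unfolding e1 e2 e3 unfolding b_def Suc nat.case by (simp only: mult_ac)
        finally show ?thesis .
      qed
      finally show ?thesis .
    qed
    have "(\<integral>\<^sup>+y. ennreal (\<bar>brouwer_degree u U y\<bar> powr q) \<partial>lborel) \<le> (\<integral>\<^sup>+y. (\<Sum>k. ennreal ((a k y / w k) powr q)) \<partial>lborel)"
      by (intro nn_integral_mono pw)
    also have "\<dots> = (\<Sum>k. \<integral>\<^sup>+y. ennreal ((a k y / w k) powr q) \<partial>lborel)"
      using am by (intro nn_integral_suminf) simp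
    also have "\<dots> \<le> (\<Sum>k. ennreal (b k))" by (intro suminf_le int) auto
    also have "\<dots> = ennreal (suminf b)" using b0 sb by (rule suminf_ennreal2)
    finally show ?thesis .
  qed
  then show ?thesis by blast
qed

section \<open>Hoelder functions\<close>

text \<open>The real counterpart of a bound on \<open>holder_norm\<close>, with one constant for the
  supremum and the seminorm; the two are equivalent up to a factor 2.\<close>

definition hbound :: "real \<Rightarrow> real \<Rightarrow> 'a::real_normed_vector set \<Rightarrow> ('a \<Rightarrow> 'b::real_normed_vector) \<Rightarrow> bool" where
  "hbound \<alpha> C A f \<longleftrightarrow> (\<forall>x\<in>A. norm (f x) \<le> C) \<and> (\<forall>x\<in>A. \<forall>y\<in>A. norm (f x - f y) \<le> C * norm (x - y) powr \<alpha>)"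

lemma hbound_mono: "hbound \<alpha> C A f \<Longrightarrow> C \<le> D \<Longrightarrow> hbound \<alpha> D A f"
  unfolding hbound_def by (meson mult_right_mono order_trans powr_ge_zero)

lemma hbound_cong: "hbound \<alpha> C A f \<Longrightarrow> (\<And>x. x \<in> A \<Longrightarrow> f x = g x) \<Longrightarrow> hbound \<alpha> C A g"
  unfolding hbound_def by simp

lemma hbound_add:
  assumes "hbound \<alpha> C A f" "hbound \<alpha> D A g"
  shows "hbound \<alpha> (C + D) A (\<lambda>x. f x + g x)"
  unfolding hbound_def
proof (intro conjI ballI)
  fix x assume x: "x \<in> A"
  show "norm (f x + g x) \<le> C + D"
    using assms x norm_triangle_ineq[of "f x" "g x"] unfolding hbound_def by (meson add_mono order_trans)
  fix y assume y: "y \<in> A"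
  have "norm ((f x + g x) - (f y + g y)) \<le> norm (f x - f y) + norm (g x - g y)"
    by (rule norm_diff_triangle_ineq)
  also have "\<dots> \<le> C * norm (x - y) powr \<alpha> + D * norm (x - y) powr \<alpha>"
    using assms x y unfolding hbound_def by (intro add_mono) auto
  finally show "norm ((f x + g x) - (f y + g y)) \<le> (C + D) * norm (x - y) powr \<alpha>"
    by (simp add: distrib_right)
qed

lemma holder_norm_le_imp_hbound:
  assumes "holder_norm \<alpha> A f \<le> ennreal C" "0 \<le> C"
  shows "hbound \<alpha> C A f"
  unfolding hbound_def
proof (intro conjI ballI)
  fix x assume x: "x \<in> A"
  have "ennreal (norm (f x)) \<le> (SUP x\<in>A. ennreal (norm (f x)))" by (rule SUP_upper[OF x])
  also have "\<dots> \<le> holder_norm \<alpha> A f" by (simp add: holder_norm_def)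
  finally have "ennreal (norm (f x)) \<le> ennreal C" using assms(1) by (rule order_trans)
  then show "norm (f x) \<le> C" using assms(2) by (simp add: ennreal_le_iff)
  fix y assume y: "y \<in> A"
  show "norm (f x - f y) \<le> C * norm (x - y) powr \<alpha>"
  proof (cases "x = y")
    case False
    have "ennreal (norm (f x - f y) / norm (x - y) powr \<alpha>) \<le> holder_seminorm \<alpha> A f"
      unfolding holder_seminorm_def
      by (rule SUP_upper2[of "(x, y)"]) (use x y False in auto)
    also have "\<dots> \<le> holder_norm \<alpha> A f" by (simp add: holder_norm_def)
    finally have "ennreal (norm (f x - f y) / norm (x - y) powr \<alpha>) \<le> ennreal C" using assms(1) by (rule order_trans)
    then have "norm (f x - f y) / norm (x - y) powr \<alpha> \<le> C" using assms(2) by (simp add: ennreal_le_iff)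
    then show ?thesis using False by (simp add: pos_divide_le_eq)
  qed simp
qed

lemma holder_space_imp_hbound:
  assumes "f \<in> holder_space \<alpha> A"
  shows "\<exists>C\<ge>0. hbound \<alpha> C A f"
proof -
  have "holder_norm \<alpha> A f < \<infinity>" using assms by (simp add: holder_space_def)
  then obtain C where "0 \<le> C" "holder_norm \<alpha> A f = ennreal C" by (cases "holder_norm \<alpha> A f") auto
  then show ?thesis using holder_norm_le_imp_hbound[of \<alpha> A f C] by auto
qed

lemma tendsto_holder_hbound:
  assumes "tendsto_holder \<alpha> A u w"
  shows "\<exists>C\<ge>0. hbound \<alpha> C A w \<and> (\<forall>k. hbound \<alpha> C A (u k))"
    and "e > 0 \<Longrightarrow> \<forall>\<^sub>F k in sequentially. \<forall>x\<in>A. norm (u k x - w x) \<le> e"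
proof -
  have lim: "(\<lambda>k. holder_norm \<alpha> A (\<lambda>x. u k x - w x)) \<longlonglongrightarrow> 0"
    and uk: "\<And>k. u k \<in> holder_space \<alpha> A" and w: "w \<in> holder_space \<alpha> A"
    using assms by (auto simp: tendsto_holder_def)
  have ev: "\<forall>\<^sub>F k in sequentially. hbound \<alpha> e A (\<lambda>x. u k x - w x)" if "e > 0" for e
  proof -
    have "\<forall>\<^sub>F k in sequentially. holder_norm \<alpha> A (\<lambda>x. u k x - w x) < ennreal e"
      using order_tendstoD(2)[OF lim, of "ennreal e"] that by simp
    then show ?thesis by eventually_elim (use that in \<open>auto intro: holder_norm_le_imp_hbound\<close>)
  qed
  show "e > 0 \<Longrightarrow> \<forall>\<^sub>F k in sequentially. \<forall>x\<in>A. norm (u k x - w x) \<le> e"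
    using ev[of e] by (auto simp: hbound_def elim: eventually_mono)
  obtain Cw where Cw: "Cw \<ge> 0" "hbound \<alpha> Cw A w" using holder_space_imp_hbound[OF w] by blast
  obtain K where K: "\<And>k. k \<ge> K \<Longrightarrow> hbound \<alpha> 1 A (\<lambda>x. u k x - w x)"
    using ev[of 1] by (auto simp: eventually_sequentially)
  have "\<forall>k. \<exists>C\<ge>0. hbound \<alpha> C A (u k)" using holder_space_imp_hbound[OF uk] by blast
  from choice[OF this] obtain C where C: "\<forall>k. C k \<ge> 0 \<and> hbound \<alpha> (C k) A (u k)" ..
  \<comment> \<open>The finitely many members before \<open>K\<close> are bounded one by one; from
    \<open>K\<close> on the distance to the limit is at most 1.\<close>
  define D where "D = (1 + Cw) + (\<Sum>k<K. C k)"
  have S0: "(\<Sum>k<K. C k) \<ge> 0" using C by (intro sum_nonneg) auto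
  have "hbound \<alpha> D A (u k)" for k
  proof (cases "k < K")
    case True
    have "C k \<le> (\<Sum>k<K. C k)" using True C by (intro member_le_sum) auto
    then have "C k \<le> D" using Cw by (simp add: D_def)
    then show ?thesis using C hbound_mono by blast
  next
    case False
    then have "hbound \<alpha> (1 + Cw) A (\<lambda>x. (u k x - w x) + w x)" by (intro hbound_add K Cw(2)) simp
    then have "hbound \<alpha> (1 + Cw) A (u k)" by simp
    then show ?thesis by (rule hbound_mono) (use S0 in \<open>simp add: D_def\<close>)
  qed
  moreover have "hbound \<alpha> D A w" by (rule hbound_mono[OF Cw(2)]) (use S0 in \<open>simp add: D_def\<close>)
  moreover have "D \<ge> 0" using S0 Cw by (simp add: D_def)
  ultimately show "\<exists>C\<ge>0. hbound \<alpha> C A w \<and> (\<forall>k. hbound \<alpha> C A (u k))" by blast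
qed

lemma hbound_imp_uniformly_continuous:
  assumes "hbound \<alpha> C A f" "0 < \<alpha>"
  shows "uniformly_continuous_on A f"
  unfolding uniformly_continuous_on_def
proof (intro allI impI)
  fix e :: real assume e: "e > 0"
  define D where "D = max C 1"
  have D: "D \<ge> 1" "C \<le> D" by (auto simp: D_def)
  let ?d = "(e / D) powr (1 / \<alpha>)"
  have "dist (f x') (f x) < e" if "x \<in> A" "x' \<in> A" "dist x' x < ?d" for x x'
  proof (cases "x' = x")
    case False
    have "norm (f x' - f x) \<le> C * norm (x' - x) powr \<alpha>" using assms(1) that by (simp add: hbound_def)
    also have "\<dots> \<le> D * norm (x' - x) powr \<alpha>" using D by (intro mult_right_mono) auto
    also have "norm (x' - x) powr \<alpha> < ?d powr \<alpha>"
      using that assms(2) by (intro powr_less_mono2) (auto simp: dist_norm)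
    also have "?d powr \<alpha> = e / D" using assms(2) e D by (simp add: powr_powr)
    finally show ?thesis using D by (simp add: dist_norm)
  qed (use e in simp)
  moreover have "?d > 0" using e D by simp
  ultimately show "\<exists>d>0. \<forall>x\<in>A. \<forall>x'\<in>A. dist x' x < d \<longrightarrow> dist (f x') (f x) < e" by blast
qed

lemma cont_ext_props:
  fixes f :: "'a::euclidean_space \<Rightarrow> 'b::euclidean_space"
  assumes "uniformly_continuous_on U f"
  shows "continuous_on (closure U) (cont_ext U f)" "\<And>x. x \<in> U \<Longrightarrow> cont_ext U f x = f x"
proof -
  obtain g where "uniformly_continuous_on (closure U) g" "\<And>x. x \<in> U \<Longrightarrow> f x = g x"
    using uniformly_continuous_on_extension_on_closure[OF assms] by metis
  then have "\<exists>v. continuous_on (closure U) v \<and> (\<forall>x\<in>U. v x = f x)"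
    by (intro exI[of _ g]) (auto intro: uniformly_continuous_imp_continuous)
  from someI_ex[OF this] show "continuous_on (closure U) (cont_ext U f)" "\<And>x. x \<in> U \<Longrightarrow> cont_ext U f x = f x"
    unfolding cont_ext_def by auto
qed

text \<open>Passing to the maximum norm costs \<open>CARD('n) powr \<alpha>\<close>, at most
  \<open>CARD('n)\<close>; the \<open>+ 1\<close> makes the constant positive.\<close>

lemma hbound_holder_cub:
  fixes u :: "real^'n \<Rightarrow> real^'n"
  assumes "hbound \<alpha> C U u" "0 < \<alpha>" "\<alpha> \<le> 1" "0 \<le> C"
  shows "holder_cub \<alpha> ((C + 1) * real CARD('n)) U u"
  unfolding holder_cub_def
proof (intro allI ballI impI)
  fix h :: real and x z assume h: "h > 0" and xz: "x \<in> U" "z \<in> U" "z \<in> cub x h"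
  have n1: "real CARD('n) \<ge> 1" by (simp add: Suc_le_eq)
  have "norm (u z - u x) \<le> C * norm (z - x) powr \<alpha>" using assms(1) xz by (simp add: hbound_def)
  also have "\<dots> \<le> C * (real CARD('n) * h) powr \<alpha>"
    using norm_le_cub[OF xz(3)] assms by (intro mult_left_mono powr_mono2) auto
  also have "\<dots> = C * real CARD('n) powr \<alpha> * h powr \<alpha>" using h by (simp add: powr_mult)
  also have "\<dots> \<le> (C + 1) * real CARD('n) * h powr \<alpha>"
  proof (intro mult_right_mono mult_mono)
    show "real CARD('n) powr \<alpha> \<le> real CARD('n)" using powr_mono[OF assms(3) n1] n1 by simp
  qed (use assms in auto)
  finally have "u z \<in> cball (u x) ((C + 1) * real CARD('n) * h powr \<alpha>)"
    by (simp add: dist_norm norm_minus_commute)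
  then show "u z \<in> cub (u x) ((C + 1) * real CARD('n) * h powr \<alpha>)" using cball_subset_cub by blast
qed

text \<open>The image of the frontier is estimated through values at limit points of
  \<open>U\<close>; both inequalities pass to the limit.\<close>

lemma hbound_closure:
  fixes f :: "'a::euclidean_space \<Rightarrow> 'b::euclidean_space"
  assumes "hbound \<alpha> C U f" "continuous_on (closure U) f" "0 < \<alpha>"
  shows "hbound \<alpha> C (closure U) f"
  unfolding hbound_def
proof (intro conjI ballI)
  fix x assume x: "x \<in> closure U"
  obtain X where X: "\<And>k. X k \<in> U" "X \<longlonglongrightarrow> x" using x by (metis closure_sequential)
  have Xc: "\<forall>k. X k \<in> closure U" using X(1) closure_subset by blast
  have fX: "(\<lambda>k. f (X k)) \<longlonglongrightarrow> f x"
    using continuous_on_tendsto_compose[OF assms(2) X(2) x] Xc by simp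
  show "norm (f x) \<le> C"
    by (rule LIMSEQ_le_const2[OF tendsto_norm[OF fX]]) (use assms(1) X(1) in \<open>auto simp: hbound_def\<close>)
  fix y assume y: "y \<in> closure U"
  obtain Y where Y: "\<And>k. Y k \<in> U" "Y \<longlonglongrightarrow> y" using y by (metis closure_sequential)
  have Yc: "\<forall>k. Y k \<in> closure U" using Y(1) closure_subset by blast
  have fY: "(\<lambda>k. f (Y k)) \<longlonglongrightarrow> f y"
    using continuous_on_tendsto_compose[OF assms(2) Y(2) y] Yc by simp
  have "(\<lambda>k. norm (X k - Y k) powr \<alpha>) \<longlonglongrightarrow> norm (x - y) powr \<alpha>"
    using assms(3) by (intro tendsto_powr' tendsto_norm tendsto_diff X Y tendsto_const) auto
  then have "(\<lambda>k. C * norm (X k - Y k) powr \<alpha>) \<longlonglongrightarrow> C * norm (x - y) powr \<alpha>"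
    by (intro tendsto_mult tendsto_const)
  then show "norm (f x - f y) \<le> C * norm (x - y) powr \<alpha>"
    by (rule LIMSEQ_le[OF tendsto_norm[OF tendsto_diff[OF fX fY]]])
       (use assms(1) X(1) Y(1) in \<open>auto simp: hbound_def\<close>)
qed

section \<open>Dyadic box counts and the image of the frontier\<close>

text \<open>The slack \<open>d' - d\<close> absorbs the factors that the logarithmic limit does not
  see. A box number 0 is treated apart because of \<open>ln 0 = 0\<close>.\<close>

lemma box_dim_eventually:
  fixes F :: "'a::euclidean_space set"
  assumes "has_box_dim F d" "d < d'"
  shows "\<forall>\<^sub>F k in sequentially. real (box_number ((1/2) ^ k) F) \<le> 2 powr (d' * real k)"
proof -
  have "filterlim (\<lambda>k. (1/2::real) ^ k) (at_right 0) sequentially"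
    unfolding at_within_def
    by (intro filterlim_inf[THEN iffD2] conjI LIMSEQ_realpow_zero) (auto simp: filterlim_principal intro!: always_eventually)
  with assms(1) have "(\<lambda>k. ln (real (box_number ((1/2) ^ k) F)) / (- ln ((1/2) ^ k))) \<longlonglongrightarrow> d"
    unfolding has_box_dim_def by (rule filterlim_compose)
  from order_tendstoD(2)[OF this assms(2)] eventually_gt_at_top[of 0]
  show ?thesis
  proof eventually_elim
    case (elim k)
    let ?N = "real (box_number ((1/2) ^ k) F)"
    have l: "- ln ((1/2::real) ^ k) = real k * ln 2" by (simp add: ln_realpow ln_div)
    show ?case
    proof (cases "?N > 0")
      case True
      have "ln ?N < d' * (real k * ln 2)" using elim l by (simp add: divide_less_eq)
      then have "exp (ln ?N) \<le> exp (d' * (real k * ln 2))" by simp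
      then show ?thesis using True by (simp add: powr_def mult_ac)
    next
      case False
      then have "?N = 0" by simp
      then show ?thesis by simp
    qed
  qed
qed

text \<open>For large k, 2^(d'k) boxes of side 2^(-k) cover the frontier, and their images lie in
  cubes of volume of order 2^(-n\<alpha>k). The total volume tends to 0 for d < d' <
  n\<alpha>.\<close>

lemma null_image_frontier:
  fixes u :: "real^'n \<Rightarrow> real^'n"
  assumes U: "bounded U" and dim: "has_box_dim (frontier U) d" and d: "d < real CARD('n) * \<alpha>" and \<alpha>: "0 < \<alpha>" "\<alpha> \<le> 1"
    and hb: "hbound \<alpha> C U u" and u: "continuous_on (closure U) u" and C: "0 \<le> C"
  shows "u ` frontier U \<in> null_sets lborel"
proof -
  let ?F = "frontier U"
  define E where "E = (C + 1) * real CARD('n)"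
  have E: "E > 0" using C by (simp add: E_def)
  have osc: "holder_cub \<alpha> E (closure U) u" unfolding E_def
    by (rule hbound_holder_cub[OF hbound_closure[OF hb u \<alpha>(1)] \<alpha> C])
  have Fcl: "?F \<subseteq> closure U" by (auto simp: frontier_def)
  have bF: "bounded ?F" using compact_frontier_bounded[OF U] compact_imp_bounded by blast
  have meas: "u ` ?F \<in> sets borel"
    by (rule borel_closed[OF compact_imp_closed[OF compact_image_frontier[OF U u]]])
  obtain d' where d': "d < d'" and d'': "d' < real CARD('n) * \<alpha>" using dense[OF d] by blast
  have bound: "emeasure lborel (u ` ?F) \<le> ennreal (real (box_number ((1/2) ^ k) ?F) * (2 * (E * ((1/2) ^ k) powr \<alpha>)) ^ CARD('n))" for k
  proof -
    let ?h = "(1/2::real) ^ k"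
    have e0: "E * ?h powr \<alpha> \<ge> 0" using E by simp
    obtain A where A: "finite A" "card A = box_number ?h ?F" "?F \<subseteq> (\<Union>a\<in>A. cbox a (a + ?h *\<^sub>R One))"
      using box_number_cover[OF bF, of ?h] by auto
    define q where "q a = (SOME x. x \<in> ?F \<inter> cbox a (a + ?h *\<^sub>R One))" for a
    have "u ` ?F \<subseteq> (\<Union>a\<in>A. cub (u (q a)) (E * ?h powr \<alpha>))"
    proof (rule image_subsetI)
      fix x assume x: "x \<in> ?F"
      with A(3) obtain a where a: "a \<in> A" "x \<in> cbox a (a + ?h *\<^sub>R One)" by blast
      have qa: "q a \<in> ?F \<inter> cbox a (a + ?h *\<^sub>R One)" unfolding q_def by (rule someI[of _ x]) (use x a in blast)
      have "\<bar>x $ i - q a $ i\<bar> \<le> ?h" for i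
      proof -
        have "a $ i \<le> x $ i" "x $ i \<le> a $ i + ?h" using a(2) unfolding mem_cbox_One by auto
        moreover have "a $ i \<le> q a $ i" "q a $ i \<le> a $ i + ?h" using qa unfolding Int_iff mem_cbox_One by auto
        ultimately show ?thesis by (simp add: abs_le_iff)
      qed
      then have "x \<in> cub (q a) ?h" by (simp add: cub_def)
      then have "u x \<in> cub (u (q a)) (E * ?h powr \<alpha>)"
        using osc x qa Fcl unfolding holder_cub_def by (meson IntD1 subsetD zero_less_divide_1_iff zero_less_numeral zero_less_power)
      with a(1) show "u x \<in> (\<Union>a\<in>A. cub (u (q a)) (E * ?h powr \<alpha>))" by blast
    qed
    then have "emeasure lborel (u ` ?F) \<le> emeasure lborel (\<Union>a\<in>A. cub (u (q a)) (E * ?h powr \<alpha>))"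
      by (intro emeasure_mono sets.finite_UN A(1)) auto
    also have "\<dots> \<le> (\<Sum>a\<in>A. emeasure lborel (cub (u (q a)) (E * ?h powr \<alpha>)))"
      by (intro emeasure_subadditive_finite A(1)) auto
    also have "\<dots> = ennreal (real (box_number ?h ?F) * (2 * (E * ?h powr \<alpha>)) ^ CARD('n))"
      unfolding emeasure_cub[OF e0] using A(2) e0 by (subst sum_ennreal) auto
    finally show ?thesis .
  qed
  have "(\<lambda>k. (2 * E) ^ CARD('n) * (2 powr (d' - real CARD('n) * \<alpha>)) ^ k) \<longlonglongrightarrow> (2 * E) ^ CARD('n) * 0"
    using d'' powr_less_mono[of "d' - real CARD('n) * \<alpha>" 0 2]
    by (intro tendsto_mult tendsto_const LIMSEQ_realpow_zero) auto
  then have lim: "(\<lambda>k. ennreal ((2 * E) ^ CARD('n) * (2 powr (d' - real CARD('n) * \<alpha>)) ^ k)) \<longlonglongrightarrow> 0"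
    using tendsto_ennrealI by fastforce
  have "emeasure lborel (u ` ?F) \<le> 0"
  proof (rule tendsto_lowerbound[OF lim])
    show "\<forall>\<^sub>F k in sequentially. emeasure lborel (u ` ?F) \<le> ennreal ((2 * E) ^ CARD('n) * (2 powr (d' - real CARD('n) * \<alpha>)) ^ k)"
      using box_dim_eventually[OF dim d']
    proof eventually_elim
      case (elim k)
      have h: "((1/2::real) ^ k) powr \<alpha> = 2 powr (- \<alpha> * real k)"
        by (simp add: powr_minus powr_powr power_one_over powr_realpow[symmetric] powr_divide mult.commute inverse_eq_divide)
      have "real (box_number ((1/2) ^ k) ?F) * (2 * (E * ((1/2) ^ k) powr \<alpha>)) ^ CARD('n)
        \<le> 2 powr (d' * real k) * (2 * (E * ((1/2) ^ k) powr \<alpha>)) ^ CARD('n)"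
        using E elim by (intro mult_right_mono) auto
      also have "\<dots> = (2 * E) ^ CARD('n) * (2 powr (d' * real k) * (2 powr (- \<alpha> * real k)) ^ CARD('n))"
        unfolding h by (simp add: power_mult_distrib mult_ac)
      also have "2 powr (d' * real k) * (2 powr (- \<alpha> * real k)) ^ CARD('n) = (2 powr (d' - real CARD('n) * \<alpha>)) ^ k"
        by (simp add: powr_realpow[symmetric] powr_powr powr_add[symmetric] algebra_simps flip: powr_power)
      finally show ?case using bound[of k] by (meson ennreal_leI order_trans)
    qed
  qed simp
  then show ?thesis using meas by (auto simp: null_sets_def)
qed

section \<open>Convergence of the degree\<close>

text \<open>Some coordinate of \<open>u - y\<close> exceeds 1 in absolute value on the whole
  closure, so the kernel of width 1/4 in the degree formula vanishes throughout
  \<open>U\<close>.\<close>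

lemma brouwer_degree_support:
  fixes u :: "real^'n \<Rightarrow> real^'n"
  assumes U: "open U" "bounded U" and u: "continuous_on (closure U) u"
    and S: "\<And>x. x \<in> closure U \<Longrightarrow> norm (u x) \<le> S" and y: "brouwer_degree u U y \<noteq> 0"
  shows "y \<in> cub 0 (S + 1)"
proof (rule ccontr)
  assume "y \<notin> cub 0 (S + 1)"
  then obtain i where i: "S + 1 < \<bar>y $ i\<bar>" by (auto simp: cub_def not_le)
  have ui: "\<bar>u x $ i\<bar> \<le> S" if "x \<in> closure U" for x
    using component_le_norm_cart[of "u x" i] S[OF that] by linarith
  have far: "1 < \<bar>u x $ i - y $ i\<bar>" if "x \<in> closure U" for x
    using ui[OF that] i by linarith
  obtain v where v: "v \<in> smooth_closure U" "\<And>x. x \<in> closure U \<Longrightarrow> norm (v x - u x) < 1 / 4"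
    using smooth_approximation[OF U(2) u, of "1 / 4"] by auto
  have vu: "\<bar>v x $ j - u x $ j\<bar> < 1 / 4" if "x \<in> closure U" for x j
    using component_le_norm_cart[of "v x - u x" j] v(2)[OF that] by simp
  have "\<forall>x\<in>frontier U. \<exists>i. 2 * (1 / 4) < \<bar>u x $ i - y $ i\<bar>"
  proof
    fix x assume "x \<in> frontier U"
    then have "1 < \<bar>u x $ i - y $ i\<bar>" using far by (simp add: frontier_def)
    then show "\<exists>i. 2 * (1 / 4) < \<bar>u x $ i - y $ i\<bar>" by (intro exI[of _ i]) simp
  qed
  then have "brouwer_degree u U y = (LINT x:U|lborel. kap (1 / 4) (v x - y) * det (jac v x))"
    by (intro brouwer_degree_eq[OF U u _ _ v(1) vu]) auto
  also have "\<dots> = (LINT x|(lborel :: (real^'n) measure). 0)"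
    unfolding set_lebesgue_integral_def
  proof (rule Bochner_Integration.integral_cong[OF refl])
    fix x
    have "kap (1 / 4) (v x - y) = 0" if "x \<in> U"
    proof (rule ccontr)
      assume nz: "kap (1 / 4) (v x - y) \<noteq> 0"
      have x: "x \<in> closure U" using that closure_subset by blast
      have "0 < v x $ i - y $ i" "v x $ i - y $ i < 1 / 4" using kap_nonzero[OF _ nz, of i] by simp_all
      with far[OF x] vu[OF x, of i] show False by linarith
    qed
    then show "indicator U x *\<^sub>R (kap (1 / 4) (v x - y) * det (jac v x)) = 0" by (cases "x \<in> U") auto
  qed
  finally show False using y by simp
qed

lemma powr_le_one_plus:
  assumes "1 \<le> p" "p \<le> q"
  shows "\<bar>t\<bar> powr p \<le> indicator {t. t \<noteq> 0} t + \<bar>t::real\<bar> powr q"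
proof (cases "t = 0")
  case False
  show ?thesis
  proof (cases "\<bar>t\<bar> \<le> 1")
    case True
    then have "\<bar>t\<bar> powr p \<le> 1 powr p" using assms by (intro powr_mono2) auto
    then show ?thesis using False by (simp add: add_increasing2)
  next
    case False
    then have "\<bar>t\<bar> powr p \<le> \<bar>t\<bar> powr q" using assms by (intro powr_mono) auto
    then show ?thesis by (simp add: add_increasing)
  qed
qed (use assms in simp)

lemma integrable_powr_lower:
  fixes f :: "real^'n \<Rightarrow> real"
  assumes "f \<in> borel_measurable borel" "1 \<le> p" "p \<le> q" "integrable lborel (\<lambda>x. \<bar>f x\<bar> powr q)"
    and "\<And>x. f x \<noteq> 0 \<Longrightarrow> x \<in> cub 0 R"
  shows "integrable lborel (\<lambda>x. \<bar>f x\<bar> powr p)"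
proof (rule Bochner_Integration.integrable_bound)
  show "integrable lborel (\<lambda>x. indicator (cub 0 R) x + \<bar>f x\<bar> powr q)"
    using emeasure_bounded_finite[OF bounded_cub]
    by (intro Bochner_Integration.integrable_add assms(4) integrable_real_indicator) auto
  show "(\<lambda>x. \<bar>f x\<bar> powr p) \<in> borel_measurable lborel" using assms(1) by simp
  show "AE x in lborel. norm (\<bar>f x\<bar> powr p) \<le> norm (indicator (cub 0 R) x + \<bar>f x\<bar> powr q)"
  proof (rule AE_I2)
    fix x
    show "norm (\<bar>f x\<bar> powr p) \<le> norm (indicator (cub 0 R) x + \<bar>f x\<bar> powr q)"
      using powr_le_one_plus[OF assms(2,3), of "f x"] assms(5)[of x] by (cases "f x = 0") auto
  qed
qed

text \<open>
  For every \<open>m > 0\<close>, \<open>\<bar>g\<bar>\<^sup>p\<close> is at most \<open>m\<^sup>p + m\<^sup>p\<^sup>-\<^sup>q \<bar>g\<bar>\<^sup>q\<close> where \<open>g\<close> is nonzero, and the measure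
  of that set tends to 0.
\<close>

lemma Lp_convergence:
  fixes g :: "nat \<Rightarrow> real^'n \<Rightarrow> real"
  assumes p: "1 \<le> p" "p < q" and meas: "\<And>k. g k \<in> borel_measurable borel"
    and supp: "\<And>k y. g k y \<noteq> 0 \<Longrightarrow> y \<in> cub 0 R"
    and ev: "AE y in lborel. \<forall>\<^sub>F k in sequentially. g k y = 0"
    and int: "\<And>k. integrable lborel (\<lambda>y. \<bar>g k y\<bar> powr q)"
    and Q: "\<And>k. (LINT y|lborel. \<bar>g k y\<bar> powr q) \<le> Q"
  shows "(\<lambda>k. LINT y|lborel. \<bar>g k y\<bar> powr p) \<longlonglongrightarrow> 0"
proof -
  have cubint: "integrable lborel (indicator (cub (0::real^'n) R) :: _ \<Rightarrow> real)"
    using emeasure_bounded_finite[OF bounded_cub] by (intro integrable_real_indicator) auto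
  let ?J = "\<lambda>k y. indicator {y. g k y \<noteq> 0} y :: real"
  have Jm: "?J k \<in> borel_measurable borel" for k
    using meas[of k] by (intro borel_measurable_indicator) measurable
  have Jle: "\<bar>?J k y\<bar> \<le> indicator (cub 0 R) y" for k y using supp[of k y] by (simp add: indicator_def)
  have Jint: "integrable lborel (?J k)" for k
    by (rule Bochner_Integration.integrable_bound[OF cubint]) (use Jm Jle in auto)
  have J0: "(\<lambda>k. LINT y|lborel. ?J k y) \<longlonglongrightarrow> (LINT y|(lborel :: (real^'n) measure). (0::real))"
  proof (rule integral_dominated_convergence[OF _ _ cubint])
    show "AE y in lborel. (\<lambda>k. ?J k y) \<longlonglongrightarrow> 0"
      using ev
    proof eventually_elim
      case (elim y)
      then have "\<forall>\<^sub>F k in sequentially. ?J k y = 0" by eventually_elim simp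
      then show ?case by (rule tendsto_eventually)
    qed
  qed (use Jm Jle in auto)
  have Q0: "Q \<ge> 0" using Q[of 0] by (rule order_trans[rotated]) simp
  have pint: "integrable lborel (\<lambda>y. \<bar>g k y\<bar> powr p)" for k
    by (rule integrable_powr_lower[OF meas p(1) less_imp_le[OF p(2)] int supp])
  show ?thesis
  proof (rule LIMSEQ_I)
    fix e :: real assume e: "e > 0"
    \<comment> \<open>Solves \<open>m powr (p - q) * (Q + 1) = e / 2\<close>. The exponent is
      negative, so the values above \<open>m\<close> contribute at most
      \<open>e / 2\<close>.\<close>
    define m where "m = ((e / 2) / (Q + 1)) powr (1 / (p - q))"
    have m: "m > 0" using e Q0 by (simp add: m_def)
    have mp: "m powr (p - q) = (e / 2) / (Q + 1)" using e Q0 p by (simp add: m_def powr_powr)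
    have pw: "\<bar>g k y\<bar> powr p \<le> m powr p * ?J k y + m powr (p - q) * \<bar>g k y\<bar> powr q" for k y
    proof (cases "g k y = 0")
      case False
      show ?thesis
      proof (cases "\<bar>g k y\<bar> \<le> m")
        case True
        then have "\<bar>g k y\<bar> powr p \<le> m powr p" using p by (intro powr_mono2) auto
        then show ?thesis using False by (simp add: add_increasing2)
      next
        case big: False
        have "\<bar>g k y\<bar> powr p = \<bar>g k y\<bar> powr (p - q) * \<bar>g k y\<bar> powr q"
          using False by (simp flip: powr_add)
        also have "\<dots> \<le> m powr (p - q) * \<bar>g k y\<bar> powr q"
          using big p m by (intro mult_right_mono powr_mono2') auto
        finally show ?thesis by (simp add: add_increasing)
      qed
    qed (use p in simp)
    have est: "(LINT y|lborel. \<bar>g k y\<bar> powr p) \<le> m powr p * (LINT y|lborel. ?J k y) + e / 2" for k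
    proof -
      have "(LINT y|lborel. \<bar>g k y\<bar> powr p) \<le> (LINT y|lborel. m powr p * ?J k y + m powr (p - q) * \<bar>g k y\<bar> powr q)"
        by (intro integral_mono pint Bochner_Integration.integrable_add integrable_mult_right Jint int pw)
      also have "\<dots> = m powr p * (LINT y|lborel. ?J k y) + m powr (p - q) * (LINT y|lborel. \<bar>g k y\<bar> powr q)"
        using Jint[of k] int[of k] by (simp add: Bochner_Integration.integral_add)
      also have "m powr (p - q) * (LINT y|lborel. \<bar>g k y\<bar> powr q) \<le> (e / 2) / (Q + 1) * (Q + 1)"
        unfolding mp using Q[of k] Q0 e by (intro mult_left_mono) auto
      also have "\<dots> = e / 2"
      proof -
        have "Q + 1 \<noteq> 0" using Q0 by simp
        moreover have "(e / 2) / z * z = e / 2" if "z \<noteq> 0" for z using that by simp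
        ultimately show ?thesis by blast
      qed
      finally show ?thesis by simp
    qed
    have "(\<lambda>k. m powr p * (LINT y|lborel. ?J k y)) \<longlonglongrightarrow> m powr p * 0"
      using J0 by (intro tendsto_mult tendsto_const) simp
    then have "\<forall>\<^sub>F k in sequentially. m powr p * (LINT y|lborel. ?J k y) < e / 2"
      using e by (intro order_tendstoD(2)) auto
    then obtain K where K: "\<And>k. k \<ge> K \<Longrightarrow> m powr p * (LINT y|lborel. ?J k y) < e / 2"
      by (auto simp: eventually_sequentially)
    show "\<exists>K. \<forall>k\<ge>K. norm ((LINT y|lborel. \<bar>g k y\<bar> powr p) - 0) < e"
    proof (intro exI allI impI)
      fix k assume "k \<ge> K"
      from K[OF this] est[of k] have "(LINT y|lborel. \<bar>g k y\<bar> powr p) < e" by linarith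
      then show "norm ((LINT y|lborel. \<bar>g k y\<bar> powr p) - 0) < e" by simp
    qed
  qed
qed

text \<open>Dividing by geometric weights costs 2^(\<theta>qk) up to a constant, against a decay of
  2^((qd' - n\<alpha>)k); by \<open>neg\<close> the product is still geometric with ratio below 1.
  The factor \<open>1 - 2 powr (- \<theta>)\<close> normalises the sum of the weights.\<close>

lemma degree_weights_summable:
  fixes N :: "nat \<Rightarrow> real" and n :: nat
  assumes N: "\<forall>\<^sub>F k in sequentially. N k \<le> 2 powr (d' * real k)" "\<And>k. 0 \<le> N k"
    and \<theta>: "\<theta> > 0" and q: "1 \<le> q" and neg: "q * (d' + \<theta>) < real n * \<alpha>"
  defines "w k \<equiv> (1 - 2 powr (- \<theta>)) * (2 powr (- \<theta>)) ^ k"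
  shows "0 < w k" and "(\<Sum>k<K. w k) \<le> 1"
    and "summable (\<lambda>k. (1 / w (Suc k)) powr q * N k powr q * (((1/2) ^ k) powr \<alpha>) ^ n)"
proof -
  let ?s = "2 powr (- \<theta>)"
  have s: "0 < ?s" "?s < 1" using \<theta> powr_less_mono[of "- \<theta>" 0 2] by auto
  show w0: "0 < w k" for k using s by (simp add: w_def)
  have "(\<Sum>k<K. w k) = 1 - ?s ^ K" using s by (simp add: w_def sum_distrib_left[symmetric] sum_gp_strict)
  then show "(\<Sum>k<K. w k) \<le> 1" using s by simp
  let ?r = "2 powr (q * (d' + \<theta>) - real n * \<alpha>)"
  let ?C = "(1 / ((1 - ?s) * ?s)) powr q"
  have r: "0 \<le> ?r" "?r < 1" using neg powr_less_mono[of "q * (d' + \<theta>) - real n * \<alpha>" 0 2] by auto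
  show "summable (\<lambda>k. (1 / w (Suc k)) powr q * N k powr q * (((1/2) ^ k) powr \<alpha>) ^ n)"
  proof (rule summable_comparison_test_ev)
    show "summable (\<lambda>k. ?C * ?r ^ k)" using r by (intro summable_mult summable_geometric) simp
    show "\<forall>\<^sub>F k in sequentially. norm ((1 / w (Suc k)) powr q * N k powr q * (((1/2) ^ k) powr \<alpha>) ^ n) \<le> ?C * ?r ^ k"
      using N(1)
    proof eventually_elim
      case (elim k)
      have a: "(1 / w (Suc k)) powr q = ?C * 2 powr (\<theta> * q * real k)"
      proof -
        have "?s ^ k = 2 powr (- \<theta> * real k)" by (simp add: powr_powr flip: powr_realpow)
        then have "1 / w (Suc k) = (1 / ((1 - ?s) * ?s)) * 2 powr (\<theta> * real k)"
          by (simp add: w_def powr_minus field_simps)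
        then show ?thesis using s by (simp only:) (subst powr_mult, auto simp: powr_powr mult_ac)
      qed
      have b: "N k powr q \<le> 2 powr (d' * q * real k)"
        using powr_mono2[of q "N k" "2 powr (d' * real k)"] elim N(2)[of k] q by (simp add: powr_powr mult_ac)
      have "((1/2::real) ^ k) powr \<alpha> = 2 powr (- (\<alpha> * real k))"
        by (simp add: powr_minus_divide powr_powr power_one_over powr_divide mult.commute flip: powr_realpow)
      then have c: "(((1/2::real) ^ k) powr \<alpha>) ^ n = 2 powr (- (real n * \<alpha> * real k))"
        by (simp add: powr_powr mult_ac flip: powr_realpow)
      have "norm ((1 / w (Suc k)) powr q * N k powr q * (((1/2) ^ k) powr \<alpha>) ^ n) =
          ?C * (2 powr (\<theta> * q * real k) * N k powr q * 2 powr (- (real n * \<alpha> * real k)))"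
        unfolding c a by (simp add: abs_mult)
      also have "\<dots> \<le> ?C * (2 powr (\<theta> * q * real k) * 2 powr (d' * q * real k) * 2 powr (- (real n * \<alpha> * real k)))"
        using b by (intro mult_left_mono mult_right_mono) auto
      also have "2 powr (\<theta> * q * real k) * 2 powr (d' * q * real k) * 2 powr (- (real n * \<alpha> * real k)) = ?r ^ k"
        by (simp add: powr_powr algebra_simps flip: powr_realpow powr_add)
      finally show ?case .
    qed
  qed
qed

lemma degree_in_Lp_bound:
  fixes U :: "(real^'n) set"
  assumes \<alpha>: "0 < \<alpha>" "\<alpha> \<le> 1" and U: "open U" "bounded U" and dim: "has_box_dim (frontier U) d" and d: "0 < d"
    and q: "1 \<le> q" "q * d < real CARD('n) * \<alpha>" and C: "0 \<le> C"
  shows "\<exists>M. \<forall>u. hbound \<alpha> C U u \<longrightarrow> continuous_on (closure U) u \<longrightarrow>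
      u ` frontier U \<in> null_sets lborel \<and>
      integrable lborel (\<lambda>y. \<bar>brouwer_degree u U y\<bar> powr q) \<and>
      (LINT y|lborel. \<bar>brouwer_degree u U y\<bar> powr q) \<le> M"
proof -
  define E where "E = (C + 1) * real CARD('n)"
  have E: "E > 0" using C by (simp add: E_def)
  define N where "N k = real (box_number ((1/2) ^ k) (frontier U))" for k
  \<comment> \<open>A third of the gap between d and n\<alpha>/q: one share for the box count, one
    for the weights, one for strictness.\<close>
  define \<theta> where "\<theta> = (real CARD('n) * \<alpha> / q - d) / 3"
  have "d < real CARD('n) * \<alpha> / q" using q by (simp add: pos_less_divide_eq mult.commute)
  then have \<theta>: "\<theta> > 0" by (simp add: \<theta>_def)
  have "q * ((d + \<theta>) + \<theta>) < q * (d + 3 * \<theta>)" using \<theta> q by (intro mult_strict_left_mono) auto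
  also have "d + 3 * \<theta> = real CARD('n) * \<alpha> / q" unfolding \<theta>_def by (rule trans[OF _ refl]) argo
  also have "q * (real CARD('n) * \<alpha> / q) = real CARD('n) * \<alpha>" using q by simp
  finally have neg: "q * ((d + \<theta>) + \<theta>) < real CARD('n) * \<alpha>" .
  have ev: "\<forall>\<^sub>F k in sequentially. N k \<le> 2 powr ((d + \<theta>) * real k)"
    unfolding N_def by (rule box_dim_eventually[OF dim]) (use \<theta> in simp)
  have N0: "0 \<le> N k" for k by (simp add: N_def)
  note w = degree_weights_summable[OF ev N0 \<theta> q(1) neg]
  obtain M where M: "\<And>u. continuous_on (closure U) u \<Longrightarrow> holder_cub \<alpha> E U u \<Longrightarrow> (\<forall>x\<in>U. norm (u x) \<le> C) \<Longrightarrow>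
     (\<integral>\<^sup>+y. ennreal (\<bar>brouwer_degree u U y\<bar> powr q) \<partial>lborel) \<le> ennreal M"
    using degree_Lq_bound[OF \<alpha> U E q(1) w(1,2) N_def w(3), of C] by blast
  have dna: "d < real CARD('n) * \<alpha>"
  proof -
    have "1 * d \<le> q * d" using q d by (intro mult_right_mono) auto
    with q(2) show ?thesis by simp
  qed
  show ?thesis
  proof (intro exI allI impI)
    fix u :: "real^'n \<Rightarrow> real^'n" assume hb: "hbound \<alpha> C U u" and u: "continuous_on (closure U) u"
    have meas: "(\<lambda>y. \<bar>brouwer_degree u U y\<bar> powr q) \<in> borel_measurable lborel"
      using brouwer_degree_measurable[OF U u] by simp
    have le: "(\<integral>\<^sup>+y. ennreal (\<bar>brouwer_degree u U y\<bar> powr q) \<partial>lborel) \<le> ennreal M"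
    proof (rule M[OF u])
      show "holder_cub \<alpha> E U u" unfolding E_def by (rule hbound_holder_cub[OF hb \<alpha> C])
    qed (use hb in \<open>simp add: hbound_def\<close>)
    also have "\<dots> < \<infinity>" by simp
    finally have fin: "(\<integral>\<^sup>+y. ennreal (\<bar>brouwer_degree u U y\<bar> powr q) \<partial>lborel) < \<infinity>" .
    have int: "integrable lborel (\<lambda>y. \<bar>brouwer_degree u U y\<bar> powr q)"
      using meas fin by (intro integrableI_nonneg) auto
    have "ennreal (LINT y|lborel. \<bar>brouwer_degree u U y\<bar> powr q) \<le> ennreal M"
      using le nn_integral_eq_integral[OF int] by simp
    \<comment> \<open>\<open>ennreal\<close> sends a negative \<open>M\<close> to 0.\<close>
    then have "(LINT y|lborel. \<bar>brouwer_degree u U y\<bar> powr q) \<le> max M 0"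
      by (auto simp: ennreal_le_iff2)
    with int null_image_frontier[OF U(2) dim dna \<alpha> hb u C]
    show "u ` frontier U \<in> null_sets lborel \<and> integrable lborel (\<lambda>y. \<bar>brouwer_degree u U y\<bar> powr q) \<and>
      (LINT y|lborel. \<bar>brouwer_degree u U y\<bar> powr q) \<le> max M 0" by blast
  qed
qed

theorem degree_convergence:
  fixes U :: "(real^'n) set" and u :: "nat \<Rightarrow> real^'n \<Rightarrow> real^'n"
  assumes \<alpha>: "0 < \<alpha>" "\<alpha> < 1" and d: "0 < d" and p: "1 \<le> p" "p < real CARD('n) * \<alpha> / d"
    and U: "open U" "bounded U" and dim: "has_box_dim (frontier U) d" and conv: "tendsto_holder \<alpha> U u w"
  shows "degree_in_Lp p U (cont_ext U (u k))" and "degree_in_Lp p U (cont_ext U w)"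
    and "(\<lambda>k. Lp_norm p (\<lambda>y. brouwer_degree (cont_ext U (u k)) U y
                 - brouwer_degree (cont_ext U w) U y)) \<longlonglongrightarrow> 0"
proof -
  have \<alpha>1: "\<alpha> \<le> 1" using \<alpha> by simp
  obtain C where C: "0 \<le> C" "hbound \<alpha> C U w" "\<And>k. hbound \<alpha> C U (u k)"
    using tendsto_holder_hbound(1)[OF conv] by blast
  let ?u = "\<lambda>k. cont_ext U (u k)" and ?w = "cont_ext U w"
  note ext = cont_ext_props[OF hbound_imp_uniformly_continuous[OF _ \<alpha>(1)]]
  have cu: "continuous_on (closure U) (?u k)" and cw: "continuous_on (closure U) ?w" for k
    using ext(1) C by blast+
  have hu: "hbound \<alpha> C U (?u k)" for k by (rule hbound_cong[OF C(3)]) (simp add: ext(2)[OF C(3)])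
  have hw: "hbound \<alpha> C U ?w" by (rule hbound_cong[OF C(2)]) (simp add: ext(2)[OF C(2)])
  obtain q where q: "p < q" "q < real CARD('n) * \<alpha> / d" using dense[OF p(2)] by blast
  have q1: "1 \<le> q" and qd: "q * d < real CARD('n) * \<alpha>"
    using p q d by (auto simp: pos_less_divide_eq)
  obtain M where M: "\<And>f. hbound \<alpha> C U f \<Longrightarrow> continuous_on (closure U) f \<Longrightarrow>
      f ` frontier U \<in> null_sets lborel \<and> integrable lborel (\<lambda>y. \<bar>brouwer_degree f U y\<bar> powr q) \<and>
      (LINT y|lborel. \<bar>brouwer_degree f U y\<bar> powr q) \<le> M"
    using degree_in_Lp_bound[OF \<alpha>(1) \<alpha>1 U dim d q1 qd C(1)] by blast
  have supp: "y \<in> cub 0 (C + 1)" if "hbound \<alpha> C U f" "continuous_on (closure U) f" "brouwer_degree f U y \<noteq> 0" for f y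
    using hbound_closure[OF that(1,2) \<alpha>(1)] by (intro brouwer_degree_support[OF U that(2) _ that(3)]) (simp add: hbound_def)
  have Lp: "degree_in_Lp p U f" if f: "hbound \<alpha> C U f" "continuous_on (closure U) f" for f
    unfolding degree_in_Lp_def Lp_space_def
    using M[OF f] brouwer_degree_measurable[OF U f(2)] supp[OF f] q
    by (auto intro!: integrable_powr_lower[OF _ p(1), of _ q])
  show "degree_in_Lp p U (?u k)" "degree_in_Lp p U ?w" using Lp hu cu hw cw by auto
  define g where "g k y = brouwer_degree (?u k) U y - brouwer_degree ?w U y" for k y
  have mg: "g k \<in> borel_measurable borel" for k
    unfolding g_def[abs_def] by (intro borel_measurable_diff brouwer_degree_measurable[OF U] cu cw)
  \<comment> \<open>The difference is at most twice the larger of the two degrees. This stands in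
    for the triangle inequality of the norm and is uniform in \<open>k\<close>.\<close>
  have gq: "\<bar>g k y\<bar> powr q \<le> 2 powr q * (\<bar>brouwer_degree (?u k) U y\<bar> powr q + \<bar>brouwer_degree ?w U y\<bar> powr q)" for k y
  proof -
    let ?a = "\<bar>brouwer_degree (?u k) U y\<bar>" and ?b = "\<bar>brouwer_degree ?w U y\<bar>"
    have "\<bar>g k y\<bar> powr q \<le> (2 * max ?a ?b) powr q"
      using q1 by (intro powr_mono2) (auto simp: g_def)
    also have "\<dots> = 2 powr q * max ?a ?b powr q" by (simp add: powr_mult)
    also have "\<dots> \<le> 2 powr q * (?a powr q + ?b powr q)" by (auto simp: max_def)
    finally show ?thesis .
  qed
  have bint: "integrable lborel (\<lambda>y. 2 powr q * (\<bar>brouwer_degree (?u k) U y\<bar> powr q + \<bar>brouwer_degree ?w U y\<bar> powr q))" for k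
    using M[OF hu cu] M[OF hw cw] by (intro integrable_mult_right Bochner_Integration.integrable_add) auto
  have gint: "integrable lborel (\<lambda>y. \<bar>g k y\<bar> powr q)" for k
    by (rule Bochner_Integration.integrable_bound[OF bint[of k]]) (use mg[of k] gq[of k] in auto)
  have gQ: "(LINT y|lborel. \<bar>g k y\<bar> powr q) \<le> 2 powr q * (M + M)" for k
  proof -
    have "(LINT y|lborel. \<bar>g k y\<bar> powr q) \<le> (LINT y|lborel. 2 powr q * (\<bar>brouwer_degree (?u k) U y\<bar> powr q + \<bar>brouwer_degree ?w U y\<bar> powr q))"
      by (intro integral_mono gint bint gq)
    also have "\<dots> = 2 powr q * ((LINT y|lborel. \<bar>brouwer_degree (?u k) U y\<bar> powr q) + (LINT y|lborel. \<bar>brouwer_degree ?w U y\<bar> powr q))"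
      using M[OF hu cu, of k] M[OF hw cw] by (simp add: Bochner_Integration.integral_add)
    also have "\<dots> \<le> 2 powr q * (M + M)" using M[OF hu cu, of k] M[OF hw cw] by (intro mult_left_mono add_mono) auto
    finally show ?thesis .
  qed
  \<comment> \<open>A point off the image of the frontier under the limit map has positive distance
    from it, so uniform convergence fixes the degree there for large \<open>k\<close>.\<close>
  have ev: "AE y in lborel. \<forall>\<^sub>F k in sequentially. g k y = 0"
  proof (rule AE_I')
    show "?w ` frontier U \<in> null_sets lborel" using M[OF hw cw] by blast
    show "{y \<in> space lborel. \<not> (\<forall>\<^sub>F k in sequentially. g k y = 0)} \<subseteq> ?w ` frontier U"
    proof (rule ccontr)
      assume "\<not> ?thesis"
      then obtain y where y: "\<not> (\<forall>\<^sub>F k in sequentially. g k y = 0)" "y \<notin> ?w ` frontier U" by blast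
      obtain \<delta> where \<delta>: "\<delta> > 0" "\<forall>x\<in>frontier U. \<exists>i. 2 * \<delta> < \<bar>?w x $ i - y $ i\<bar>"
        using uniformly_far_point[OF compact_image_frontier[OF U(2) cw] y(2)] by blast
      have "\<forall>\<^sub>F k in sequentially. \<forall>x\<in>U. norm (u k x - w x) \<le> \<delta> / 4"
        using \<delta>(1) by (intro tendsto_holder_hbound(2)[OF conv]) simp
      then have "\<forall>\<^sub>F k in sequentially. g k y = 0"
      proof eventually_elim
        case (elim k)
        have "norm (?u k x - ?w x) \<le> \<delta> / 4" if "x \<in> closure U" for x
        proof (rule continuous_on_closure_norm_le[OF _ _ that])
          show "continuous_on (closure U) (\<lambda>x. ?u k x - ?w x)" by (intro continuous_on_diff cu cw)
          show "\<forall>x\<in>U. norm (?u k x - ?w x) \<le> \<delta> / 4" using elim ext(2)[OF C(2)] ext(2)[OF C(3)] by simp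
        qed
        then have "\<bar>?u k x $ i - ?w x $ i\<bar> \<le> \<delta> / 4" if "x \<in> closure U" for x i
          using component_le_norm_cart[of "?u k x - ?w x" i] that by fastforce
        then have "brouwer_degree (?u k) U y = brouwer_degree ?w U y"
          using \<delta>(1) by (intro brouwer_degree_near[OF U cw cu \<delta>]) (auto intro: cub_self)
        then show ?case by (simp add: g_def)
      qed
      with y(1) show False by blast
    qed
  qed
  have gsupp: "y \<in> cub 0 (C + 1)" if "g k y \<noteq> 0" for k y
  proof -
    have "brouwer_degree (?u k) U y \<noteq> 0 \<or> brouwer_degree ?w U y \<noteq> 0" using that by (auto simp: g_def)
    then show ?thesis using supp[OF hu cu] supp[OF hw cw] by blast
  qed
  have "(\<lambda>k. LINT y|lborel. \<bar>g k y\<bar> powr p) \<longlonglongrightarrow> 0"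
    by (rule Lp_convergence[OF p(1) q(1) mg gsupp ev gint gQ])
  then have "(\<lambda>k. (LINT y|lborel. \<bar>g k y\<bar> powr p) powr (1 / p)) \<longlonglongrightarrow> 0 powr (1 / p)"
    using p(1) by (intro tendsto_powr' tendsto_const) auto
  then show "(\<lambda>k. Lp_norm p (\<lambda>y. brouwer_degree (?u k) U y - brouwer_degree ?w U y)) \<longlonglongrightarrow> 0"
    by (simp add: Lp_norm_def g_def)
qed

section \<open>A domain with prescribed box dimension of the frontier\<close>

definition ocub :: "real^'n \<Rightarrow> real \<Rightarrow> (real^'n) set" where
  "ocub x r = {z. \<forall>i. \<bar>z $ i - x $ i\<bar> < r}"

lemma ocub_eq_box: "ocub x r = box (\<chi> i. x $ i - r) (\<chi> i. x $ i + r)"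
  by (auto simp: set_eq_iff ocub_def mem_box_cart abs_diff_less_iff)

lemma open_ocub: "open (ocub x r)"
  by (simp add: ocub_eq_box open_box)

lemma ocub_subset_cub: "ocub x r \<subseteq> cub x r"
  by (auto simp: ocub_def cub_def less_imp_le)

lemma cub_subset_ocub: "r < s \<Longrightarrow> cub x r \<subseteq> ocub x s"
  by (auto simp: ocub_def cub_def intro: le_less_trans)

lemma closed_cub: "closed (cub x r)"
  unfolding cub_eq_cbox by (rule closed_cbox)

lemma closure_ocub: "0 < r \<Longrightarrow> closure (ocub x r) = cub x r"
proof -
  assume r: "0 < r"
  then have "x \<in> ocub x r" by (simp add: ocub_def)
  then have "box (\<chi> i. x $ i - r) (\<chi> i. x $ i + r) \<noteq> {}" by (auto simp: ocub_eq_box)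
  then show ?thesis by (simp add: ocub_eq_box cub_eq_cbox closure_box)
qed

lemma measure_ocub: "0 < r \<Longrightarrow> measure lborel (ocub x r) = (2 * r) ^ CARD('n)"
  for x :: "real^'n"
  using measure_cub[of r x] measure_lborel_box_eq[of "\<chi> i. x $ i - r" "\<chi> i. x $ i + r"]
    measure_lborel_cbox_eq[of "\<chi> i. x $ i - r" "\<chi> i. x $ i + r"]
  by (simp add: ocub_eq_box cub_eq_cbox)

lemma ocub_scale:
  fixes x c :: "real^'n"
  assumes "t > 0"
  shows "t *\<^sub>R (x - c) \<in> ocub 0 (t * r) \<longleftrightarrow> x \<in> ocub c r"
proof -
  have "\<bar>t * (x $ i - c $ i)\<bar> < t * r \<longleftrightarrow> \<bar>x $ i - c $ i\<bar> < r" for i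
    using assms by (simp add: abs_mult)
  then show ?thesis by (simp add: ocub_def)
qed

text \<open>Directional derivatives of locally affine maps are locally constant, hence again locally
  affine: an invariant class for \<open>smooth_onI\<close>.\<close>

lemma smooth_on_locally_affine:
  fixes f :: "'a::real_normed_vector \<Rightarrow> 'b::real_normed_vector"
  assumes "\<And>x. x \<in> W \<Longrightarrow> \<exists>e>0. \<exists>A c. bounded_linear A \<and> (\<forall>z\<in>ball x e. f z = A z + c)"
  shows "smooth_on f W"
proof (rule smooth_onI[where C="{f. \<forall>x\<in>W. \<exists>e>0. \<exists>A c. bounded_linear A \<and> (\<forall>z\<in>ball x e. f z = A z + c)}"])
  have der: "(f has_derivative A) (at y)"
    if "bounded_linear A" "\<forall>z\<in>ball x e. f z = A z + c" "y \<in> ball x e" for f :: "'a \<Rightarrow> 'b" and A c x y e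
  proof (rule has_derivative_transform_within_open[OF _ open_ball that(3)])
    show "((\<lambda>z. A z + c) has_derivative A) (at y)"
      using has_derivative_add_const[OF bounded_linear_imp_has_derivative[OF that(1)]] .
  qed (use that in simp)
  fix f :: "'a \<Rightarrow> 'b" assume f: "f \<in> {f. \<forall>x\<in>W. \<exists>e>0. \<exists>A c. bounded_linear A \<and> (\<forall>z\<in>ball x e. f z = A z + c)}"
  show "f differentiable (at x)" if "x \<in> W" for x
  proof -
    obtain e A c where e: "e > 0" "bounded_linear A" "\<forall>z\<in>ball x e. f z = A z + c" using f \<open>x \<in> W\<close> by blast
    from der[OF e(2,3), of x] e(1) show ?thesis by (auto simp: differentiable_def)
  qed
  fix h
  show "(\<lambda>x. frechet_derivative f (at x) h) \<in> {f. \<forall>x\<in>W. \<exists>e>0. \<exists>A c. bounded_linear A \<and> (\<forall>z\<in>ball x e. f z = A z + c)}"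
  proof (clarify)
    fix x assume "x \<in> W"
    then obtain e A c where e: "e > 0" "bounded_linear A" "\<forall>z\<in>ball x e. f z = A z + c" using f by blast
    have "frechet_derivative f (at z) h = A h" if "z \<in> ball x e" for z
      using frechet_derivative_at[OF der[OF e(2,3) that]] by simp
    with e(1) show "\<exists>e>0. \<exists>A c. bounded_linear A \<and> (\<forall>z\<in>ball x e. frechet_derivative f (at z) h = A z + c)"
      by (intro exI[of _ e] conjI exI[of _ "\<lambda>_. 0"] exI[of _ "A h"]) auto
  qed
qed (use assms in blast)

lemma integral_affine:
  fixes f :: "real^'n \<Rightarrow> real"
  assumes "f \<in> borel_measurable borel" "t > 0"
  shows "(LINT x|lborel. f (t *\<^sub>R (x - c)) * t ^ CARD('n)) = (LINT x|lborel. f x)"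
proof -
  have T: "(\<lambda>x. - (t *\<^sub>R c) + t *\<^sub>R x) \<in> borel_measurable borel"
    by (intro borel_measurable_continuous_onI continuous_intros)
  have "(LINT x|lborel. f x) = (LINT x|density (distr lborel borel (\<lambda>x. - (t *\<^sub>R c) + t *\<^sub>R x)) (\<lambda>_. ennreal (\<bar>t\<bar> ^ CARD('n))). f x)"
    using lborel_affine[of t "- (t *\<^sub>R c)"] assms(2) by simp
  also have "\<dots> = (LINT x|distr lborel borel (\<lambda>x. - (t *\<^sub>R c) + t *\<^sub>R x). \<bar>t\<bar> ^ CARD('n) * f x)"
    using assms by (subst integral_density) auto
  also have "\<dots> = (LINT x|lborel. \<bar>t\<bar> ^ CARD('n) * f (- (t *\<^sub>R c) + t *\<^sub>R x))"
    using assms T by (subst integral_distr) auto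
  finally show ?thesis using assms(2) by (simp add: scaleR_diff_right mult.commute)
qed

lemma sphere_cub_null: "cub x r - ocub x r \<in> null_sets lborel"
proof -
  have "negligible (cub x r - ocub x r)"
    unfolding cub_eq_cbox ocub_eq_box by (rule negligible_frontier_interval)
  then have "cub x r - ocub x r \<in> null_sets (completion lborel)" by (simp add: negligible_iff_null_sets)
  moreover have "cub x r - ocub x r \<in> sets lborel"
    using open_ocub[of x r] by (simp add: borel_open sets.Diff)
  ultimately show ?thesis by (simp add: null_sets_completion_iff)
qed

text \<open>
  Level \<open>k\<close> consists of \<open>L k * (2 ^ k) ^ (n - 1)\<close> cells of side \<open>r k = 2\<^sup>-\<^sup>k\<close> with centres \<open>c k a\<close>,
  filling a layer over the unit cube of dimension \<open>n - 1\<close> which starts at height \<open>s k\<close> in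
  direction \<open>i0\<close>; with \<open>L k\<close> about \<open>2\<^sup>\<gamma>\<^sup>k\<close> the layers have finite total height. Each cell
  contributes to \<open>U\<close> the concentric open cube of half its side.
\<close>

locale cube_layers =
  fixes i0 :: "'n::finite" and \<gamma> :: real
  assumes \<gamma>: "0 < \<gamma>" "\<gamma> < 1"
begin

definition r :: "nat \<Rightarrow> real" where "r k = (1/2) ^ k"

definition L :: "nat \<Rightarrow> nat" where "L k = nat \<lceil>2 powr (\<gamma> * real k)\<rceil>"

definition s :: "nat \<Rightarrow> real" where "s k = (\<Sum>j<k. real (L j) * r j)"

definition I :: "nat \<Rightarrow> ('n \<Rightarrow> nat) set" where
  "I k = PiE UNIV (\<lambda>i. {..< if i = i0 then L k else 2 ^ k})"

definition c :: "nat \<Rightarrow> ('n \<Rightarrow> nat) \<Rightarrow> real^'n" where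
  "c k a = (\<chi> i. (if i = i0 then s k else 0) + r k * (real (a i) + 1/2))"

definition U :: "(real^'n) set" where
  "U = (\<Union>k. \<Union>a\<in>I k. ocub (c k a) (r k / 4))"

lemma r_pos [simp]: "0 < r k" by (simp add: r_def)

lemma r_nonneg [simp]: "0 \<le> r k" by (simp add: r_def)

lemma finite_I: "finite (I k)" unfolding I_def by (rule finite_PiE) auto

lemma card_I: "card (I k) = L k * (2 ^ k) ^ (CARD('n) - 1)"
proof -
  have "card (I k) = (\<Prod>i\<in>UNIV. if i = i0 then L k else 2 ^ k)"
    unfolding I_def by (subst card_PiE) auto
  also have "\<dots> = L k * (\<Prod>i\<in>UNIV - {i0}. if i = i0 then L k else 2 ^ k)"
    by (subst prod.remove[of _ i0]) auto
  also have "(\<Prod>i\<in>UNIV - {i0}. if i = i0 then L k else 2 ^ k) = (\<Prod>i\<in>UNIV - {i0}. 2 ^ k)"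
    by (rule prod.cong) auto
  finally show ?thesis by (simp add: card_Diff_singleton)
qed

lemma L_bounds: "2 powr (\<gamma> * real k) \<le> real (L k)" "real (L k) \<le> 2 * 2 powr (\<gamma> * real k)"
proof -
  have 1: "1 \<le> 2 powr (\<gamma> * real k)" using \<gamma> by (intro ge_one_powr_ge_zero) auto
  then have L: "real (L k) = of_int \<lceil>2 powr (\<gamma> * real k)\<rceil>" by (simp add: L_def)
  show "2 powr (\<gamma> * real k) \<le> real (L k)" unfolding L by linarith
  show "real (L k) \<le> 2 * 2 powr (\<gamma> * real k)" unfolding L using 1 by linarith
qed

lemma s_mono: "j \<le> k \<Longrightarrow> s j \<le> s k"
  unfolding s_def by (intro sum_mono2) auto

lemma s_Suc: "s (Suc k) = s k + real (L k) * r k"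
  by (simp add: s_def)

lemma separation_less:
  assumes "a \<in> I k" "k < j"
  shows "(r k + r j) / 2 \<le> c j b $ i0 - c k a $ i0"
proof -
  have a: "real (a i0) + 1 \<le> real (L k)" using assms(1) by (auto simp: I_def PiE_iff dest!: spec[of _ i0])
  have "s (Suc k) \<le> s j" using assms(2) by (intro s_mono) simp
  then have "s k + (real (a i0) + 1) * r k \<le> s j"
  proof -
    have "(real (a i0) + 1) * r k \<le> real (L k) * r k" by (intro mult_right_mono a) simp
    with \<open>s (Suc k) \<le> s j\<close> show ?thesis unfolding s_Suc by linarith
  qed
  moreover have "0 \<le> r j * real (b i0)" by simp
  moreover have "c j b $ i0 = s j + r j * real (b i0) + r j / 2" "c k a $ i0 = s k + r k * real (a i0) + r k / 2"
    by (simp_all add: c_def distrib_left)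
  moreover have "(real (a i0) + 1) * r k = r k * real (a i0) + r k" by (simp add: algebra_simps)
  ultimately show ?thesis unfolding add_divide_distrib by linarith
qed

text \<open>Half the sum of the sides is the distance of the centres, in the maximum norm, at which
  two cells have disjoint interiors. Different levels are separated in the stacking direction
  \<open>i0\<close>, cells of one level by the integer grid.\<close>

lemma separation:
  assumes "a \<in> I k" "b \<in> I j" "(k, a) \<noteq> (j, b)"
  shows "\<exists>i. (r k + r j) / 2 \<le> \<bar>c k a $ i - c j b $ i\<bar>"
proof -
  consider "k < j" | "j < k" | "k = j" "a \<noteq> b" using assms(3) by force
  then show ?thesis
  proof cases
    case 1
    show ?thesis using separation_less[OF assms(1) 1, of b] by (intro exI[of _ i0]) argo
  next
    case 2
    show ?thesis using separation_less[OF assms(2) 2, of a] by (intro exI[of _ i0]) argo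
  next
    case 3
    then obtain i where i: "a i \<noteq> b i" by blast
    have "c k a $ i - c j b $ i = r k * (real (a i) - real (b i))"
      using 3 by (simp add: c_def right_diff_distrib distrib_left)
    then have "\<bar>c k a $ i - c j b $ i\<bar> = r k * \<bar>real (a i) - real (b i)\<bar>"
      by (simp add: abs_mult)
    moreover have "1 \<le> \<bar>real (a i) - real (b i)\<bar>" using i by (cases "a i < b i") auto
    then have "r k * 1 \<le> r k * \<bar>real (a i) - real (b i)\<bar>" by (intro mult_left_mono) auto
    ultimately show ?thesis using 3 by (intro exI[of _ i]) simp
  qed
qed

text \<open>The cubes have half the side of their cells, so half of the distance between the centres
  remains as a gap. The Hoelder estimate across different cubes relies on it.\<close>

lemma cells_apart:
  assumes "a \<in> I k" "b \<in> I j" "(k, a) \<noteq> (j, b)" "x \<in> cub (c k a) (r k / 4)" "z \<in> cub (c j b) (r j / 4)"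
  shows "\<exists>i. (r k + r j) / 4 \<le> \<bar>x $ i - z $ i\<bar>"
proof -
  obtain i where i: "(r k + r j) / 2 \<le> \<bar>c k a $ i - c j b $ i\<bar>" using separation[OF assms(1-3)] by blast
  have "\<bar>x $ i - c k a $ i\<bar> \<le> r k / 4" "\<bar>z $ i - c j b $ i\<bar> \<le> r j / 4"
    using assms(4,5) by (auto simp: cub_def)
  with i show ?thesis by (intro exI[of _ i]) argo
qed

lemma cells_disjoint:
  assumes "a \<in> I k" "b \<in> I j" "x \<in> ocub (c k a) (r k / 2)" "x \<in> ocub (c j b) (r j / 2)"
  shows "k = j \<and> a = b"
proof (rule ccontr)
  assume "\<not> ?thesis"
  then obtain i where i: "(r k + r j) / 2 \<le> \<bar>c k a $ i - c j b $ i\<bar>" using separation[OF assms(1,2)] by blast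
  have "\<bar>x $ i - c k a $ i\<bar> < r k / 2" "\<bar>x $ i - c j b $ i\<bar> < r j / 2"
    using assms(3,4) by (auto simp: ocub_def)
  with i show False by argo
qed

lemma ocub_mono: "p \<le> q \<Longrightarrow> ocub x p \<subseteq> ocub x q"
  by (auto simp: ocub_def intro: less_le_trans)

lemma open_U: "open U"
  unfolding U_def by (intro open_UN ballI open_ocub)

lemma U_cell: "a \<in> I k \<Longrightarrow> ocub (c k a) (r k / 4) \<subseteq> U"
  unfolding U_def by blast

lemma U_in_cell:
  assumes "a \<in> I k"
  shows "U \<inter> ocub (c k a) (r k / 2) \<subseteq> ocub (c k a) (r k / 4)"
proof
  fix x assume x: "x \<in> U \<inter> ocub (c k a) (r k / 2)"
  then obtain j b where b: "b \<in> I j" "x \<in> ocub (c j b) (r j / 4)" by (auto simp: U_def)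
  then have "x \<in> ocub (c j b) (r j / 2)" using ocub_mono[of "r j / 4" "r j / 2" "c j b"] r_pos[of j] by auto
  with cells_disjoint[OF assms b(1)] x b(2) show "x \<in> ocub (c k a) (r k / 4)" by blast
qed

lemma closure_in_cell:
  assumes "a \<in> I k"
  shows "closure U \<inter> ocub (c k a) (r k / 2) \<subseteq> cub (c k a) (r k / 4)"
proof -
  have "closure U \<inter> ocub (c k a) (r k / 2) \<subseteq> closure (U \<inter> ocub (c k a) (r k / 2))"
    using open_Int_closure_subset[OF open_ocub, of "c k a" "r k / 2" U] by (simp add: Int_commute)
  also have "\<dots> \<subseteq> closure (ocub (c k a) (r k / 4))" by (rule closure_mono[OF U_in_cell[OF assms]])
  also have "\<dots> = cub (c k a) (r k / 4)" by (rule closure_ocub) simp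
  finally show ?thesis .
qed

lemma frontier_in_cell:
  assumes "a \<in> I k"
  shows "frontier U \<inter> ocub (c k a) (r k / 2) = cub (c k a) (r k / 4) - ocub (c k a) (r k / 4)"
proof (intro equalityI subsetI)
  fix x assume x: "x \<in> frontier U \<inter> ocub (c k a) (r k / 2)"
  then have "x \<in> closure U" "x \<notin> U" using open_U by (auto simp: frontier_def interior_open)
  with x closure_in_cell[OF assms] U_cell[OF assms]
  show "x \<in> cub (c k a) (r k / 4) - ocub (c k a) (r k / 4)" by blast
next
  fix x assume x: "x \<in> cub (c k a) (r k / 4) - ocub (c k a) (r k / 4)"
  have x2: "x \<in> ocub (c k a) (r k / 2)" using x cub_subset_ocub[of "r k / 4" "r k / 2" "c k a"] r_pos[of k] by auto
  have "x \<in> closure (ocub (c k a) (r k / 4))" using x closure_ocub[of "r k / 4" "c k a"] by simp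
  then have "x \<in> closure U" using closure_mono[OF U_cell[OF assms]] by blast
  moreover have "x \<notin> U" using U_in_cell[OF assms] x x2 by blast
  ultimately show "x \<in> frontier U \<inter> ocub (c k a) (r k / 2)"
    using x2 open_U by (simp add: frontier_def interior_open)
qed

text \<open>
  An upper bound for the total height of the layers from \<open>k\<close> on, from a geometric series.
\<close>

definition tail :: "nat \<Rightarrow> real" where "tail k = 2 * (2 powr (\<gamma> - 1)) ^ k / (1 - 2 powr (\<gamma> - 1))"

lemma ratio: "0 < 2 powr (\<gamma> - 1)" "2 powr (\<gamma> - 1) < 1"
  using \<gamma> powr_less_mono[of "\<gamma> - 1" 0 2] by auto

lemma L_r: "real (L k) * r k \<le> 2 * (2 powr (\<gamma> - 1)) ^ k"
proof -
  have "real (L k) * r k \<le> (2 * 2 powr (\<gamma> * real k)) * r k"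
    using L_bounds(2) by (intro mult_right_mono) (auto intro: less_imp_le[OF r_pos])
  also have "\<dots> = 2 * 2 powr (\<gamma> * real k) * 2 powr (- real k)"
    by (simp add: r_def powr_minus powr_realpow power_one_over inverse_eq_divide)
  also have "\<dots> = 2 * (2 powr (\<gamma> - 1)) ^ k"
    by (simp add: powr_powr algebra_simps flip: powr_realpow powr_add)
  finally show ?thesis .
qed

lemma s_tail: "s (k + m) - s k \<le> tail k"
proof -
  let ?q = "2 powr (\<gamma> - 1)"
  \<comment> \<open>The explicit partial sum of the geometric series, instead of its limit, is what
    the induction on \<open>m\<close> can carry along.\<close>
  have "s (k + m) - s k \<le> 2 * ?q ^ k * (1 - ?q ^ m) / (1 - ?q)"
  proof (induction m)
    case (Suc m)
    have "s (k + Suc m) - s k \<le> 2 * ?q ^ k * (1 - ?q ^ m) / (1 - ?q) + 2 * ?q ^ (k + m)"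
      using Suc L_r[of "k + m"] by (simp add: s_Suc)
    also have "\<dots> = 2 * ?q ^ k * (1 - ?q ^ Suc m) / (1 - ?q)"
    proof -
      have "A * (1 - B) / (1 - q) + A * B = A * (1 - q * B) / (1 - q)" if "q < 1" for A B q :: real
        using that by (simp add: field_simps)
      from this[OF ratio(2), of "2 * ?q ^ k" "?q ^ m"] show ?thesis by (simp add: power_add mult_ac)
    qed
    finally show ?case .
  qed simp
  also have "\<dots> \<le> 2 * ?q ^ k * 1 / (1 - ?q)"
    using ratio by (intro divide_right_mono mult_left_mono) auto
  finally show ?thesis by (simp add: tail_def)
qed

lemma cell_range:
  assumes "a \<in> I k" "x \<in> cub (c k a) (r k / 4)" "m \<le> k"
  shows "i \<noteq> i0 \<Longrightarrow> 0 \<le> x $ i \<and> x $ i \<le> 1" and "s m \<le> x $ i0 \<and> x $ i0 \<le> s m + tail m"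
proof -
  have x: "\<bar>x $ i - c k a $ i\<bar> \<le> r k / 4" for i using assms(2) by (simp add: cub_def)
  have rk: "0 < r k" by simp
  {
    assume i: "i \<noteq> i0"
    have "a i < 2 ^ k" using assms(1) i by (auto simp: I_def PiE_iff dest!: spec[of _ i])
    then have "real (a i) + 1 \<le> 2 ^ k" by (metis Suc_leI of_nat_1 of_nat_Suc of_nat_le_iff of_nat_numeral of_nat_power add.commute)
    then have "r k * (real (a i) + 1) \<le> r k * 2 ^ k" by (intro mult_left_mono) auto
    also have "\<dots> = 1" by (simp add: r_def power_one_over)
    finally have "r k * real (a i) + r k \<le> 1" by (simp add: distrib_left)
    moreover have "0 \<le> r k * real (a i)" using rk by simp
    moreover have "c k a $ i = r k * real (a i) + r k / 2" using i by (simp add: c_def distrib_left)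
    ultimately show "0 \<le> x $ i \<and> x $ i \<le> 1" using x[of i] rk by argo
  }
  have "real (a i0) + 1 \<le> real (L k)" using assms(1) by (auto simp: I_def PiE_iff dest!: spec[of _ i0])
  then have "r k * (real (a i0) + 1) \<le> r k * real (L k)" by (intro mult_left_mono) auto
  then have 1: "r k * real (a i0) + r k \<le> s (Suc k) - s k" by (simp add: s_Suc distrib_left mult.commute)
  have 2: "s (Suc k) - s m \<le> tail m" using s_tail[of m "Suc k - m"] assms(3) by simp
  have 3: "0 \<le> r k * real (a i0)" using rk by simp
  have 4: "c k a $ i0 = s k + r k * real (a i0) + r k / 2" by (simp add: c_def distrib_left)
  show "s m \<le> x $ i0 \<and> x $ i0 \<le> s m + tail m"
    using x[of i0] rk 1 2 3 4 s_mono[OF assms(3)] by argo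
qed

lemma bounded_U: "bounded U"
proof -
  have "U \<subseteq> cub 0 (1 + tail 0)"
  proof
    fix x assume "x \<in> U"
    then obtain k a where a: "a \<in> I k" "x \<in> ocub (c k a) (r k / 4)" by (auto simp: U_def)
    then have x: "x \<in> cub (c k a) (r k / 4)" using ocub_subset_cub by blast
    have t0: "0 \<le> tail 0" using s_tail[of 0 0] by simp
    have "\<bar>x $ i\<bar> \<le> 1 + tail 0" for i
    proof (cases "i = i0")
      case True
      then show ?thesis using cell_range(2)[OF a(1) x, of 0] t0 by (simp add: s_def)
    next
      case False
      then show ?thesis using cell_range(1)[OF a(1) x, of 0 i] t0 by simp
    qed
    then show "x \<in> cub 0 (1 + tail 0)" by (simp add: cub_def)
  qed
  then show ?thesis using bounded_cub bounded_subset by blast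
qed

end

section \<open>Covering bounds and the box dimension of the frontier\<close>

text \<open>Constant factors disappear after division by \<open>- ln \<rho>\<close>, which tends to
  infinity.\<close>

lemma has_box_dimI:
  fixes F :: "'a::euclidean_space set"
  assumes AB: "0 < A" "0 < B"
    and bounds: "\<And>\<rho>. 0 < \<rho> \<Longrightarrow> \<rho> < 1 \<Longrightarrow> A * (1 / \<rho>) powr d \<le> real (box_number \<rho> F) \<and> real (box_number \<rho> F) \<le> B * (1 / \<rho>) powr d"
  shows "has_box_dim F d"
proof -
  have z: "((\<lambda>\<rho>. K / (- ln \<rho>)) \<longlongrightarrow> 0) (at_right 0)" for K :: real
  proof (rule tendsto_divide_0[OF tendsto_const])
    have "filterlim (\<lambda>\<rho>::real. - ln \<rho>) at_top (at_right 0)"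
      using ln_at_0 by (simp add: filterlim_uminus_at_top)
    then show "filterlim (\<lambda>\<rho>::real. - ln \<rho>) at_infinity (at_right 0)" by (rule filterlim_at_top_imp_at_infinity)
  qed
  have lim: "((\<lambda>\<rho>. K / (- ln \<rho>) + d) \<longlongrightarrow> d) (at_right 0)" for K :: real
    using tendsto_add[OF z[of K] tendsto_const[of d]] by simp
  have ev: "\<forall>\<^sub>F \<rho> in at_right (0::real). 0 < \<rho> \<and> \<rho> < 1"
    by (auto simp: eventually_at_right_field intro: exI[of _ 1])
  have expand: "ln (K * (1 / \<rho>) powr d) / (- ln \<rho>) = ln K / (- ln \<rho>) + d" if "0 < K" "0 < \<rho>" "\<rho> < 1" for K \<rho> :: real
  proof -
    have "ln \<rho> \<noteq> 0" using that by simp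
    moreover have "ln (K * (1 / \<rho>) powr d) = ln K + d * (- ln \<rho>)"
      using that by (simp add: ln_mult ln_powr ln_div)
    ultimately show ?thesis by (simp add: diff_divide_distrib)
  qed
  show ?thesis unfolding has_box_dim_def
  proof (rule tendsto_sandwich[OF _ _ lim[of "ln A"] lim[of "ln B"]])
    show "\<forall>\<^sub>F \<rho> in at_right 0. ln A / (- ln \<rho>) + d \<le> ln (real (box_number \<rho> F)) / (- ln \<rho>)"
      using ev
    proof eventually_elim
      case (elim \<rho>)
      have "0 < A * (1 / \<rho>) powr d" using AB elim by simp
      then have "ln (A * (1 / \<rho>) powr d) \<le> ln (real (box_number \<rho> F))" using bounds[of \<rho>] elim by (subst ln_le_cancel_iff) auto
      then have "ln (A * (1 / \<rho>) powr d) / (- ln \<rho>) \<le> ln (real (box_number \<rho> F)) / (- ln \<rho>)"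
        using elim by (intro divide_right_mono) auto
      then show ?case using expand[of A \<rho>] AB elim by simp
    qed
    show "\<forall>\<^sub>F \<rho> in at_right 0. ln (real (box_number \<rho> F)) / (- ln \<rho>) \<le> ln B / (- ln \<rho>) + d"
      using ev
    proof eventually_elim
      case (elim \<rho>)
      have "0 < A * (1 / \<rho>) powr d" using AB elim by simp
      then have "0 < real (box_number \<rho> F)" using bounds[of \<rho>] elim by linarith
      then have "ln (real (box_number \<rho> F)) \<le> ln (B * (1 / \<rho>) powr d)" using bounds[of \<rho>] elim by (subst ln_le_cancel_iff) auto
      then have "ln (real (box_number \<rho> F)) / (- ln \<rho>) \<le> ln (B * (1 / \<rho>) powr d) / (- ln \<rho>)"
        using elim by (intro divide_right_mono) auto
      then show ?case using expand[of B \<rho>] AB elim by simp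
    qed
  qed
qed

text \<open>A real upper bound for the number of boxes instead of the exact minimum, so that bounds
  for unions simply add up.\<close>

definition covered :: "(real^'n) set \<Rightarrow> real \<Rightarrow> real \<Rightarrow> bool" where
  "covered E \<rho> N \<longleftrightarrow> (\<exists>A. finite A \<and> real (card A) \<le> N \<and> E \<subseteq> (\<Union>a\<in>A. cbox a (a + \<rho> *\<^sub>R One)))"

lemma covered_imp_box_number: "covered E \<rho> N \<Longrightarrow> real (box_number \<rho> E) \<le> N"
proof -
  assume "covered E \<rho> N"
  then obtain A where A: "finite A" "real (card A) \<le> N" "E \<subseteq> (\<Union>a\<in>A. cbox a (a + \<rho> *\<^sub>R One))"
    unfolding covered_def by blast
  then have "box_number \<rho> E \<le> card A" by (intro box_number_le)
  with A(2) show ?thesis by linarith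
qed

lemma covered_mono: "covered E \<rho> N \<Longrightarrow> E' \<subseteq> E \<Longrightarrow> N \<le> N' \<Longrightarrow> covered E' \<rho> N'"
  unfolding covered_def by (meson order_trans)

lemma covered_Un:
  assumes "covered E \<rho> M" "covered F \<rho> N"
  shows "covered (E \<union> F) \<rho> (M + N)"
proof -
  obtain A B where A: "finite A" "real (card A) \<le> M" "E \<subseteq> (\<Union>a\<in>A. cbox a (a + \<rho> *\<^sub>R One))"
    and B: "finite B" "real (card B) \<le> N" "F \<subseteq> (\<Union>a\<in>B. cbox a (a + \<rho> *\<^sub>R One))"
    using assms unfolding covered_def by auto
  have "real (card (A \<union> B)) \<le> M + N"
    using card_Un_le[of A B] A(2) B(2) by linarith
  with A B show ?thesis unfolding covered_def by (intro exI[of _ "A \<union> B"]) auto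
qed

lemma covered_UN:
  assumes "finite J" "\<And>j. j \<in> J \<Longrightarrow> covered (E j) \<rho> (N j)"
  shows "covered (\<Union>j\<in>J. E j) \<rho> (\<Sum>j\<in>J. N j)"
  using assms
proof (induction J rule: finite_induct)
  case empty
  show ?case unfolding covered_def by (intro exI[of _ "{}"]) simp
next
  case (insert j J)
  then show ?case using covered_Un[of "E j" \<rho> "N j" "\<Union>j\<in>J. E j" "\<Sum>j\<in>J. N j"] by simp
qed

lemma covered_box:
  fixes l b :: "'n::finite \<Rightarrow> real"
  assumes "\<rho> > 0" "\<And>i. l i \<le> b i" "\<And>i. (b i - l i) / \<rho> + 1 \<le> M i"
  shows "covered {x::real^'n. \<forall>i. l i \<le> x $ i \<and> x $ i \<le> b i} \<rho> (\<Prod>i\<in>UNIV. M i)"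
proof -
  obtain A where A: "finite A" "card A \<le> (\<Prod>i\<in>UNIV. nat \<lfloor>(b i - l i) / \<rho>\<rfloor> + 1)"
     "{x::real^'n. \<forall>i. l i \<le> x $ i \<and> x $ i \<le> b i} \<subseteq> (\<Union>a\<in>A. cbox a (a + \<rho> *\<^sub>R One))"
    using grid_cover[of \<rho> l b] assms by blast
  have "real (card A) \<le> real (\<Prod>i\<in>UNIV. nat \<lfloor>(b i - l i) / \<rho>\<rfloor> + 1)" using A(2) by (rule of_nat_mono)
  also have "\<dots> = (\<Prod>i\<in>UNIV. real (nat \<lfloor>(b i - l i) / \<rho>\<rfloor> + 1))" by simp
  also have "\<dots> \<le> (\<Prod>i\<in>UNIV. M i)"
  proof (rule prod_mono)
    fix i
    have "0 \<le> (b i - l i) / \<rho>" using assms(1,2) by simp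
    then have "real (nat \<lfloor>(b i - l i) / \<rho>\<rfloor> + 1) \<le> (b i - l i) / \<rho> + 1" by linarith
    with assms(3)[of i] show "0 \<le> real (nat \<lfloor>(b i - l i) / \<rho>\<rfloor> + 1) \<and> real (nat \<lfloor>(b i - l i) / \<rho>\<rfloor> + 1) \<le> M i" by simp
  qed
  finally show ?thesis using A unfolding covered_def by blast
qed

text \<open>The boundary of a cube is the union of its 2n faces. A face is flat in one coordinate,
  where one box suffices, and takes up to \<open>M\<close> boxes in each of the others.\<close>

lemma covered_sphere:
  fixes x :: "real^'n"
  assumes "\<rho> > 0" "0 \<le> R" "2 * R / \<rho> + 1 \<le> M"
  shows "covered (cub x R - ocub x R) \<rho> (2 * real CARD('n) * M ^ (CARD('n) - 1))"
proof -
  define face where "face j = {z::real^'n. \<forall>i. (if i = fst j then x $ i + snd j * R else x $ i - R) \<le> z $ i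
    \<and> z $ i \<le> (if i = fst j then x $ i + snd j * R else x $ i + R)}" for j :: "'n \<times> real"
  have "covered (face j) \<rho> (M ^ (CARD('n) - 1))" for j
  proof -
    have "covered (face j) \<rho> (\<Prod>i\<in>UNIV. if i = fst j then 1 else M)"
      unfolding face_def by (rule covered_box) (use assms in auto)
    also have "(\<Prod>i\<in>UNIV. if i = fst j then 1 else M) = M ^ (CARD('n) - 1)"
    proof -
      have "(\<Prod>i\<in>UNIV. if i = fst j then 1 else M) = (\<Prod>i\<in>UNIV - {fst j}. if i = fst j then 1 else M)"
        by (subst prod.remove[of _ "fst j"]) auto
      also have "\<dots> = (\<Prod>i\<in>UNIV - {fst j}. M)" by (rule prod.cong) auto
      finally show ?thesis by (simp add: card_Diff_singleton)
    qed
    finally show ?thesis .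
  qed
  then have "covered (\<Union>j\<in>UNIV \<times> {1, -1}. face j) \<rho> (\<Sum>j\<in>(UNIV :: 'n set) \<times> {1, - 1 :: real}. M ^ (CARD('n) - 1))"
    by (intro covered_UN[where E=face and N="\<lambda>_. M ^ (CARD('n) - 1)"]) auto
  moreover have "cub x R - ocub x R \<subseteq> (\<Union>j\<in>UNIV \<times> {1, -1}. face j)"
  proof
    fix z assume z: "z \<in> cub x R - ocub x R"
    then obtain j where j: "\<bar>z $ j - x $ j\<bar> = R" by (auto simp: cub_def ocub_def not_less) (metis order_antisym)
    have zi: "x $ i - R \<le> z $ i \<and> z $ i \<le> x $ i + R" for i using z by (auto simp: cub_def abs_le_iff dest!: spec[of _ i])
    from j have "z $ j = x $ j + 1 * R \<or> z $ j = x $ j + (- 1) * R" by linarith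
    then have "z \<in> face (j, 1) \<or> z \<in> face (j, - 1)" using zi by (auto simp: face_def)
    then show "z \<in> (\<Union>j\<in>UNIV \<times> {1, -1}. face j)" by blast
  qed
  ultimately show ?thesis by (rule covered_mono) (simp add: card_cartesian_product)
qed

context cube_layers
begin

definition dim :: real where "dim = real CARD('n) - 1 + \<gamma>"

definition slab :: "nat \<Rightarrow> (real^'n) set" where
  "slab m = {x. \<forall>i. (if i = i0 then s m else 0) \<le> x $ i \<and> x $ i \<le> (if i = i0 then s m + tail m else 1)}"

lemma closed_slab: "closed (slab m)"
proof -
  have "slab m = cbox (\<chi> i. if i = i0 then s m else 0) (\<chi> i. if i = i0 then s m + tail m else 1)"
    by (auto simp: slab_def set_eq_iff mem_box_cart)
  then show ?thesis by (simp only: closed_cbox)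
qed

text \<open>Finitely many closed cubes together with a slab that holds all levels from
  \<open>m\<close> on form a closed set containing \<open>U\<close>, so the points where the cubes
  accumulate stay in the slab.\<close>

lemma frontier_subset:
  "frontier U \<subseteq> (\<Union>k<m. \<Union>a\<in>I k. cub (c k a) (r k / 4) - ocub (c k a) (r k / 4)) \<union> slab m"
proof
  fix x assume x: "x \<in> frontier U"
  let ?K = "(\<Union>k<m. \<Union>a\<in>I k. cub (c k a) (r k / 4)) \<union> slab m"
  have "U \<subseteq> ?K"
  proof
    fix z assume "z \<in> U"
    then obtain k a where a: "a \<in> I k" "z \<in> ocub (c k a) (r k / 4)" by (auto simp: U_def)
    then have z: "z \<in> cub (c k a) (r k / 4)" using ocub_subset_cub by blast
    show "z \<in> ?K"
    proof (cases "k < m")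
      case True
      with a z show ?thesis by blast
    next
      case False
      then have "z \<in> slab m" using cell_range[OF a(1) z, of m] by (auto simp: slab_def)
      then show ?thesis by blast
    qed
  qed
  moreover have "closed ?K"
    by (intro closed_Un closed_UN closed_slab closed_cub finite_I ballI) auto
  ultimately have "closure U \<subseteq> ?K" by (rule closure_minimal)
  moreover have "x \<in> closure U" using x by (simp add: frontier_def)
  ultimately have xK: "x \<in> ?K" by blast
  have xU: "x \<notin> U" using x open_U by (simp add: frontier_def interior_open)
  show "x \<in> (\<Union>k<m. \<Union>a\<in>I k. cub (c k a) (r k / 4) - ocub (c k a) (r k / 4)) \<union> slab m"
    using xK xU U_cell by blast
qed

lemma pow_gamma: "(2 powr \<gamma>) ^ k = 2 powr (\<gamma> * real k)"
  by (simp add: powr_powr flip: powr_realpow)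

lemma pow_dim: "(2 ^ m) ^ (CARD('n) - 1) * (2 powr \<gamma>) ^ m = (2 powr dim) ^ m"
proof -
  have "real (CARD('n) - 1) = real CARD('n) - 1" by (simp add: of_nat_diff Suc_le_eq)
  then have "2 powr dim = 2 ^ (CARD('n) - 1) * 2 powr \<gamma>"
    by (simp add: dim_def powr_add flip: powr_realpow)
  then show ?thesis by (simp add: power_mult_distrib power_mult[symmetric] mult.commute)
qed

lemma sum_gamma: "(\<Sum>k<m. (2 powr \<gamma>) ^ k) \<le> (2 powr \<gamma>) ^ m / (2 powr \<gamma> - 1)"
proof -
  have g: "2 powr \<gamma> > 1" using \<gamma> powr_less_mono[of 0 \<gamma> 2] by simp
  have "(\<Sum>k<m. (2 powr \<gamma>) ^ k) = ((2 powr \<gamma>) ^ m - 1) / (2 powr \<gamma> - 1)"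
    using g \<gamma> by (intro geometric_sum) simp
  also have "\<dots> \<le> (2 powr \<gamma>) ^ m / (2 powr \<gamma> - 1)" using g by (intro divide_right_mono) auto
  finally show ?thesis .
qed

text \<open>Up to constants, the boundary of a cube of level k < m takes 2^((m-k)(n-1)) boxes, and
  there are 2^(k(n-1+\<gamma>)) such cubes: 2^(m(n-1)+\<gamma>k) in all, a geometric sum dominated
  by k near m. The slab for the finer levels has height 2^((\<gamma>-1)m), which is 2^(\<gamma>m)
  boxes. Both parts are of order \<open>(2 powr dim) ^ m\<close>.\<close>

lemma upper_bound:
  "\<exists>B>0. \<forall>m \<rho>. r m \<le> \<rho> \<longrightarrow> real (box_number \<rho> (frontier U)) \<le> B * (2 powr dim) ^ m"
proof -
  let ?n = "CARD('n)"
  define T where "T = 2 / (1 - 2 powr (\<gamma> - 1))"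
  have T: "T > 0" using ratio by (simp add: T_def)
  define B1 where "B1 = 4 * real ?n * 2 ^ (?n - 1) / (2 powr \<gamma> - 1)"
  define B2 where "B2 = 2 ^ (?n - 1) * (T + 1)"
  have g: "2 powr \<gamma> > 1" using \<gamma> powr_less_mono[of 0 \<gamma> 2] by simp
  have B1: "B1 > 0" using g by (simp add: B1_def)
  have B2: "B2 > 0" using T by (simp add: B2_def)
  have "real (box_number \<rho> (frontier U)) \<le> (B1 + B2) * (2 powr dim) ^ m" if \<rho>: "r m \<le> \<rho>" for m \<rho>
  proof -
    have \<rho>0: "\<rho> > 0" using \<rho> r_pos[of m] by linarith
    have inv: "1 / \<rho> \<le> 2 ^ m"
      using \<rho> \<rho>0 frac_le[of 1 1 "r m" \<rho>] by (simp add: r_def power_one_over)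
    have sph: "covered (cub (c k a) (r k / 4) - ocub (c k a) (r k / 4)) \<rho> (2 * real ?n * (2 * 2 ^ (m - k)) ^ (?n - 1))"
      if "k < m" for k a
    proof (rule covered_sphere[OF \<rho>0])
      have "2 * (r k / 4) / \<rho> = (r k / 2) * (1 / \<rho>)" by simp
      also have "\<dots> \<le> (r k / 2) * 2 ^ m" using inv by (intro mult_left_mono) auto
      also have "\<dots> = 2 ^ (m - k) / 2" using that by (simp add: r_def power_one_over power_diff)
      finally have 1: "2 * (r k / 4) / \<rho> \<le> 2 ^ (m - k) / 2" .
      have "(1::real) \<le> 2 ^ (m - k)" by (rule one_le_power) simp
      with 1 show "2 * (r k / 4) / \<rho> + 1 \<le> 2 * 2 ^ (m - k)" by linarith
    qed simp
    have c1: "covered (\<Union>k<m. \<Union>a\<in>I k. cub (c k a) (r k / 4) - ocub (c k a) (r k / 4)) \<rho>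
       (\<Sum>k<m. \<Sum>a\<in>I k. 2 * real ?n * (2 * 2 ^ (m - k)) ^ (?n - 1))"
      by (intro covered_UN finite_I sph) auto
    have s1: "(\<Sum>k<m. \<Sum>a\<in>I k. 2 * real ?n * (2 * 2 ^ (m - k)) ^ (?n - 1)) \<le> B1 * (2 powr dim) ^ m"
    proof -
      have "(\<Sum>a\<in>I k. 2 * real ?n * (2 * 2 ^ (m - k)) ^ (?n - 1)) \<le> 4 * real ?n * 2 ^ (?n - 1) * (2 ^ m) ^ (?n - 1) * (2 powr \<gamma>) ^ k"
        if "k \<in> {..<m}" for k
      proof -
        have "(2::real) ^ m = 2 ^ k * 2 ^ (m - k)" using that by (simp flip: power_add)
        then have e: "((2::real) ^ m) ^ (?n - 1) = (2 ^ k) ^ (?n - 1) * (2 ^ (m - k)) ^ (?n - 1)" by (simp add: power_mult_distrib)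
        have "(\<Sum>a\<in>I k. 2 * real ?n * (2 * 2 ^ (m - k)) ^ (?n - 1)) =
            real (L k) * (2 * real ?n * 2 ^ (?n - 1) * (2 ^ m) ^ (?n - 1))"
          unfolding e by (simp add: card_I power_mult_distrib)
        also have "\<dots> \<le> (2 * (2 powr \<gamma>) ^ k) * (2 * real ?n * 2 ^ (?n - 1) * (2 ^ m) ^ (?n - 1))"
          using L_bounds(2)[of k] by (intro mult_right_mono) (simp_all add: pow_gamma)
        finally show ?thesis by (simp add: mult_ac)
      qed
      then have "(\<Sum>k<m. \<Sum>a\<in>I k. 2 * real ?n * (2 * 2 ^ (m - k)) ^ (?n - 1)) \<le>
          (\<Sum>k<m. 4 * real ?n * 2 ^ (?n - 1) * (2 ^ m) ^ (?n - 1) * (2 powr \<gamma>) ^ k)" by (rule sum_mono)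
      also have "\<dots> = 4 * real ?n * 2 ^ (?n - 1) * (2 ^ m) ^ (?n - 1) * (\<Sum>k<m. (2 powr \<gamma>) ^ k)"
        by (simp add: sum_distrib_left)
      also have "\<dots> \<le> 4 * real ?n * 2 ^ (?n - 1) * (2 ^ m) ^ (?n - 1) * ((2 powr \<gamma>) ^ m / (2 powr \<gamma> - 1))"
        by (intro mult_left_mono sum_gamma) simp
      also have "\<dots> = B1 * ((2 ^ m) ^ (?n - 1) * (2 powr \<gamma>) ^ m)" by (simp add: B1_def)
      finally show ?thesis unfolding pow_dim .
    qed
    have t0: "0 \<le> tail m" using s_tail[of m 0] by simp
    have c2: "covered (slab m) \<rho> (\<Prod>i\<in>UNIV. if i = i0 then (T + 1) * (2 powr \<gamma>) ^ m else 2 * 2 ^ m)"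
      unfolding slab_def
    proof (rule covered_box[OF \<rho>0])
      fix i
      show "(if i = i0 then s m else 0) \<le> (if i = i0 then s m + tail m else 1)" using t0 by simp
      have "tail m / \<rho> \<le> tail m * 2 ^ m" using inv t0 mult_left_mono[of "1 / \<rho>" "2 ^ m" "tail m"] by simp
      also have "\<dots> = T * (2 powr \<gamma>) ^ m"
      proof -
        have "(2 powr (\<gamma> - 1)) ^ m * 2 ^ m = (2 powr \<gamma>) ^ m"
          by (simp add: powr_diff flip: power_mult_distrib)
        then show ?thesis by (simp add: tail_def T_def)
      qed
      finally have "tail m / \<rho> \<le> T * (2 powr \<gamma>) ^ m" .
      moreover have "1 \<le> (2 powr \<gamma>) ^ m" using g by (intro one_le_power) simp
      moreover have "1 / \<rho> + 1 \<le> 2 * 2 ^ m" using inv one_le_power[of "2::real" m] by linarith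
      ultimately show "((if i = i0 then s m + tail m else 1) - (if i = i0 then s m else 0)) / \<rho> + 1
          \<le> (if i = i0 then (T + 1) * (2 powr \<gamma>) ^ m else 2 * 2 ^ m)"
        by (auto simp: distrib_right)
    qed
    have s2: "(\<Prod>i\<in>UNIV. if i = i0 then (T + 1) * (2 powr \<gamma>) ^ m else 2 * 2 ^ m) = B2 * (2 powr dim) ^ m"
    proof -
      have "(\<Prod>i\<in>UNIV. if i = i0 then (T + 1) * (2 powr \<gamma>) ^ m else 2 * 2 ^ m) =
          (T + 1) * (2 powr \<gamma>) ^ m * (\<Prod>i\<in>UNIV - {i0}. if i = i0 then (T + 1) * (2 powr \<gamma>) ^ m else 2 * 2 ^ m)"
        by (subst prod.remove[of _ i0]) auto
      also have "(\<Prod>i\<in>UNIV - {i0}. if i = i0 then (T + 1) * (2 powr \<gamma>) ^ m else 2 * 2 ^ m) = (\<Prod>i\<in>UNIV - {i0}. 2 * 2 ^ m)"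
        by (rule prod.cong) auto
      also have "\<dots> = 2 ^ (?n - 1) * (2 ^ m) ^ (?n - 1)" by (simp add: card_Diff_singleton power_mult_distrib)
      also have "(T + 1) * (2 powr \<gamma>) ^ m * (2 ^ (?n - 1) * (2 ^ m) ^ (?n - 1)) = B2 * ((2 ^ m) ^ (?n - 1) * (2 powr \<gamma>) ^ m)"
        by (simp add: B2_def)
      finally show ?thesis unfolding pow_dim .
    qed
    have "covered (frontier U) \<rho> ((B1 + B2) * (2 powr dim) ^ m)"
      by (rule covered_mono[OF covered_Un[OF c1 c2] frontier_subset]) (use s1 s2 in \<open>simp add: distrib_right\<close>)
    then show ?thesis by (rule covered_imp_box_number)
  qed
  then show ?thesis using B1 B2 by (intro exI[of _ "B1 + B2"]) auto
qed

lemma card_I_lower: "(2 powr dim) ^ m \<le> real (card (I m))"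
proof -
  have "(2 powr dim) ^ m = (2 ^ m) ^ (CARD('n) - 1) * (2 powr \<gamma>) ^ m" by (rule pow_dim[symmetric])
  also have "\<dots> \<le> (2 ^ m) ^ (CARD('n) - 1) * real (L m)"
    using L_bounds(1)[of m] by (intro mult_left_mono) (simp_all add: pow_gamma)
  finally show ?thesis by (simp add: card_I mult.commute)
qed

text \<open>Each cube of level \<open>m\<close> supplies one corner \<open>z a\<close>. Two of these
  corners differ by at least \<open>r m > \<rho>\<close> in some coordinate, so no covering box
  contains both.\<close>

lemma lower_bound:
  assumes "0 < \<rho>" "\<rho> < r m"
  shows "(2 powr dim) ^ m \<le> real (box_number \<rho> (frontier U))"
proof -
  have bF: "bounded (frontier U)" using compact_frontier_bounded[OF bounded_U] compact_imp_bounded by blast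
  obtain A where A: "finite A" "card A = box_number \<rho> (frontier U)" "frontier U \<subseteq> (\<Union>a\<in>A. cbox a (a + \<rho> *\<^sub>R One))"
    using box_number_cover[OF bF assms(1)] by blast
  define z where "z a = (\<chi> i. c m a $ i + r m / 4)" for a
  have "\<forall>a\<in>I m. \<exists>b. b \<in> A \<and> z a \<in> cbox b (b + \<rho> *\<^sub>R One)"
  proof
    fix a assume a: "a \<in> I m"
    have "z a \<in> cub (c m a) (r m / 4) - ocub (c m a) (r m / 4)"
      by (auto simp: z_def cub_def ocub_def)
    then have "z a \<in> frontier U" using frontier_in_cell[OF a] by blast
    with A(3) show "\<exists>b. b \<in> A \<and> z a \<in> cbox b (b + \<rho> *\<^sub>R One)" by blast
  qed
  from bchoice[OF this] obtain f where f: "\<forall>a\<in>I m. f a \<in> A \<and> z a \<in> cbox (f a) (f a + \<rho> *\<^sub>R One)" ..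
  have "inj_on f (I m)"
  proof (rule inj_onI, rule ccontr)
    fix a b assume ab: "a \<in> I m" "b \<in> I m" "f a = f b" "a \<noteq> b"
    obtain i where i: "(r m + r m) / 2 \<le> \<bar>c m a $ i - c m b $ i\<bar>" using separation[OF ab(1,2)] ab(4) by blast
    have "f a $ i \<le> z a $ i \<and> z a $ i \<le> f a $ i + \<rho>" "f a $ i \<le> z b $ i \<and> z b $ i \<le> f a $ i + \<rho>"
      using f ab(1,2,3) unfolding mem_cbox_One by metis+
    then have "\<bar>z a $ i - z b $ i\<bar> \<le> \<rho>" by (simp add: abs_le_iff)
    with i assms(2) show False by (simp add: z_def)
  qed
  then have "card (I m) \<le> card A" using f A(1) by (intro card_inj_on_le[of f]) auto
  then show ?thesis using card_I_lower[of m] A(2) by simp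
qed

lemma has_box_dim_U: "has_box_dim (frontier U) dim"
proof -
  obtain B where B: "B > 0" "\<And>m \<rho>. r m \<le> \<rho> \<Longrightarrow> real (box_number \<rho> (frontier U)) \<le> B * (2 powr dim) ^ m"
    using upper_bound by blast
  have pd: "(2 powr dim) ^ m = (1 / r m) powr dim" for m
    by (simp add: r_def power_one_over powr_powr mult.commute flip: powr_realpow)
  have dim0: "dim \<ge> 0" using \<gamma> by (simp add: dim_def Suc_le_eq)
  show ?thesis
  proof (rule has_box_dimI)
    show "0 < (1/2) powr dim" "0 < B * 2 powr dim" using B by auto
    fix \<rho> :: real assume \<rho>: "0 < \<rho>" "\<rho> < 1"
    \<comment> \<open>The least choice gives \<open>r m \<le> \<rho> < 2 * r m\<close>, so passing
      between \<open>\<rho>\<close> and \<open>r m\<close> costs only the factor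
      \<open>2 powr dim\<close>.\<close>
    define m where "m = (LEAST m. r m \<le> \<rho>)"
    obtain m' where "(1/2) ^ m' < \<rho>" using real_arch_pow_inv[OF \<rho>(1), of "1/2"] by auto
    then have "r m' \<le> \<rho>" by (simp add: r_def)
    then have m: "r m \<le> \<rho>" unfolding m_def by (rule LeastI)
    have "m \<noteq> 0"
    proof
      assume "m = 0"
      with m \<rho>(2) show False by (simp add: r_def)
    qed
    then obtain l where l: "m = Suc l" by (cases m) auto
    have "\<not> r l \<le> \<rho>" using not_less_Least[of l "\<lambda>m. r m \<le> \<rho>"] l m_def by auto
    then have rl: "\<rho> < r l" by simp
    have rm: "r m = r l / 2" by (simp add: l r_def)
    have "(1/2) powr dim * (1 / \<rho>) powr dim = (1 / (2 * \<rho>)) powr dim"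
      using \<rho> by (subst powr_mult[symmetric]) auto
    also have "\<dots> \<le> (1 / r l) powr dim"
    proof (intro powr_mono2 dim0)
      show "1 / (2 * \<rho>) \<le> 1 / r l" using m rm r_pos[of l] by (intro frac_le) auto
      show "0 \<le> 1 / (2 * \<rho>)" using \<rho>(1) by simp
    qed
    also have "\<dots> \<le> real (box_number \<rho> (frontier U))" using lower_bound[OF \<rho>(1) rl] by (simp add: pd)
    finally have lo: "(1/2) powr dim * (1 / \<rho>) powr dim \<le> real (box_number \<rho> (frontier U))" .
    have "real (box_number \<rho> (frontier U)) \<le> B * (1 / r m) powr dim" using B(2)[OF m] by (simp add: pd)
    also have "\<dots> \<le> B * (2 / \<rho>) powr dim"
    proof (intro mult_left_mono powr_mono2 dim0)
      have "\<rho> \<le> 2 * r m" using rl rm by simp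
      then show "1 / r m \<le> 2 / \<rho>" using \<rho> r_pos[of m] by (simp add: field_simps)
    qed (use B r_pos[of m] in auto)
    also have "(2 / \<rho>) powr dim = 2 powr dim * (1 / \<rho>) powr dim"
      using \<rho> by (subst powr_mult[symmetric]) auto
    finally show "(1/2) powr dim * (1 / \<rho>) powr dim \<le> real (box_number \<rho> (frontier U)) \<and>
        real (box_number \<rho> (frontier U)) \<le> B * 2 powr dim * (1 / \<rho>) powr dim"
      using lo by simp
  qed
qed

end

section \<open>Maps with large degree\<close>

lemma hbound_imp_holder_norm:
  assumes "hbound \<alpha> C A f" "0 \<le> C"
  shows "holder_norm \<alpha> A f \<le> ennreal (2 * C)"
proof -
  have "(SUP x\<in>A. ennreal (norm (f x))) \<le> ennreal C"
    using assms by (intro SUP_least ennreal_leI) (simp add: hbound_def)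
  moreover have "holder_seminorm \<alpha> A f \<le> ennreal C"
    unfolding holder_seminorm_def
  proof (intro SUP_least, clarify)
    fix x y assume "x \<in> A" "y \<in> A" "x \<noteq> y"
    then show "ennreal (norm (f x - f y) / norm (x - y) powr \<alpha>) \<le> ennreal C"
      using assms by (intro ennreal_leI) (simp add: hbound_def pos_divide_le_eq)
  qed
  ultimately have "holder_norm \<alpha> A f \<le> ennreal C + ennreal C" unfolding holder_norm_def by (rule add_mono)
  also have "\<dots> = ennreal (2 * C)" using assms(2) by (simp flip: ennreal_plus)
  finally show ?thesis .
qed

context cube_layers
begin

text \<open>The scaling factor that takes a cube of side \<open>r k / 2\<close> to one of side
  2^(-\<beta>k)/2.\<close>

definition t :: "real \<Rightarrow> nat \<Rightarrow> real" where "t \<beta> k = 2 powr ((1 - \<beta>) * real k)"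

text \<open>
  The radius \<open>3 * r k / 8\<close> lies strictly between that of the cubes of \<open>U\<close> (\<open>r k / 4\<close>) and that
  of the cells (\<open>r k / 2\<close>), so that \<open>v \<beta> k\<close> is locally affine near the closure of \<open>U\<close>.
\<close>

definition v :: "real \<Rightarrow> nat \<Rightarrow> real^'n \<Rightarrow> real^'n" where
  "v \<beta> k x = (\<Sum>a\<in>I k. indicator (ocub (c k a) (3 * r k / 8)) x *\<^sub>R (t \<beta> k *\<^sub>R (x - c k a)))"

definition R :: "real \<Rightarrow> nat \<Rightarrow> real" where "R \<beta> k = t \<beta> k * (r k / 4)"

lemma t_pos [simp]: "0 < t \<beta> k" by (simp add: t_def)

lemma t_abs [simp]: "\<bar>t \<beta> k\<bar> = t \<beta> k" by (simp add: t_def)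

lemma R_pos: "0 < R \<beta> k" by (simp add: R_def)

lemma t_r: "t \<beta> k * r k = 2 powr (- (\<beta> * real k))"
proof -
  have "r k = 2 powr (- real k)" by (simp add: r_def powr_minus powr_realpow power_one_over inverse_eq_divide)
  then show ?thesis by (simp add: t_def algebra_simps flip: powr_add)
qed

lemma I_nonempty: "I k \<noteq> {}"
  using card_I_lower[of k] by (metis card.empty not_le of_nat_0 zero_less_power powr_gt_zero zero_neq_numeral)

lemma v_in:
  assumes "a \<in> I k" "x \<in> ocub (c k a) (3 * r k / 8)"
  shows "v \<beta> k x = t \<beta> k *\<^sub>R (x - c k a)"
proof -
  have sub: "ocub z (3 * r k / 8) \<subseteq> ocub z (r k / 2)" for z :: "real^'n" by (rule ocub_mono) simp
  have "v \<beta> k x = (\<Sum>b\<in>{a}. indicator (ocub (c k b) (3 * r k / 8)) x *\<^sub>R (t \<beta> k *\<^sub>R (x - c k b)))"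
    unfolding v_def
  proof (rule sum.mono_neutral_right)
    show "\<forall>b\<in>I k - {a}. indicator (ocub (c k b) (3 * r k / 8)) x *\<^sub>R (t \<beta> k *\<^sub>R (x - c k b)) = 0"
      using cells_disjoint[OF assms(1), of _ k x] assms(2) sub by (auto simp: indicator_def)
  qed (use assms finite_I in auto)
  then show ?thesis using assms(2) by simp
qed

lemma v_out:
  assumes "\<And>a. a \<in> I k \<Longrightarrow> x \<notin> ocub (c k a) (3 * r k / 8)"
  shows "v \<beta> k x = 0"
  unfolding v_def using assms by (intro sum.neutral) simp

text \<open>Together with \<open>outside k\<close> an open set that contains the closure of
  \<open>U\<close> and on which \<open>v\<close> is locally affine, as \<open>smooth_closure\<close>
  demands. The surfaces left out lie in the gaps around the cubes.\<close>

definition inside :: "nat \<Rightarrow> (real^'n) set" where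
  "inside k = (\<Union>a\<in>I k. ocub (c k a) (3 * r k / 8))"

definition outside :: "nat \<Rightarrow> (real^'n) set" where
  "outside k = - (\<Union>a\<in>I k. cub (c k a) (3 * r k / 8))"

lemma open_inside: "open (inside k)" unfolding inside_def by (intro open_UN ballI open_ocub)

lemma open_outside: "open (outside k)"
  unfolding outside_def by (intro open_Compl closed_UN finite_I ballI closed_cub)

lemma closure_U_subset: "closure U \<subseteq> inside k \<union> outside k"
proof
  fix x assume x: "x \<in> closure U"
  show "x \<in> inside k \<union> outside k"
  proof (cases "x \<in> outside k")
    case False
    then obtain a where a: "a \<in> I k" "x \<in> cub (c k a) (3 * r k / 8)" by (auto simp: outside_def)
    then have "x \<in> ocub (c k a) (r k / 2)" using cub_subset_ocub[of "3 * r k / 8" "r k / 2" "c k a"] r_pos[of k] by auto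
    then have "x \<in> cub (c k a) (r k / 4)" using closure_in_cell[OF a(1)] x by blast
    then have "x \<in> ocub (c k a) (3 * r k / 8)" using cub_subset_ocub[of "r k / 4" "3 * r k / 8" "c k a"] r_pos[of k] by auto
    with a(1) show ?thesis by (auto simp: inside_def)
  qed simp
qed

lemma v_outside: "x \<in> outside k \<Longrightarrow> v \<beta> k x = 0"
  using ocub_subset_cub by (intro v_out) (auto simp: outside_def)

lemma v_has_derivative:
  "a \<in> I k \<Longrightarrow> x \<in> ocub (c k a) (3 * r k / 8) \<Longrightarrow> (v \<beta> k has_derivative (\<lambda>h. t \<beta> k *\<^sub>R h)) (at x)"
  "x \<in> outside k \<Longrightarrow> (v \<beta> k has_derivative (\<lambda>h. 0)) (at x)"
proof -
  assume a: "a \<in> I k" "x \<in> ocub (c k a) (3 * r k / 8)"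
  have "((\<lambda>x. t \<beta> k *\<^sub>R (x - c k a)) has_derivative (\<lambda>h. t \<beta> k *\<^sub>R h)) (at x)"
    by (auto intro!: derivative_eq_intros)
  then show "(v \<beta> k has_derivative (\<lambda>h. t \<beta> k *\<^sub>R h)) (at x)"
    by (rule has_derivative_transform_within_open[OF _ open_ocub a(2)]) (simp add: v_in[OF a(1)])
next
  assume x: "x \<in> outside k"
  show "(v \<beta> k has_derivative (\<lambda>h. 0)) (at x)"
    by (rule has_derivative_transform_within_open[OF has_derivative_const[of 0] open_outside x]) (simp add: v_outside)
qed

lemma det_jac_v:
  "a \<in> I k \<Longrightarrow> x \<in> ocub (c k a) (3 * r k / 8) \<Longrightarrow> det (jac (v \<beta> k) x) = t \<beta> k ^ CARD('n)"
  "x \<in> outside k \<Longrightarrow> det (jac (v \<beta> k) x) = 0"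
proof -
  assume a: "a \<in> I k" "x \<in> ocub (c k a) (3 * r k / 8)"
  have "jac (v \<beta> k) x = matrix (\<lambda>h. t \<beta> k *\<^sub>R h)"
    unfolding jac_def using frechet_derivative_at[OF v_has_derivative(1)[OF a]] by simp
  then have "jac (v \<beta> k) x $ i $ j = (if i = j then t \<beta> k else 0)" for i j
    by (simp add: matrix_def axis_def)
  then show "det (jac (v \<beta> k) x) = t \<beta> k ^ CARD('n)" by (subst det_diagonal) auto
next
  assume "x \<in> outside k"
  then have "jac (v \<beta> k) x = matrix (\<lambda>h. 0)"
    unfolding jac_def using frechet_derivative_at[OF v_has_derivative(2)] by simp
  then have "jac (v \<beta> k) x = 0" by (simp add: matrix_def vec_eq_iff)
  then show "det (jac (v \<beta> k) x) = 0" by simp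
qed

lemma v_smooth: "v \<beta> k \<in> smooth_closure U"
proof -
  have "smooth_on (v \<beta> k) (inside k \<union> outside k)"
  proof (rule smooth_on_locally_affine)
    fix x assume "x \<in> inside k \<union> outside k"
    then show "\<exists>e>0. \<exists>A d. bounded_linear A \<and> (\<forall>z\<in>ball x e. v \<beta> k z = A z + d)"
    proof
      assume "x \<in> inside k"
      then obtain a where a: "a \<in> I k" "x \<in> ocub (c k a) (3 * r k / 8)" by (auto simp: inside_def)
      obtain e where "e > 0" "ball x e \<subseteq> ocub (c k a) (3 * r k / 8)" using open_contains_ball open_ocub a(2) by blast
      then show ?thesis
        using v_in[OF a(1)] bounded_linear_scaleR_right[of "t \<beta> k"]
        by (intro exI[of _ e] conjI exI[of _ "\<lambda>z. t \<beta> k *\<^sub>R z"] exI[of _ "- (t \<beta> k *\<^sub>R c k a)"])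
           (auto simp: scaleR_diff_right)
    next
      assume x: "x \<in> outside k"
      obtain e where "e > 0" "ball x e \<subseteq> outside k" using open_contains_ball open_outside x by blast
      then show ?thesis
        by (intro exI[of _ e] conjI exI[of _ "\<lambda>_. 0"] exI[of _ 0]) (auto simp: v_outside subset_iff)
    qed
  qed
  then show ?thesis unfolding smooth_closure_def
    using open_inside open_outside closure_U_subset by (auto intro!: exI[of _ "inside k \<union> outside k"])
qed

lemma U_not_level_outside:
  assumes "b \<in> I j" "x \<in> ocub (c j b) (r j / 4)" "j \<noteq> k"
  shows "x \<in> outside k"
proof -
  have xj: "x \<in> ocub (c j b) (r j / 2)" using assms(2) ocub_mono[of "r j / 4" "r j / 2" "c j b"] by auto
  have "x \<notin> cub (c k a) (3 * r k / 8)" if "a \<in> I k" for a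
  proof
    assume "x \<in> cub (c k a) (3 * r k / 8)"
    then have "x \<in> ocub (c k a) (r k / 2)" using cub_subset_ocub[of "3 * r k / 8" "r k / 2" "c k a"] r_pos[of k] by auto
    with cells_disjoint[OF assms(1) that xj] assms(3) show False by blast
  qed
  then show ?thesis by (simp add: outside_def)
qed

text \<open>On \<open>U\<close> the integrand lives on the cubes of level \<open>k\<close>. The
  affine substitution turns each of them into the same image cube, and the determinant is its
  Jacobian factor.\<close>

lemma integral_v:
  assumes \<phi>: "continuous_on UNIV \<phi>"
  shows "(LINT x:U|lborel. \<phi> (v \<beta> k x) * det (jac (v \<beta> k) x)) =
     real (card (I k)) * (LINT y|lborel. indicator (ocub 0 (R \<beta> k)) y * \<phi> y)"
proof -
  let ?t = "t \<beta> k"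
  define g where "g y = indicator (ocub 0 (R \<beta> k)) y * \<phi> y" for y
  have gm: "g \<in> borel_measurable borel" unfolding g_def[abs_def]
    using borel_measurable_continuous_onI[OF \<phi>] open_ocub
    by (intro borel_measurable_times borel_measurable_indicator borel_open)
  have geq: "g (?t *\<^sub>R (x - c k a)) = indicator (ocub (c k a) (r k / 4)) x * \<phi> (?t *\<^sub>R (x - c k a))" for x a
    using ocub_scale[OF t_pos, of \<beta> k x "c k a" "r k / 4"] by (simp add: g_def R_def indicator_def)
  have sub: "ocub z (r k / 4) \<subseteq> ocub z (3 * r k / 8)" for z :: "real^'n" by (rule ocub_mono) simp
  have sub2: "ocub z (r k / 4) \<subseteq> ocub z (r k / 2)" for z :: "real^'n" by (rule ocub_mono) simp
  have pw: "indicator U x *\<^sub>R (\<phi> (v \<beta> k x) * det (jac (v \<beta> k) x)) = (\<Sum>a\<in>I k. g (?t *\<^sub>R (x - c k a)) * ?t ^ CARD('n))" for x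
  proof (cases "\<exists>a\<in>I k. x \<in> ocub (c k a) (r k / 4)")
    case True
    then obtain a where a: "a \<in> I k" "x \<in> ocub (c k a) (r k / 4)" by blast
    have others: "x \<notin> ocub (c k b) (r k / 4)" if "b \<in> I k" "b \<noteq> a" for b
      using cells_disjoint[OF a(1) that(1), of x] a(2) that(2) sub2 by blast
    have "(\<Sum>b\<in>I k. g (?t *\<^sub>R (x - c k b)) * ?t ^ CARD('n)) = (\<Sum>b\<in>{a}. g (?t *\<^sub>R (x - c k b)) * ?t ^ CARD('n))"
      by (rule sum.mono_neutral_right) (use a finite_I others in \<open>auto simp: geq\<close>)
    moreover have "x \<in> U" using a U_cell by blast
    moreover have "x \<in> ocub (c k a) (3 * r k / 8)" using a sub by blast
    ultimately show ?thesis using a by (simp add: geq v_in det_jac_v(1))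
  next
    case False
    then have "(\<Sum>b\<in>I k. g (?t *\<^sub>R (x - c k b)) * ?t ^ CARD('n)) = 0"
      by (intro sum.neutral) (auto simp: geq)
    moreover have "det (jac (v \<beta> k) x) = 0" if xU: "x \<in> U"
    proof -
      obtain j b where b: "b \<in> I j" "x \<in> ocub (c j b) (r j / 4)" using xU by (auto simp: U_def)
      with False have "j \<noteq> k" by blast
      from U_not_level_outside[OF b this] show ?thesis by (rule det_jac_v(2))
    qed
    ultimately show ?thesis by (cases "x \<in> U") auto
  qed
  have int: "integrable lborel (\<lambda>x. g (?t *\<^sub>R (x - c k a)) * ?t ^ CARD('n))" for a
  proof -
    have cont: "continuous_on (cub (c k a) (r k / 4)) (\<lambda>x. \<phi> (?t *\<^sub>R (x - c k a)) * ?t ^ CARD('n))"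
      by (intro continuous_intros continuous_on_compose2[OF \<phi>]) auto
    have "set_integrable lborel (cub (c k a) (r k / 4)) (\<lambda>x. \<phi> (?t *\<^sub>R (x - c k a)) * ?t ^ CARD('n))"
      unfolding set_integrable_def by (rule borel_integrable_compact[OF compact_cub cont])
    then have "set_integrable lborel (ocub (c k a) (r k / 4)) (\<lambda>x. \<phi> (?t *\<^sub>R (x - c k a)) * ?t ^ CARD('n))"
    proof (rule set_integrable_subset)
      show "ocub (c k a) (r k / 4) \<in> sets lborel"
        unfolding sets_lborel by (rule borel_open[OF open_ocub])
    qed (rule ocub_subset_cub)
    then show ?thesis by (simp add: set_integrable_def geq mult.assoc)
  qed
  have "(LINT x:U|lborel. \<phi> (v \<beta> k x) * det (jac (v \<beta> k) x)) = (LINT x|lborel. (\<Sum>a\<in>I k. g (?t *\<^sub>R (x - c k a)) * ?t ^ CARD('n)))"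
    unfolding set_lebesgue_integral_def pw ..
  also have "\<dots> = (\<Sum>a\<in>I k. LINT x|lborel. g (?t *\<^sub>R (x - c k a)) * ?t ^ CARD('n))"
    by (rule Bochner_Integration.integral_sum[OF int])
  also have "\<dots> = (\<Sum>a\<in>I k. LINT y|lborel. g y)"
    by (intro sum.cong refl integral_affine gm t_pos)
  finally show ?thesis by (simp add: g_def)
qed

text \<open>The whole boundary of the image cube belongs to the image of the frontier, so that a
  component of the complement lies entirely inside or entirely outside that cube.\<close>

lemma frontier_image_sphere: "cub 0 (R \<beta> k) - ocub 0 (R \<beta> k) \<subseteq> v \<beta> k ` frontier U"
proof
  fix y assume y: "y \<in> cub 0 (R \<beta> k) - ocub (0::real^'n) (R \<beta> k)"
  obtain a where a: "a \<in> I k" using I_nonempty by blast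
  let ?x = "c k a + (1 / t \<beta> k) *\<^sub>R y"
  have y': "t \<beta> k *\<^sub>R (?x - c k a) = y"
    using less_imp_neq[OF t_pos[of \<beta> k]] by simp
  have "?x \<notin> ocub (c k a) (r k / 4)" using y ocub_scale[OF t_pos, of \<beta> k ?x "c k a" "r k / 4"] by (simp only: y' R_def[symmetric]) simp
  moreover have "?x \<in> cub (c k a) (r k / 4)"
  proof -
    have "\<bar>y $ i\<bar> / t \<beta> k \<le> r k / 4" for i
    proof -
      have "\<bar>y $ i\<bar> \<le> t \<beta> k * (r k / 4)" using y by (simp add: cub_def R_def)
      then show ?thesis using t_pos[of \<beta> k] by (simp add: pos_divide_le_eq mult.commute)
    qed
    then show ?thesis using t_pos[of \<beta> k] by (simp add: cub_def abs_mult)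
  qed
  ultimately have x: "?x \<in> frontier U" "?x \<in> cub (c k a) (r k / 4)" using frontier_in_cell[OF a] by blast+
  then have "?x \<in> ocub (c k a) (3 * r k / 8)" using cub_subset_ocub[of "r k / 4" "3 * r k / 8" "c k a"] r_pos[of k] by auto
  from v_in[OF a this] have "v \<beta> k ?x = y" using y' by simp
  with imageI[OF x(1), of "v \<beta> k"] show "y \<in> v \<beta> k ` frontier U" by simp
qed

text \<open>The point 0 is the image of the frontier outside the cells of level \<open>k\<close>:
  the boundaries of the other cubes and their accumulation points.\<close>

lemma frontier_image_subset: "v \<beta> k ` frontier U \<subseteq> insert 0 (cub 0 (R \<beta> k) - ocub 0 (R \<beta> k))"
proof (rule image_subsetI)
  fix x assume x: "x \<in> frontier U"
  show "v \<beta> k x \<in> insert 0 (cub 0 (R \<beta> k) - ocub 0 (R \<beta> k))"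
  proof (cases "\<exists>a\<in>I k. x \<in> ocub (c k a) (3 * r k / 8)")
    case True
    then obtain a where a: "a \<in> I k" "x \<in> ocub (c k a) (3 * r k / 8)" by blast
    then have "x \<in> ocub (c k a) (r k / 2)" using ocub_mono[of "3 * r k / 8" "r k / 2" "c k a"] r_pos[of k] by auto
    then have xs: "x \<in> cub (c k a) (r k / 4) - ocub (c k a) (r k / 4)" using frontier_in_cell[OF a(1)] x by blast
    then have "t \<beta> k *\<^sub>R (x - c k a) \<notin> ocub 0 (R \<beta> k)"
      using ocub_scale[OF t_pos, of \<beta> k x "c k a" "r k / 4"] by (simp add: R_def)
    moreover have "t \<beta> k *\<^sub>R (x - c k a) \<in> cub 0 (R \<beta> k)"
      using xs t_pos[of \<beta> k] by (simp add: cub_def R_def abs_mult)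
    ultimately show ?thesis using v_in[OF a] by simp
  next
    case False
    then have "v \<beta> k x = 0" by (intro v_out) blast
    then show ?thesis by simp
  qed
qed

lemma v_continuous: "continuous_on (closure U) (v \<beta> k)"
proof -
  obtain W where "closure U \<subseteq> W" "continuous_on W (v \<beta> k)" using smooth_closureD[OF v_smooth] by metis
  then show ?thesis using continuous_on_subset by blast
qed

lemma frontier_image_null: "v \<beta> k ` frontier U \<in> null_sets lborel"
proof (rule null_sets_subset[OF _ _ frontier_image_subset])
  have "{0::real^'n} \<in> null_sets lborel" by (simp add: null_sets_def)
  from null_sets.Un[OF this sphere_cub_null[of 0 "R \<beta> k"]]
  show "insert 0 (cub 0 (R \<beta> k) - ocub (0::real^'n) (R \<beta> k)) \<in> null_sets lborel" by simp
  show "v \<beta> k ` frontier U \<in> sets lborel"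
    using borel_closed[OF compact_imp_closed[OF compact_image_frontier[OF bounded_U v_continuous]]] by simp
qed

text \<open>A test form is supported in the component of \<open>y\<close>, hence inside or outside
  the image cube as a whole, and \<open>integral_v\<close> counts its mass once for each cube of
  level \<open>k\<close>.\<close>

lemma degree_v:
  assumes y: "y \<notin> v \<beta> k ` frontier U"
  shows "brouwer_degree (v \<beta> k) U y = (if y \<in> ocub 0 (R \<beta> k) then real (card (I k)) else 0)"
proof -
  let ?Q = "ocub (0::real^'n) (R \<beta> k)" and ?F = "v \<beta> k ` frontier U"
  define V where "V = connected_component_set (- ?F) y"
  have yV: "y \<in> V" using y by (simp add: V_def connected_component_refl)
  have "V \<subseteq> - ?F" unfolding V_def by (rule connected_component_subset)
  moreover have "frontier ?Q \<subseteq> ?F"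
    using frontier_image_sphere[of \<beta> k] closure_ocub[OF R_pos, of "0::real^'n" \<beta> k] open_ocub[of "0::real^'n" "R \<beta> k"]
    by (auto simp: frontier_def interior_open)
  ultimately have "V \<inter> frontier ?Q = {}" by blast
  then have dich: "V \<inter> ?Q = {} \<or> V - ?Q = {}"
    using connected_Int_frontier[of V ?Q] by (auto simp: V_def connected_connected_component)
  have "smooth_degree (v \<beta> k) U y = (if y \<in> ?Q then real (card (I k)) else 0)"
  proof (rule smooth_degree_eqI[OF compact_image_frontier[OF bounded_U v_continuous] y])
    fix \<phi> assume \<phi>: "\<phi> \<in> degree_test_form (v \<beta> k) U y"
    have cont: "continuous_on UNIV \<phi>" using \<phi> smooth_on_imp_continuous by (auto simp: degree_test_form_def)
    have supp: "z \<in> V" if "\<phi> z \<noteq> 0" for z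
      using \<phi> that closure_subset[of "{z. \<phi> z \<noteq> 0}"] by (auto simp: degree_test_form_def V_def)
    have one: "(LINT z|lborel. \<phi> z) = 1"
      using \<phi> by (auto simp: degree_test_form_def dest: has_bochner_integral_integral_eq)
    show "(LINT x:U|lborel. \<phi> (v \<beta> k x) * det (jac (v \<beta> k) x)) = (if y \<in> ?Q then real (card (I k)) else 0)"
    proof (cases "y \<in> ?Q")
      case True
      with dich yV have "V \<subseteq> ?Q" by blast
      then have "(\<lambda>z. indicator ?Q z * \<phi> z) = \<phi>" using supp by (force simp: indicator_def)
      then show ?thesis using True one by (simp add: integral_v[OF cont])
    next
      case False
      with dich yV have "V \<inter> ?Q = {}" by blast
      then have "(\<lambda>z. indicator ?Q z * \<phi> z) = (\<lambda>z. 0)" using supp by (force simp: indicator_def)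
      then show ?thesis using False by (simp add: integral_v[OF cont])
    qed
  qed
  with brouwer_degree_smooth[OF open_U bounded_U v_smooth y] show ?thesis by simp
qed

lemma Lp_v:
  assumes p: "1 \<le> p"
  shows "degree_in_Lp p U (v \<beta> k)"
    and "Lp_norm p (brouwer_degree (v \<beta> k) U) = (real (card (I k)) powr p * (2 * R \<beta> k) ^ CARD('n)) powr (1 / p)"
proof -
  let ?N = "real (card (I k))" and ?Q = "ocub (0::real^'n) (R \<beta> k)"
  have ae: "AE y in lborel. \<bar>brouwer_degree (v \<beta> k) U y\<bar> powr p = ?N powr p * indicator ?Q y"
  proof (rule AE_I'[OF frontier_image_null[of \<beta> k]], safe, rule ccontr)
    fix y
    assume "\<bar>brouwer_degree (v \<beta> k) U y\<bar> powr p \<noteq> ?N powr p * indicator ?Q y"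
      and "y \<notin> v \<beta> k ` frontier U"
    then show False using degree_v[of y \<beta> k] by (cases "y \<in> ?Q") simp_all
  qed
  have meas: "brouwer_degree (v \<beta> k) U \<in> borel_measurable borel"
    by (rule brouwer_degree_measurable[OF open_U bounded_U v_continuous])
  have fin: "emeasure lborel ?Q < \<infinity>"
    using emeasure_bounded_finite[OF bounded_subset[OF bounded_cub ocub_subset_cub]] by blast
  have int: "integrable lborel (\<lambda>y. ?N powr p * indicator ?Q y)"
    using fin by (intro integrable_mult_right integrable_real_indicator) (auto simp: borel_open open_ocub)
  have m1: "(\<lambda>y. \<bar>brouwer_degree (v \<beta> k) U y\<bar> powr p) \<in> borel_measurable lborel" using meas by simp
  have m2: "(\<lambda>y. ?N powr p * indicator ?Q y) \<in> borel_measurable lborel" using int by blast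
  have "integrable lborel (\<lambda>y. \<bar>brouwer_degree (v \<beta> k) U y\<bar> powr p)"
    using int integrable_cong_AE[OF m1 m2 ae] by simp
  then show "degree_in_Lp p U (v \<beta> k)"
    using frontier_image_null meas by (simp add: degree_in_Lp_def Lp_space_def)
  have "(LINT y|lborel. \<bar>brouwer_degree (v \<beta> k) U y\<bar> powr p) = (LINT y|lborel. ?N powr p * indicator ?Q y)"
    by (rule integral_cong_AE[OF m1 m2 ae])
  also have "\<dots> = ?N powr p * (2 * R \<beta> k) ^ CARD('n)" by (simp add: measure_ocub[OF R_pos])
  finally show "Lp_norm p (brouwer_degree (v \<beta> k) U) = (?N powr p * (2 * R \<beta> k) ^ CARD('n)) powr (1 / p)"
    by (simp add: Lp_norm_def)
qed

lemma v_U_cases: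
  assumes "x \<in> U"
  obtains j b where "b \<in> I j" "x \<in> ocub (c j b) (r j / 4)" "j = k \<Longrightarrow> v \<beta> k x = t \<beta> k *\<^sub>R (x - c k b)" "j \<noteq> k \<Longrightarrow> v \<beta> k x = 0"
proof -
  obtain j b where b: "b \<in> I j" "x \<in> ocub (c j b) (r j / 4)" using assms by (auto simp: U_def)
  show thesis
  proof (rule that[OF b])
    assume j: "j = k"
    have "x \<in> ocub (c k b) (3 * r k / 8)" using b j ocub_mono[of "r k / 4" "3 * r k / 8" "c k b"] r_pos[of k] by auto
    with b j show "v \<beta> k x = t \<beta> k *\<^sub>R (x - c k b)" using v_in by blast
  next
    assume "j \<noteq> k"
    then show "v \<beta> k x = 0" using U_not_level_outside[OF b] v_outside by blast
  qed
qed

text \<open>Within one cube of level \<open>k\<close> the map is affine, and the diameter bound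
  turns |x - z| into (n r)^(1-\<alpha>) |x - z|^\<alpha> with r = \<open>r k\<close>. Points of
  different cubes, one of them of level \<open>k\<close>, are at least \<open>r k / 4\<close> apart,
  and the bound on the values of \<open>v\<close> suffices. Both cases give the factor
  2^((\<alpha>-\<beta>)k).\<close>

lemma hbound_v:
  assumes \<alpha>: "0 < \<alpha>" "\<alpha> < 1" "\<alpha> < \<beta>"
  shows "hbound \<alpha> (8 * real CARD('n) * 2 powr (- ((\<beta> - \<alpha>) * real k))) U (v \<beta> k)"
proof -
  let ?n = "real CARD('n)" and ?t = "t \<beta> k"
  \<comment> \<open>The 8 comes from points in different cubes: the rough bound
    \<open>2 * (?n * ?q)\<close> for the difference of the values is compared with
    \<open>r k powr \<alpha> / 4\<close>.\<close>
  let ?C = "8 * ?n * 2 powr (- ((\<beta> - \<alpha>) * real k))"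
  let ?q = "2 powr (- (\<beta> * real k))"
  have n1: "?n \<ge> 1" by (simp add: Suc_le_eq)
  have r2: "r k = 2 powr (- real k)" by (simp add: r_def powr_minus powr_realpow power_one_over inverse_eq_divide)
  have ra: "r k powr \<alpha> = 2 powr (- (\<alpha> * real k))" by (simp add: r2 powr_powr mult.commute)
  have Cr: "?C * r k powr \<alpha> = 8 * ?n * ?q"
    by (simp add: ra algebra_simps flip: powr_add)
  have rle: "r k powr \<alpha> \<le> 1" using powr_mono2[of \<alpha> "r k" 1] \<alpha> by (simp add: r_def power_le_one)
  have sup: "norm (v \<beta> k x) \<le> ?n * ?q / 4" if "x \<in> U" for x
  proof (rule v_U_cases[OF that, of k \<beta>])
    fix j b assume b: "b \<in> I j" "x \<in> ocub (c j b) (r j / 4)"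
      "j = k \<Longrightarrow> v \<beta> k x = ?t *\<^sub>R (x - c k b)" "j \<noteq> k \<Longrightarrow> v \<beta> k x = 0"
    show "norm (v \<beta> k x) \<le> ?n * ?q / 4"
    proof (cases "j = k")
      case True
      have "norm (x - c k b) \<le> ?n * (r k / 4)" using b(2) True ocub_subset_cub norm_le_cub by blast
      then have "?t * norm (x - c k b) \<le> ?t * (?n * (r k / 4))" using less_imp_le[OF t_pos[of \<beta> k]] by (rule mult_left_mono)
      then have "norm (v \<beta> k x) \<le> ?t * (?n * (r k / 4))" using b(3)[OF True] by simp
      also have "\<dots> = ?n * (?t * r k) / 4" by simp
      finally show ?thesis unfolding t_r .
    next
      case False
      then show ?thesis using b(4) by simp
    qed
  qed
  show ?thesis unfolding hbound_def
  proof (intro conjI ballI)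
    fix x assume x: "x \<in> U"
    have "?n * ?q / 4 \<le> 8 * ?n * ?q" using n1 by simp
    also have "\<dots> = ?C * r k powr \<alpha>" using Cr by simp
    also have "\<dots> \<le> ?C * 1" using rle by (intro mult_left_mono) auto
    finally have "?n * ?q / 4 \<le> ?C" by (simp only: mult_1_right)
    with sup[OF x] show "norm (v \<beta> k x) \<le> ?C" by (rule order_trans)
    fix z assume z: "z \<in> U"
    show "norm (v \<beta> k x - v \<beta> k z) \<le> ?C * norm (x - z) powr \<alpha>"
    proof (rule v_U_cases[OF x, of k \<beta>], rule v_U_cases[OF z, of k \<beta>])
      fix j b j' b'
      assume b: "b \<in> I j" "x \<in> ocub (c j b) (r j / 4)"
          "j = k \<Longrightarrow> v \<beta> k x = ?t *\<^sub>R (x - c k b)" "j \<noteq> k \<Longrightarrow> v \<beta> k x = 0"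
        and b': "b' \<in> I j'" "z \<in> ocub (c j' b') (r j' / 4)"
          "j' = k \<Longrightarrow> v \<beta> k z = ?t *\<^sub>R (z - c k b')" "j' \<noteq> k \<Longrightarrow> v \<beta> k z = 0"
      show "norm (v \<beta> k x - v \<beta> k z) \<le> ?C * norm (x - z) powr \<alpha>"
      proof (cases "j \<noteq> k \<and> j' \<noteq> k")
        case True
        then show ?thesis using b(4) b'(4) by simp
      next
        case lev: False
        show ?thesis
        proof (cases "(j, b) = (j', b')")
          case True
          with lev have jk: "j = k" "j' = k" "b = b'" by auto
          have "v \<beta> k x - v \<beta> k z = ?t *\<^sub>R (x - z)"
            using b(3)[OF jk(1)] b'(3)[OF jk(2)] jk(3) by (simp flip: scaleR_diff_right)
          then have 1: "norm (v \<beta> k x - v \<beta> k z) = ?t * norm (x - z)" using t_pos[of \<beta> k] by simp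
          have "x \<in> cub (c k b) (r k / 4)" "z \<in> cub (c k b) (r k / 4)"
            using b(2) b'(2) jk ocub_subset_cub by blast+
          then have "z \<in> cub x (r k / 4 + r k / 4)" using cub_trans[of "c k b" x "r k / 4" "r k / 4"] cub_sym by blast
          then have "norm (z - x) \<le> ?n * (r k / 4 + r k / 4)" by (rule norm_le_cub)
          also have "\<dots> \<le> ?n * r k" by (intro mult_left_mono) auto
          finally have le: "norm (x - z) \<le> ?n * r k" by (simp add: norm_minus_commute)
          have "norm (x - z) = norm (x - z) powr (1 - \<alpha>) * norm (x - z) powr \<alpha>"
            by (cases "x = z") (simp_all flip: powr_add)
          also have "\<dots> \<le> (?n * r k) powr (1 - \<alpha>) * norm (x - z) powr \<alpha>"
            using le \<alpha> by (intro mult_right_mono powr_mono2) auto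
          also have "(?n * r k) powr (1 - \<alpha>) \<le> ?n * r k powr (1 - \<alpha>)"
          proof -
            have "?n powr (1 - \<alpha>) \<le> ?n powr 1" using n1 \<alpha> by (intro powr_mono) auto
            then show ?thesis by (simp add: powr_mult mult_right_mono)
          qed
          finally have "norm (x - z) \<le> ?n * r k powr (1 - \<alpha>) * norm (x - z) powr \<alpha>" by (simp add: mult_right_mono)
          then have "?t * norm (x - z) \<le> ?t * (?n * r k powr (1 - \<alpha>) * norm (x - z) powr \<alpha>)" by (intro mult_left_mono) (auto simp: t_def)
          also have "\<dots> = ?n * (?t * r k powr (1 - \<alpha>)) * norm (x - z) powr \<alpha>" by simp
          also have "?t * r k powr (1 - \<alpha>) = 2 powr (- ((\<beta> - \<alpha>) * real k))"
            by (simp add: t_def r2 powr_powr algebra_simps flip: powr_add)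
          also have "?n * 2 powr (- ((\<beta> - \<alpha>) * real k)) * norm (x - z) powr \<alpha> \<le> ?C * norm (x - z) powr \<alpha>"
            by (intro mult_right_mono) auto
          finally show ?thesis using 1 by simp
        next
          case False
          obtain i where i: "(r j + r j') / 4 \<le> \<bar>x $ i - z $ i\<bar>"
            using cells_apart[OF b(1) b'(1) False] b(2) b'(2) ocub_subset_cub by blast
          have "r k / 4 \<le> (r j + r j') / 4"
            using lev r_pos[of j] r_pos[of j'] by auto
          also have "\<dots> \<le> norm (x - z)" using i component_le_norm_cart[of "x - z" i] by simp
          finally have "(r k / 4) powr \<alpha> \<le> norm (x - z) powr \<alpha>" using \<alpha> by (intro powr_mono2) auto
          moreover have "r k powr \<alpha> / 4 \<le> (r k / 4) powr \<alpha>"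
          proof -
            have "(1/4::real) powr 1 \<le> (1/4) powr \<alpha>" using \<alpha> by (intro powr_mono') auto
            then have "r k powr \<alpha> * (1/4) \<le> r k powr \<alpha> * (1/4) powr \<alpha>" by (intro mult_left_mono) auto
            also have "\<dots> = (r k * (1/4)) powr \<alpha>" by (subst powr_mult) auto
            finally show ?thesis by simp
          qed
          ultimately have lo: "r k powr \<alpha> / 4 \<le> norm (x - z) powr \<alpha>" by linarith
          have "norm (v \<beta> k x - v \<beta> k z) \<le> ?n * ?q / 4 + ?n * ?q / 4"
            using norm_triangle_ineq4[of "v \<beta> k x" "v \<beta> k z"] sup[OF x] sup[OF z] by linarith
          also have "\<dots> \<le> 2 * (?n * ?q)" using n1 by simp
          also have "\<dots> = ?C * (r k powr \<alpha> / 4)" using Cr by (simp add: mult.commute)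
          also have "\<dots> \<le> ?C * norm (x - z) powr \<alpha>" using lo by (intro mult_left_mono) auto
          finally show ?thesis .
        qed
      qed
    qed
  qed
qed

lemma v_tendsto_holder:
  assumes \<alpha>: "0 < \<alpha>" "\<alpha> < 1" "\<alpha> < \<beta>"
  shows "tendsto_holder \<alpha> U (v \<beta>) (\<lambda>x. 0)"
proof -
  let ?C = "\<lambda>k. 8 * real CARD('n) * 2 powr (- ((\<beta> - \<alpha>) * real k))"
  have le: "holder_norm \<alpha> U (v \<beta> k) \<le> ennreal (2 * ?C k)" for k
    by (rule hbound_imp_holder_norm[OF hbound_v[OF \<alpha>]]) simp
  have "(\<lambda>k. (2 * (8 * real CARD('n))) * (2 powr (- (\<beta> - \<alpha>))) ^ k) \<longlonglongrightarrow> (2 * (8 * real CARD('n))) * 0"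
    using powr_less_mono[of "- (\<beta> - \<alpha>)" 0 2] \<alpha> by (intro tendsto_mult tendsto_const LIMSEQ_realpow_zero) auto
  moreover have "(2 powr (- (\<beta> - \<alpha>))) ^ k = 2 powr (- ((\<beta> - \<alpha>) * real k))" for k
    proof -
    have "- (\<beta> - \<alpha>) * real k = - ((\<beta> - \<alpha>) * real k)" by (rule minus_mult_left[symmetric])
    then show ?thesis by (simp only: powr_powr flip: powr_realpow[of "2 powr (- (\<beta> - \<alpha>))", OF powr_gt_zero[THEN iffD2]])
  qed
  ultimately have "(\<lambda>k. 2 * ?C k) \<longlonglongrightarrow> 0" by (simp add: mult.assoc)
  then have lim: "(\<lambda>k. ennreal (2 * ?C k)) \<longlonglongrightarrow> 0" using tendsto_ennrealI by fastforce
  have "(\<lambda>k. holder_norm \<alpha> U (v \<beta> k)) \<longlonglongrightarrow> 0"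
    by (rule tendsto_sandwich[OF _ _ tendsto_const lim]) (use le in auto)
  moreover have "holder_norm \<alpha> U (v \<beta> k) < \<infinity>" for k using le[of k] by (rule le_less_trans) simp
  moreover have "holder_norm \<alpha> U (\<lambda>x. 0 :: real^'n) < \<infinity>"
    using hbound_imp_holder_norm[of \<alpha> 0 U "\<lambda>x. 0 :: real^'n"] by (simp add: hbound_def)
  ultimately show ?thesis unfolding tendsto_holder_def holder_space_def by simp
qed

lemma Lp_norm_diverges:
  assumes p: "1 \<le> p" and \<beta>: "real CARD('n) * \<beta> < p * dim"
  shows "filterlim (\<lambda>k. Lp_norm p (brouwer_degree (v \<beta> k) U)) at_top sequentially"
proof -
  let ?n = "real CARD('n)"
  \<comment> \<open>The rate of growth: at least 2^(dim k) cubes, times the power 1/p of the volume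
    of the image cube, which is of order 2^(-n\<beta>k).\<close>
  define \<epsilon> where "\<epsilon> = dim - ?n * \<beta> / p"
  have \<epsilon>: "\<epsilon> > 0" using p \<beta> by (simp add: \<epsilon>_def pos_divide_less_eq mult.commute)
  have low: "(1/2) powr (?n / p) * (2 powr \<epsilon>) ^ k \<le> Lp_norm p (brouwer_degree (v \<beta> k) U)" for k
  proof -
    let ?N = "real (card (I k))"
    have R2: "2 * R \<beta> k = (1/2) * 2 powr (- (\<beta> * real k))"
      using t_r[of \<beta> k] by (simp add: R_def)
    have N: "2 powr (dim * real k) \<le> ?N" using card_I_lower[of k] by (simp add: powr_powr flip: powr_realpow)
    have "(1/2) powr (?n / p) * (2 powr \<epsilon>) ^ k = 2 powr (dim * real k) * ((1/2) powr (?n / p) * 2 powr (- (\<beta> * real k) * (?n / p)))"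
    proof -
      have "(2 powr \<epsilon>) ^ k = 2 powr (dim * real k) * 2 powr (- (\<beta> * real k) * (?n / p))"
      proof -
        have "\<epsilon> * real k = dim * real k + (- (\<beta> * real k) * (?n / p))"
          by (simp add: \<epsilon>_def left_diff_distrib)
        moreover have "(2 powr \<epsilon>) ^ k = 2 powr (\<epsilon> * real k)" by (simp add: powr_powr flip: powr_realpow)
        ultimately show ?thesis by (simp only: powr_add)
      qed
      then show ?thesis by simp
    qed
    also have "\<dots> = 2 powr (dim * real k) * (2 * R \<beta> k) powr (?n / p)"
      unfolding R2 by (subst powr_mult) (simp_all only: powr_powr)
    also have "\<dots> \<le> ?N * (2 * R \<beta> k) powr (?n / p)" using N by (intro mult_right_mono) auto
    also have "\<dots> = (?N powr p) powr (1 / p) * ((2 * R \<beta> k) powr ?n) powr (1 / p)"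
      using p by (simp add: powr_powr)
    also have "\<dots> = (?N powr p * (2 * R \<beta> k) ^ CARD('n)) powr (1 / p)"
      using R_pos[of \<beta> k] by (simp add: powr_mult powr_realpow)
    also have "\<dots> = Lp_norm p (brouwer_degree (v \<beta> k) U)" by (rule Lp_v(2)[OF p, symmetric])
    finally show ?thesis .
  qed
  have "filterlim (\<lambda>k. (2 powr \<epsilon>) ^ k) at_top sequentially"
    using powr_less_mono[of 0 \<epsilon> 2] \<epsilon> by (intro filterlim_at_infinity_imp_filterlim_at_top filterlim_realpow_sequentially_gt1) auto
  then have "filterlim (\<lambda>k. (1/2) powr (?n / p) * (2 powr \<epsilon>) ^ k) at_top sequentially"
    by (intro filterlim_tendsto_pos_mult_at_top[OF tendsto_const]) auto
  then show ?thesis by (rule filterlim_at_top_mono) (use low in auto)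
qed

text \<open>The degree sees only the values on the closure of \<open>U\<close>, where the extension
  agrees with \<open>v\<close> by continuity.\<close>

lemma counterexample:
  assumes \<alpha>: "0 < \<alpha>" "\<alpha> < 1" "\<alpha> < \<beta>" and p: "1 \<le> p" "real CARD('n) * \<beta> < p * dim"
  shows "degree_in_Lp p U (cont_ext U (v \<beta> k))"
    and "filterlim (\<lambda>k. Lp_norm p (brouwer_degree (cont_ext U (v \<beta> k)) U)) at_top sequentially"
proof -
  have eq: "cont_ext U (v \<beta> k) x = v \<beta> k x" if "x \<in> closure U" for k x
  proof -
    note ext = cont_ext_props[OF hbound_imp_uniformly_continuous[OF hbound_v[OF \<alpha>] \<alpha>(1)]]
    have "norm (cont_ext U (v \<beta> k) x - v \<beta> k x) \<le> 0"
      by (rule continuous_on_closure_norm_le[OF _ _ that])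
         (use ext in \<open>auto intro!: continuous_on_diff v_continuous\<close>)
    then show ?thesis by simp
  qed
  have deg: "brouwer_degree (cont_ext U (v \<beta> k)) U = brouwer_degree (v \<beta> k) U" for k
    by (rule brouwer_degree_cong) (rule eq)
  have "cont_ext U (v \<beta> k) ` frontier U = v \<beta> k ` frontier U"
    by (rule image_cong) (auto simp: frontier_def eq)
  then show "degree_in_Lp p U (cont_ext U (v \<beta> k))"
    using Lp_v(1)[OF p(1), of \<beta> k] by (simp add: degree_in_Lp_def deg)
  show "filterlim (\<lambda>k. Lp_norm p (brouwer_degree (cont_ext U (v \<beta> k)) U)) at_top sequentially"
    unfolding deg by (rule Lp_norm_diverges[OF p])
qed

end

theorem theorem1p2:
  fixes \<alpha> d p :: real
  assumes "0 < \<alpha>" and "\<alpha> < 1"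
    and "real CARD('n::finite) - 1 < d" and "d < real CARD('n)"
    and "1 \<le> p"
  shows "(p < real CARD('n) * \<alpha> / d \<longrightarrow>
           (\<forall>(U :: (real^'n) set) (u :: nat \<Rightarrow> real^'n \<Rightarrow> real^'n) w.
              open U \<and> bounded U \<and> has_box_dim (frontier U) d \<and> tendsto_holder \<alpha> U u w \<longrightarrow>
                (\<forall>k. degree_in_Lp p U (cont_ext U (u k))) \<and>
                degree_in_Lp p U (cont_ext U w) \<and>
                (\<lambda>k. Lp_norm p (\<lambda>y. brouwer_degree (cont_ext U (u k)) U y
                                   - brouwer_degree (cont_ext U w) U y)) \<longlonglongrightarrow> 0))
       \<and> (p > real CARD('n) * \<alpha> / d \<longrightarrow>
           (\<exists>(U :: (real^'n) set) (u :: nat \<Rightarrow> real^'n \<Rightarrow> real^'n).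
              open U \<and> bounded U \<and> has_box_dim (frontier U) d \<and>
              (\<forall>k. degree_in_Lp p U (cont_ext U (u k))) \<and>
              tendsto_holder \<alpha> U u (\<lambda>x. 0) \<and>
              filterlim (\<lambda>k. Lp_norm p (brouwer_degree (cont_ext U (u k)) U)) at_top sequentially))"
proof (intro conjI impI)
  have n1: "1 \<le> real CARD('n)" by (simp add: Suc_le_eq)
  have d: "0 < d" using assms(3) n1 by linarith
  {
    assume p: "p < real CARD('n) * \<alpha> / d"
    show "\<forall>(U :: (real^'n) set) (u :: nat \<Rightarrow> real^'n \<Rightarrow> real^'n) w.
              open U \<and> bounded U \<and> has_box_dim (frontier U) d \<and> tendsto_holder \<alpha> U u w \<longrightarrow>
                (\<forall>k. degree_in_Lp p U (cont_ext U (u k))) \<and>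
                degree_in_Lp p U (cont_ext U w) \<and>
                (\<lambda>k. Lp_norm p (\<lambda>y. brouwer_degree (cont_ext U (u k)) U y
                                   - brouwer_degree (cont_ext U w) U y)) \<longlonglongrightarrow> 0"
    proof (intro allI impI)
      fix U :: "(real^'n) set" and u :: "nat \<Rightarrow> real^'n \<Rightarrow> real^'n" and w
      assume a: "open U \<and> bounded U \<and> has_box_dim (frontier U) d \<and> tendsto_holder \<alpha> U u w"
      then have U: "open U" "bounded U" "has_box_dim (frontier U) d" "tendsto_holder \<alpha> U u w" by auto
      note part = degree_convergence[OF assms(1,2) d assms(5) p U]
      show "(\<forall>k. degree_in_Lp p U (cont_ext U (u k))) \<and> degree_in_Lp p U (cont_ext U w) \<and>
                (\<lambda>k. Lp_norm p (\<lambda>y. brouwer_degree (cont_ext U (u k)) U y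
                                   - brouwer_degree (cont_ext U w) U y)) \<longlonglongrightarrow> 0"
        using part by blast
    qed
  next
    assume p: "p > real CARD('n) * \<alpha> / d"
    \<comment> \<open>The second parameter is chosen such that \<open>dim = d\<close>, and the
      bounds on \<open>d\<close> put it between 0 and 1. The stacking direction is
      arbitrary.\<close>
    interpret cube_layers "undefined :: 'n" "d - (real CARD('n) - 1)"
      by unfold_locales (use assms in auto)
    have dim: "dim = d" by (simp add: dim_def)
    have "\<alpha> < p * d / real CARD('n)"
      using p d n1 by (simp add: field_simps)
    then obtain \<beta> where \<beta>: "\<alpha> < \<beta>" "\<beta> < p * d / real CARD('n)" using dense by blast
    have \<beta>': "real CARD('n) * \<beta> < p * dim"
      using \<beta>(2) n1 by (simp add: dim pos_less_divide_eq mult.commute)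
    note ce = counterexample[OF assms(1,2) \<beta>(1) assms(5) \<beta>']
    show "\<exists>(U :: (real^'n) set) (u :: nat \<Rightarrow> real^'n \<Rightarrow> real^'n).
              open U \<and> bounded U \<and> has_box_dim (frontier U) d \<and>
              (\<forall>k. degree_in_Lp p U (cont_ext U (u k))) \<and>
              tendsto_holder \<alpha> U u (\<lambda>x. 0) \<and>
              filterlim (\<lambda>k. Lp_norm p (brouwer_degree (cont_ext U (u k)) U)) at_top sequentially"
      using open_U bounded_U has_box_dim_U ce v_tendsto_holder[OF assms(1,2) \<beta>(1)]
      by (intro exI[of _ U] exI[of _ "v \<beta>"]) (simp add: dim)
  }
qed

end
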